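(* Let $p\in\mathbb{C}[z_1,z_2]$ be a complex conic. According to the arrangement of the roots of its initial form $\operatorname{in}(p)$ in $\mathbb{P}^1$, the set $\mathcal{I}(p)^{\mathsf c}$ is as follows. (1a) If $\operatorname{in}(p)$ has a double real root: $\mathcal{I}(p)^{\mathsf c}$ is the union of one, two, or three unbounded components. (1b) If $\operatorname{in}(p)$ has two distinct real roots: $\mathcal{I}(p)^{\mathsf c}$ is the union of four unbounded components. (2a) If $\operatorname{in}(p)$ has a double non-real root: $\mathcal{I}(p)^{\mathsf c}$ is empty. (2b) If $\operatorname{in}(p)$ has one real and one non-real root: $\mathcal{I}(p)^{\mathsf c}$ is empty, a single point, or a line segment. (2c) If $\operatorname{in}(p)$ has two distinct non-real roots: $\mathcal{I}(p)^{\mathsf c}$ is empty or one bounded component, possibly open. In particular, the components of $\mathcal{I}(p)^{\mathsf c}$ are spectrahedral in all of the first four classes (1a), (1b), (2a), (2b). This is not true in general for the last class (2c).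
   Context: A complex conic is a polynomial $p=az_1^2+bz_1z_2+cz_2^2+dz_1+ez_2+f$ with $a,\dots,f\in\mathbb{C}$ of total degree exactly two. The imaginary projection is $\mathcal{I}(p)=\{(\operatorname{Im} z_1,\operatorname{Im} z_2) : p(z_1,z_2)=0,\ (z_1,z_2)\in\mathbb{C}^2\}\subseteq\mathbb{R}^2$; $\mathcal{I}(p)^{\mathsf c}$ is its complement in $\mathbb{R}^2$; components are connected components. The initial form $\operatorname{in}(p)=az_1^2+bz_1z_2+cz_2^2$ has two roots $(z_1:z_2)$ in the complex projective line $\mathbb{P}^1$ (with multiplicity); a root is real if it lies in $\mathbb{P}^1_{\mathbb{R}}$. A spectrahedron is a set of the form $\{\mathbf{x}\in\mathbb{R}^n : A_0+\sum_{j=1}^nA_jx_j\succeq 0\}$ with real symmetric matrices $A_0,\dots,A_n$ of the same size, where $\succeq 0$ denotes positive semidefiniteness. A set is also called spectrahedral if it is given by positive definite (strict) conditions of this type.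
   Formalization: In (1b) the complement is the union of four unbounded components and at most one further component, a single point (it occurs for z1 z2 - i, where the origin is isolated); "spectrahedral" allows semidefinite and strict definite conditions together. *)

theory Defs
  imports "HOL-Analysis.Analysis" "Jordan_Normal_Form.Matrix"
begin

section \<open>Complex conics and their imaginary projections\<close>

text \<open>\<open>Quad a b c d e f\<close> is the polynomial
  a z1^2 + b z1 z2 + c z2^2 + d z1 + e z2 + f.\<close>

datatype quad_poly = Quad complex complex complex complex complex complex

fun peval :: "quad_poly \<Rightarrow> complex \<Rightarrow> complex \<Rightarrow> complex" where
  "peval (Quad a b c d e f) z1 z2 =
     a * z1\<^sup>2 + b * z1 * z2 + c * z2\<^sup>2 + d * z1 + e * z2 + f"

fun init_form :: "quad_poly \<Rightarrow> complex \<Rightarrow> complex \<Rightarrow> complex" where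
  "init_form (Quad a b c d e f) z1 z2 = a * z1\<^sup>2 + b * z1 * z2 + c * z2\<^sup>2"

fun complex_conic :: "quad_poly \<Rightarrow> bool" where
  "complex_conic (Quad a b c d e f) \<longleftrightarrow> (a, b, c) \<noteq> (0, 0, 0)"

definition imaginary_projection :: "quad_poly \<Rightarrow> (real \<times> real) set" where
  "imaginary_projection p = {(Im z1, Im z2) | z1 z2. peval p z1 z2 = 0}"

section \<open>Roots of the initial form in the complex projective line\<close>

text \<open>A point (u : v) is the set of all its homogeneous coordinate pairs.\<close>

definition proj_point :: "complex \<Rightarrow> complex \<Rightarrow> (complex \<times> complex) set" where
  "proj_point u v = {(t * u, t * v) | t. t \<noteq> 0}"

definition CP1 :: "(complex \<times> complex) set set" where
  "CP1 = {proj_point u v | u v. (u, v) \<noteq> (0, 0)}"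

definition RP1 :: "(complex \<times> complex) set set" where
  "RP1 = {proj_point (of_real s) (of_real t) | s t. (s, t) \<noteq> (0, 0)}"

text \<open>\<open>init_roots p \<xi> \<eta>\<close>: the roots of in(p), counted with multiplicity, are \<open>\<xi>\<close> and \<open>\<eta>\<close>.
  The linear form v z1 - u z2 has the single root (u : v); the constant factor of in(p) is
  absorbed into the choice of homogeneous coordinates.\<close>

definition init_roots ::
    "quad_poly \<Rightarrow> (complex \<times> complex) set \<Rightarrow> (complex \<times> complex) set \<Rightarrow> bool" where
  "init_roots p \<xi> \<eta> \<longleftrightarrow> \<xi> \<in> CP1 \<and> \<eta> \<in> CP1 \<and>
     (\<exists>u v u' v'. (u, v) \<in> \<xi> \<and> (u', v') \<in> \<eta> \<and>
        (\<forall>z1 z2. init_form p z1 z2 = (v * z1 - u * z2) * (v' * z1 - u' * z2)))"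

definition class_1a :: "quad_poly \<Rightarrow> bool" where
  "class_1a p \<longleftrightarrow> complex_conic p \<and> (\<exists>\<xi>. init_roots p \<xi> \<xi> \<and> \<xi> \<in> RP1)"

definition class_1b :: "quad_poly \<Rightarrow> bool" where
  "class_1b p \<longleftrightarrow> complex_conic p \<and>
     (\<exists>\<xi> \<eta>. init_roots p \<xi> \<eta> \<and> \<xi> \<noteq> \<eta> \<and> \<xi> \<in> RP1 \<and> \<eta> \<in> RP1)"

definition class_2a :: "quad_poly \<Rightarrow> bool" where
  "class_2a p \<longleftrightarrow> complex_conic p \<and> (\<exists>\<xi>. init_roots p \<xi> \<xi> \<and> \<xi> \<notin> RP1)"

definition class_2b :: "quad_poly \<Rightarrow> bool" where
  "class_2b p \<longleftrightarrow> complex_conic p \<and>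
     (\<exists>\<xi> \<eta>. init_roots p \<xi> \<eta> \<and> \<xi> \<in> RP1 \<and> \<eta> \<notin> RP1)"

definition class_2c :: "quad_poly \<Rightarrow> bool" where
  "class_2c p \<longleftrightarrow> complex_conic p \<and>
     (\<exists>\<xi> \<eta>. init_roots p \<xi> \<eta> \<and> \<xi> \<noteq> \<eta> \<and> \<xi> \<notin> RP1 \<and> \<eta> \<notin> RP1)"

section \<open>Spectrahedral sets\<close>

definition sym_mat :: "nat \<Rightarrow> real mat \<Rightarrow> bool" where
  "sym_mat k M \<longleftrightarrow> M \<in> carrier_mat k k \<and> transpose_mat M = M"

definition pos_semidef :: "real mat \<Rightarrow> bool" where
  "pos_semidef M \<longleftrightarrow> (\<forall>v \<in> carrier_vec (dim_row M). scalar_prod v (M *\<^sub>v v) \<ge> 0)"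

definition pos_def :: "real mat \<Rightarrow> bool" where
  "pos_def M \<longleftrightarrow>
     (\<forall>v \<in> carrier_vec (dim_row M). v \<noteq> 0\<^sub>v (dim_row M) \<longrightarrow> scalar_prod v (M *\<^sub>v v) > 0)"

text \<open>The k by k matrix A0 + sum over j of x_j A_j. The coordinates x_j of a point of the
  Euclidean space are its inner products with the standard basis vectors, and the basis
  vectors index the coefficient matrices.\<close>

definition lin_pencil ::
    "nat \<Rightarrow> real mat \<Rightarrow> ('a::euclidean_space \<Rightarrow> real mat) \<Rightarrow> 'a \<Rightarrow> real mat" where
  "lin_pencil k A0 A x =
     mat k k (\<lambda>(i, j). A0 $$ (i, j) + (\<Sum>b\<in>Basis. inner x b * A b $$ (i, j)))"

definition spectrahedron :: "'a::euclidean_space set \<Rightarrow> bool" where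
  "spectrahedron S \<longleftrightarrow> (\<exists>k A0 A. sym_mat k A0 \<and> (\<forall>b\<in>Basis. sym_mat k (A b)) \<and>
     S = {x. pos_semidef (lin_pencil k A0 A x)})"

definition strict_spectrahedron :: "'a::euclidean_space set \<Rightarrow> bool" where
  "strict_spectrahedron S \<longleftrightarrow> (\<exists>k A0 A. sym_mat k A0 \<and> (\<forall>b\<in>Basis. sym_mat k (A b)) \<and>
     S = {x. pos_def (lin_pencil k A0 A x)})"

text \<open>Semidefinite and definite conditions may occur together. This is needed: for
  z1^2 - z2 the complement of the imaginary projection consists of the two open rays of the
  line y1 = 0, and these are neither open nor closed in the plane. The whole plane is both
  a spectrahedron and a strict one, so purely semidefinite and purely definite descriptions are
  included.\<close>

definition spectrahedral :: "'a::euclidean_space set \<Rightarrow> bool" where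
  "spectrahedral S \<longleftrightarrow> (\<exists>T U. spectrahedron T \<and> strict_spectrahedron U \<and> S = T \<inter> U)"

section \<open>An isolated point in the class of two distinct real roots\<close>

text \<open>For z1 z2 - i, whose initial form has two distinct real roots, the complement of the
  imaginary projection has, besides its four unbounded components, a bounded one consisting of a
  single point. The general statement for two distinct real roots has to allow for it.\<close>

lemma class_1b_example: "class_1b (Quad 0 1 0 0 0 (- \<i>))"
proof -
  have "proj_point 0 1 \<noteq> proj_point (-1) 0"
  proof
    assume "proj_point 0 1 = proj_point (-1) 0"
    moreover have "(0, 1) \<in> proj_point 0 1" by (auto simp: proj_point_def)
    ultimately show False by (auto simp: proj_point_def)
  qed
  moreover have "proj_point 0 1 \<in> RP1"
    unfolding RP1_def by (intro CollectI exI[of _ 0] exI[of _ 1]) auto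
  moreover have "proj_point (-1) 0 \<in> RP1"
    unfolding RP1_def by (intro CollectI exI[of _ "-1"] exI[of _ 0]) auto
  moreover have "init_roots (Quad 0 1 0 0 0 (- \<i>)) (proj_point 0 1) (proj_point (-1) 0)"
  proof -
    have "proj_point 0 1 \<in> CP1" "proj_point (-1) 0 \<in> CP1"
      unfolding CP1_def by fastforce+
    moreover have "(0, 1) \<in> proj_point 0 1" "(-1, 0) \<in> proj_point (-1) 0"
      by (auto simp: proj_point_def)
    moreover have "\<forall>z1 z2. init_form (Quad 0 1 0 0 0 (- \<i>)) z1 z2
      = (1 * z1 - 0 * z2) * (0 * z1 - (-1) * z2)" by simp
    ultimately show ?thesis unfolding init_roots_def by blast
  qed
  ultimately show ?thesis
    unfolding class_1b_def complex_conic.simps by (metis one_neq_zero prod.inject)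
qed

lemma class_1b_isolated_point:
  "{(0, 0)} \<in> components (- imaginary_projection (Quad 0 1 0 0 0 (- \<i>)))"
proof -
  define S where "S = - imaginary_projection (Quad 0 1 0 0 0 (- \<i>))"
  have zero: "(0, 0) \<in> S"
  proof -
    have "z1 * z2 \<noteq> \<i>" if "Im z1 = 0" "Im z2 = 0" for z1 z2
      using that by (auto simp: complex_eq_iff)
    then show ?thesis
      unfolding S_def imaginary_projection_def by (auto simp: eq_commute[of 0])
  qed
  have near: "(y1, y2) \<notin> S" if ne: "(y1, y2) \<noteq> (0, 0)" and b: "\<bar>y1\<bar> < 1/2" "\<bar>y2\<bar> < 1/2" for y1 y2
  proof -
    have "\<exists>z1 z2. Im z1 = y1 \<and> Im z2 = y2 \<and> z1 * z2 = \<i>"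
    proof (cases "y2 = 0")
      case True
      then show ?thesis using ne
        by (intro exI[of _ "Complex 0 y1"] exI[of _ "Complex (1/y1) 0"]) (auto simp: complex_eq_iff)
    next
      case False
      define w where "w = sqrt (1 - 4 * y1\<^sup>2 * y2\<^sup>2)"
      define x where "x = (1 + w) / (2 * y2)"
      have "\<bar>y1 * y2\<bar> \<le> 1/2 * (1/2)"
        unfolding abs_mult using b by (intro mult_mono) auto
      then have "(y1 * y2)\<^sup>2 \<le> (1/4)\<^sup>2"
        using power_mono[of "\<bar>y1 * y2\<bar>" "1/4" 2] by simp
      then have le: "4 * y1\<^sup>2 * y2\<^sup>2 \<le> 1"
        using zero_le_power2[of "y1 * y2"] by (simp add: power_mult_distrib power_divide)
      have w: "w\<^sup>2 = 1 - 4 * y1\<^sup>2 * y2\<^sup>2" "w \<ge> 0" unfolding w_def using le by auto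
      have x: "x = y2 * (x\<^sup>2 + y1\<^sup>2)"
      proof -
        have "2 * y2 * x = 1 + w" unfolding x_def using False by simp
        then have "(2 * y2 * x - 1)\<^sup>2 = 1 - 4 * y1\<^sup>2 * y2\<^sup>2" using w by simp
        then have "4 * y2 * (y2 * (x\<^sup>2 + y1\<^sup>2)) = 4 * y2 * x"
          by (simp add: power2_eq_square algebra_simps)
        then show ?thesis using False by simp
      qed
      have x0: "x \<noteq> 0" unfolding x_def using False w(2) by (simp add: add_nonneg_eq_0_iff)
      define n where "n = x\<^sup>2 + y1\<^sup>2"
      have n: "n \<noteq> 0" unfolding n_def using x0 by (simp add: sum_power2_eq_zero_iff)
      have "Complex x y1 * Complex (y1 / n) (x / n) = \<i>"
        using n by (simp add: complex_eq_iff field_simps) (simp add: n_def power2_eq_square)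
      moreover have "x / n = y2" using x n unfolding n_def[symmetric] by (simp add: field_simps)
      ultimately show ?thesis
        by (intro exI[of _ "Complex x y1"] exI[of _ "Complex (y1 / n) (x / n)"]) simp
    qed
    then show ?thesis unfolding S_def imaginary_projection_def by force
  qed
  have box: "S \<inter> ({-1/2<..<1/2} \<times> {-1/2<..<1/2}) = {(0, 0)}"
  proof -
    have "q = (0, 0)" if "q \<in> S" "q \<in> {-1/2<..<1/2} \<times> {-1/2<..<1/2}" for q
    proof (rule ccontr)
      assume "q \<noteq> (0, 0)"
      moreover have "\<bar>fst q\<bar> < 1/2" "\<bar>snd q\<bar> < 1/2"
        using that(2) unfolding abs_less_iff mem_Times_iff by auto
      ultimately show False using near[of "fst q" "snd q"] that(1) by simp
    qed
    moreover have "(0, 0) \<in> {-1/2<..<1/2::real} \<times> {-1/2<..<1/2::real}" by simp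
    ultimately show ?thesis using zero by blast
  qed
  have "connected_component_set S (0, 0) = {(0, 0)}"
  proof -
    let ?C = "connected_component_set S (0, 0)"
    have sub: "?C \<subseteq> S" by (rule connected_component_subset)
    have in0: "(0, 0) \<in> ?C" using zero by (simp add: connected_component_refl)
    have "?C \<inter> ({-1/2<..<1/2} \<times> {-1/2<..<1/2}) = {(0, 0)}" using box sub in0 by blast
    then have "openin (top_of_set ?C) {(0, 0)}"
      by (metis open_Times open_greaterThanLessThan openin_open)
    moreover have "closedin (top_of_set ?C) {(0, 0)}"
      using in0 by (intro closed_subset) auto
    ultimately show ?thesis
      using connected_connected_component[of S "(0, 0)"] unfolding connected_clopen by blast
  qed
  then show ?thesis using zero componentsI unfolding S_def by metis
qed

end

theory Submission
  imports Defs
begin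

text \<open>A real affine change of coordinates combined with a complex translation carries the complement of
  the imaginary projection along, so each class is reduced to a normal form: \<open>z1\<^sup>2 = k\<close> or
  \<open>z2 = \<gamma> * z1\<^sup>2\<close> in class (1a), \<open>z1 * z2 = k\<close> in (1b) and \<open>z2 * (z1 - \<i> * z2) = k\<close> in (2b); there the
  existence of a real part for a given imaginary part is a quadratic or cubic condition. If both roots
  of the initial form lie in the same open half plane, a winding argument shows that every imaginary
  part occurs. If they lie in opposite half planes, the form is diagonalized by a real basis,
  \<open>z1\<^sup>2 + \<omega> * z2\<^sup>2 = k\<close> with \<open>\<omega>\<close> not a nonpositive real, and the imaginary projection is monotone in the
  absolute values of the two coordinates; hence the complement is star-shaped about 0 and bounded.

  For \<open>z1\<^sup>2 + \<i> * z2\<^sup>2 + 1\<close> the boundary of the complement near (1, 0) is a curve of the form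
  \<open>y1 = 1 - c * \<bar>y2\<bar> powr (4/3)\<close> to leading order. The set where a linear pencil is semidefinite cannot
  have such a boundary, because second-order perturbation theory forces it to extend up to
  \<open>y1 = 1 - K * y2\<^sup>2\<close>.\<close>

section \<open>Affine maps of the plane\<close>

text \<open>On a translate of the real plane a linear factor z1 - \<rho> * z2 winds once around 0,
  in a direction given by the sign of Im \<rho>. Roots in one half plane add up to winding number 2
  in absolute value and so force a zero; roots in opposite half planes cancel, topology gives
  nothing, and an explicit normal form is needed there. The obstacle for the spectrahedral claims is
  that components may be neither open nor closed: open rays, an open segment, a closed quadrant
  without its vertex. All of them are described by one semidefinite and one definite two by two
  block. Such sets are convex, so the same description also yields connectedness. For the negative
  example, let P be the form of the pencil at (1, 0) and C the form of its y2-coefficient. Points of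
  the set approach (1, 0) from both sides of the first axis, which forces C to vanish wherever P
  does. A shift of y2 by \<epsilon> then costs only order \<epsilon>^2, and a step of order
  \<epsilon>^2 from (1, 0) towards the origin pays for it.\<close>

definition affine_map :: "(real \<times> real \<Rightarrow> real \<times> real) \<Rightarrow> bool" where
  "affine_map \<phi> \<longleftrightarrow> (\<exists>a b c d r t. a * d - b * c \<noteq> 0 \<and>
     \<phi> = (\<lambda>x. (a * fst x + b * snd x + r, c * fst x + d * snd x + t)))"

definition affine_fun :: "(real \<times> real \<Rightarrow> real) \<Rightarrow> bool" where
  "affine_fun l \<longleftrightarrow> (\<exists>r a b. l = (\<lambda>x. r + a * fst x + b * snd x))"

lemma affine_map_inverse:
  assumes "affine_map \<phi>"
  obtains \<psi> where "affine_map \<psi>" "\<And>x. \<psi> (\<phi> x) = x" "\<And>x. \<phi> (\<psi> x) = x"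
proof -
  obtain a b c d r t where D: "a * d - b * c \<noteq> 0"
    and \<phi>: "\<phi> = (\<lambda>x. (a * fst x + b * snd x + r, c * fst x + d * snd x + t))"
    using assms unfolding affine_map_def by blast
  define D where "D = a * d - b * c"
  have D0: "D \<noteq> 0" using D D_def by simp
  define \<psi> where "\<psi> = (\<lambda>x. (d / D * fst x + (- b / D) * snd x + (b * t - d * r) / D,
      (- c / D) * fst x + a / D * snd x + (c * r - a * t) / D))"
  have "d / D * (a / D) - (- b / D) * (- c / D) = (a * d - b * c) / D / D"
    by (simp add: diff_divide_distrib mult.commute)
  then have "d / D * (a / D) - (- b / D) * (- c / D) = 1 / D"
    using D0 unfolding D_def[symmetric] by simp
  then have "affine_map \<psi>" unfolding affine_map_def \<psi>_def using D0
    by (metis divide_eq_0_iff zero_neq_one)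
  moreover have "\<psi> (\<phi> x) = x" for x
  proof -
    have "d * (a * fst x + b * snd x + r) - b * (c * fst x + d * snd x + t) + (b * t - d * r) = D * fst x"
      "- c * (a * fst x + b * snd x + r) + a * (c * fst x + d * snd x + t) + (c * r - a * t) = D * snd x"
      by (simp_all add: D_def algebra_simps)
    then show ?thesis unfolding \<phi> \<psi>_def using D0
      by (auto simp: prod_eq_iff simp flip: add_divide_distrib diff_divide_distrib)
  qed
  moreover have "\<phi> (\<psi> x) = x" for x
  proof -
    have "a * (d * fst x - b * snd x + (b * t - d * r)) + b * (a * snd x - c * fst x + (c * r - a * t)) = D * (fst x - r)"
      "c * (d * fst x - b * snd x + (b * t - d * r)) + d * (a * snd x - c * fst x + (c * r - a * t)) = D * (snd x - t)"
      by (simp_all add: D_def algebra_simps)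
    then have "(a * (d * fst x - b * snd x + (b * t - d * r)) + b * (a * snd x - c * fst x + (c * r - a * t))) / D = fst x - r"
      "(c * (d * fst x - b * snd x + (b * t - d * r)) + d * (a * snd x - c * fst x + (c * r - a * t))) / D = snd x - t"
      using D0 by simp_all
    then show ?thesis unfolding \<phi> \<psi>_def
      by (simp add: prod_eq_iff add_divide_distrib diff_divide_distrib algebra_simps)
  qed
  ultimately show thesis using that by blast
qed

lemma affine_map_continuous: "affine_map \<phi> \<Longrightarrow> continuous_on S \<phi>"
  unfolding affine_map_def by (auto intro!: continuous_intros)

lemma affine_map_inj: "affine_map \<phi> \<Longrightarrow> inj \<phi>"
  by (metis affine_map_inverse injI)

lemma bounded_aff_image:
  assumes "affine_map \<phi>"
  shows "bounded (\<phi> ` S) \<longleftrightarrow> bounded S"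
proof -
  have *: "bounded (\<phi> ` S)" if "affine_map \<phi>" "bounded S" for \<phi> S
  proof -
    have "compact (\<phi> ` closure S)"
      using that affine_map_continuous compact_closure compact_continuous_image by blast
    then show ?thesis
      by (meson bounded_subset closure_subset compact_imp_bounded image_mono)
  qed
  obtain \<psi> where \<psi>: "affine_map \<psi>" "\<And>x. \<psi> (\<phi> x) = x" using affine_map_inverse assms by metis
  then have "\<psi> ` \<phi> ` S = S" by (simp add: image_image)
  then show ?thesis using * assms \<psi>(1) by metis
qed

lemma components_aff_image:
  assumes "affine_map \<phi>"
  shows "components (\<phi> ` S) = image \<phi> ` components S"
proof -
  have *: "\<phi> ` C \<in> components (\<phi> ` S)" if \<phi>: "affine_map \<phi>" and CS: "C \<in> components S" for \<phi> C S
  proof -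
    obtain \<psi> where \<psi>: "affine_map \<psi>" "\<And>x. \<psi> (\<phi> x) = x" "\<And>x. \<phi> (\<psi> x) = x"
      using affine_map_inverse \<phi> by metis
    have C: "C \<noteq> {}" "C \<subseteq> S" "connected C"
      using CS in_components_nonempty in_components_subset in_components_connected by blast+
    have C4: "d = C" if "d \<noteq> {}" "C \<subseteq> d" "d \<subseteq> S" "connected d" for d
      using \<open>C \<in> components S\<close> that unfolding in_components_maximal by blast
    show ?thesis unfolding in_components_maximal
    proof (intro conjI allI impI)
      show "connected (\<phi> ` C)"
        using C(3) affine_map_continuous connected_continuous_image \<phi> by blast
      fix d assume d: "d \<noteq> {} \<and> \<phi> ` C \<subseteq> d \<and> d \<subseteq> \<phi> ` S \<and> connected d"
      have "\<psi> ` d = C"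
      proof (rule C4)
        show "connected (\<psi> ` d)" using d affine_map_continuous connected_continuous_image \<psi>(1) by blast
        show "C \<subseteq> \<psi> ` d" using image_mono[of "\<phi> ` C" d \<psi>] d \<psi>(2) by (simp add: image_image)
        show "\<psi> ` d \<subseteq> S" using image_mono[of d "\<phi> ` S" \<psi>] d \<psi>(2) by (simp add: image_image)
      qed (use d in auto)
      then have "\<phi> ` \<psi> ` d = \<phi> ` C" by simp
      then show "d = \<phi> ` C" using \<psi>(3) by (simp add: image_image)
    qed (use C in auto)
  qed
  obtain \<psi> where \<psi>: "affine_map \<psi>" "\<And>x. \<psi> (\<phi> x) = x" "\<And>x. \<phi> (\<psi> x) = x"
    using affine_map_inverse assms by metis
  show ?thesis
  proof
    show "image \<phi> ` components S \<subseteq> components (\<phi> ` S)" using * assms by blast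
    show "components (\<phi> ` S) \<subseteq> image \<phi> ` components S"
    proof
      fix D assume "D \<in> components (\<phi> ` S)"
      then have "\<psi> ` D \<in> components (\<psi> ` \<phi> ` S)" using * \<psi>(1) by blast
      moreover have "\<psi> ` \<phi> ` S = S" "\<phi> ` \<psi> ` D = D" using \<psi> by (simp_all add: image_image)
      ultimately show "D \<in> image \<phi> ` components S" by (metis image_eqI)
    qed
  qed
qed

text \<open>Every piece is relatively open in \<open>S\<close>, hence so is the union of the
  remaining pieces, and a connected subset of \<open>S\<close> containing one piece cannot leave it.
  Openness is relative because some pieces are rays or a single point.\<close>

lemma components_partition:
  assumes S: "S = \<Union>F" and con: "\<And>C. C \<in> F \<Longrightarrow> connected C \<and> C \<noteq> {}"
    and dis: "\<And>C D. C \<in> F \<Longrightarrow> D \<in> F \<Longrightarrow> C \<noteq> D \<Longrightarrow> C \<inter> D = {}"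
    and op: "\<And>C. C \<in> F \<Longrightarrow> \<exists>U. open U \<and> S \<inter> U = C"
  shows "components S = F"
proof -
  have in_comp: "C \<in> components S" if C: "C \<in> F" for C
    unfolding in_components_maximal
  proof (intro conjI allI impI)
    show "C \<subseteq> S" using C S by auto
    fix d assume d: "d \<noteq> {} \<and> C \<subseteq> d \<and> d \<subseteq> S \<and> connected d"
    obtain U where U: "open U" "S \<inter> U = C" using op C by auto
    \<comment> \<open>\<open>W\<close> is the largest open set disjoint from \<open>C\<close>. It
      covers the rest of \<open>S\<close>: an open set cutting out another piece \<open>D\<close>
      misses \<open>C\<close>, because \<open>C\<close> lies in \<open>S\<close>.\<close>
    define W where "W = \<Union>{V. open V \<and> V \<inter> C = {}}"
    have W: "open W" "W \<inter> C = {}" unfolding W_def by auto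
    have "x \<in> U \<or> x \<in> W" if x: "x \<in> S" for x
    proof (cases "x \<in> C")
      case True
      then show ?thesis using U by auto
    next
      case False
      obtain D where D: "D \<in> F" "x \<in> D" using x S by auto
      then obtain V where V: "open V" "S \<inter> V = D" using op by blast
      have "D \<inter> C = {}" using dis[OF D(1) C] D False by auto
      then have "V \<inter> C = {}" using V(2) \<open>C \<subseteq> S\<close> by auto
      then show ?thesis using V D(2) unfolding W_def by auto
    qed
    then have "d \<subseteq> U \<union> W" using d by auto
    moreover have "U \<inter> W \<inter> d = {}" using d U(2) W(2) by auto
    moreover have "U \<inter> d \<noteq> {}" using con[OF C] d U(2) by auto
    ultimately have "W \<inter> d = {}" using connectedD[of d U W] d U(1) W(1) by auto
    then show "d = C" using d U(2) \<open>d \<subseteq> U \<union> W\<close> by auto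
  qed (use con C in auto)
  have "C \<in> F" if "C \<in> components S" for C
  proof -
    have "C \<noteq> {}" "C \<subseteq> S" using that in_components_nonempty[of C S] in_components_subset[of C S] by simp_all
    then obtain x where x: "x \<in> C" "x \<in> S" by auto
    then obtain D where D: "D \<in> F" "x \<in> D" using S by auto
    then show ?thesis using in_comp[OF D(1)] \<open>C \<in> components S\<close> x components_eq by (metis disjoint_iff)
  qed
  then show ?thesis using in_comp by auto
qed

text \<open>A predicate in place of a \<open>quad_poly\<close> lets normal forms such as z2 =
  \<gamma> * z1^2 be used as they stand, without being rewritten as coefficient tuples.\<close>

definition imaginary_set :: "(complex \<Rightarrow> complex \<Rightarrow> bool) \<Rightarrow> (real \<times> real) set" where
  "imaginary_set P = {(Im z1, Im z2) | z1 z2. P z1 z2}"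

lemma imaginary_set_iff: "(y1, y2) \<in> imaginary_set P \<longleftrightarrow> (\<exists>x1 x2. P (Complex x1 y1) (Complex x2 y2))"
proof
  assume "(y1, y2) \<in> imaginary_set P"
  then obtain z1 z2 where "y1 = Im z1" "y2 = Im z2" "P z1 z2" unfolding imaginary_set_def by auto
  then show "\<exists>x1 x2. P (Complex x1 y1) (Complex x2 y2)"
    by (intro exI[of _ "Re z1"] exI[of _ "Re z2"]) simp
next
  assume "\<exists>x1 x2. P (Complex x1 y1) (Complex x2 y2)"
  then obtain x1 x2 where "P (Complex x1 y1) (Complex x2 y2)" by auto
  then show "(y1, y2) \<in> imaginary_set P" unfolding imaginary_set_def
    by (intro CollectI exI[of _ "Complex x1 y1"] exI[of _ "Complex x2 y2"]) simp
qed

lemma imaginary_projection_imaginary_set: "imaginary_projection p = imaginary_set (\<lambda>z1 z2. peval p z1 z2 = 0)"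
  unfolding imaginary_projection_def imaginary_set_def by simp

text \<open>The linear part of the substitution is real, so it acts on imaginary parts by itself;
  the translation by \<open>w1\<close>, \<open>w2\<close> may be complex and shifts them by its
  imaginary part only. Bijectivity carries the statement over to complements.\<close>

lemma compl_imaginary_set_aff:
  fixes a b c d :: real
  assumes D: "a * d - b * c \<noteq> 0"
    and PQ: "\<And>Z1 Z2. P (of_real a * Z1 + of_real b * Z2 + w1) (of_real c * Z1 + of_real d * Z2 + w2) \<longleftrightarrow> Q Z1 Z2"
  shows "\<exists>\<phi>. affine_map \<phi> \<and> - imaginary_set P = \<phi> ` (- imaginary_set Q)"
proof -
  define \<phi> where "\<phi> = (\<lambda>x. (a * fst x + b * snd x + Im w1, c * fst x + d * snd x + Im w2))"
  have aff: "affine_map \<phi>" unfolding affine_map_def \<phi>_def using D by blast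
  then obtain \<psi> where \<psi>: "\<And>x. \<phi> (\<psi> x) = x" using affine_map_inverse by metis
  have "imaginary_set P = \<phi> ` imaginary_set Q"
  proof
    show "\<phi> ` imaginary_set Q \<subseteq> imaginary_set P"
    proof
      fix x assume "x \<in> \<phi> ` imaginary_set Q"
      then obtain Z1 Z2 where Z: "Q Z1 Z2" "x = \<phi> (Im Z1, Im Z2)" unfolding imaginary_set_def by blast
      then have "P (of_real a * Z1 + of_real b * Z2 + w1) (of_real c * Z1 + of_real d * Z2 + w2)" using PQ by simp
      moreover have "x = (Im (of_real a * Z1 + of_real b * Z2 + w1), Im (of_real c * Z1 + of_real d * Z2 + w2))"
        unfolding Z(2) \<phi>_def by simp
      ultimately show "x \<in> imaginary_set P" unfolding imaginary_set_def by blast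
    qed
    show "imaginary_set P \<subseteq> \<phi> ` imaginary_set Q"
    proof
      fix x assume "x \<in> imaginary_set P"
      then obtain z1 z2 where z: "P z1 z2" "x = (Im z1, Im z2)" unfolding imaginary_set_def by blast
      define D where "D = complex_of_real (a * d - b * c)"
      have D0: "D \<noteq> 0" using assms(1) unfolding D_def by (metis of_real_eq_0_iff)
      define Z1 where "Z1 = (of_real d * (z1 - w1) - of_real b * (z2 - w2)) / D"
      define Z2 where "Z2 = (of_real a * (z2 - w2) - of_real c * (z1 - w1)) / D"
      have "of_real a * (of_real d * (z1 - w1) - of_real b * (z2 - w2))
          + of_real b * (of_real a * (z2 - w2) - of_real c * (z1 - w1)) = D * (z1 - w1)"
        "of_real c * (of_real d * (z1 - w1) - of_real b * (z2 - w2))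
          + of_real d * (of_real a * (z2 - w2) - of_real c * (z1 - w1)) = D * (z2 - w2)"
        by (simp_all add: D_def algebra_simps)
      then have e: "of_real a * Z1 + of_real b * Z2 + w1 = z1" "of_real c * Z1 + of_real d * Z2 + w2 = z2"
        unfolding Z1_def Z2_def times_divide_eq_right add_divide_distrib[symmetric] using D0 by simp_all
      have "x = \<phi> (Im Z1, Im Z2)"
        unfolding z(2) \<phi>_def e(1)[symmetric] e(2)[symmetric] by simp
      moreover have "Q Z1 Z2" using PQ[of Z1 Z2] e z(1) by simp
      ultimately show "x \<in> \<phi> ` imaginary_set Q" unfolding imaginary_set_def by blast
    qed
  qed
  moreover have "surj \<phi>" using \<psi> by (metis surjI)
  ultimately have "- imaginary_set P = \<phi> ` (- imaginary_set Q)"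
    using affine_map_inj[OF aff] by (simp add: bij_image_Compl_eq bij_betw_def)
  then show ?thesis using aff by blast
qed

section \<open>Spectrahedral sets given by two by two matrices\<close>

text \<open>By the criteria on minors, the matrix with rows (l1, l3), (l3, l2) is semidefinite and
  the one with rows (l4, l6), (l6, l5) is definite. Constant entries make either block vacuous.
  Unlike general pencils, this form is easily transported along affine maps and seen to be
  convex.\<close>

definition spectrahedral2 :: "(real \<times> real) set \<Rightarrow> bool" where
  "spectrahedral2 S \<longleftrightarrow> (\<exists>l1 l2 l3 l4 l5 l6. affine_fun l1 \<and> affine_fun l2 \<and> affine_fun l3 \<and> affine_fun l4 \<and> affine_fun l5 \<and> affine_fun l6 \<and>
     S = {x. 0 \<le> l1 x \<and> 0 \<le> l2 x \<and> (l3 x)\<^sup>2 \<le> l1 x * l2 x \<and> 0 < l4 x \<and> (l6 x)\<^sup>2 < l4 x * l5 x})"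

lemma spectrahedral2I:
  assumes "affine_fun l1" "affine_fun l2" "affine_fun l3" "affine_fun l4" "affine_fun l5" "affine_fun l6"
    and "S = {x. 0 \<le> l1 x \<and> 0 \<le> l2 x \<and> (l3 x)\<^sup>2 \<le> l1 x * l2 x \<and> 0 < l4 x \<and> (l6 x)\<^sup>2 < l4 x * l5 x}"
  shows "spectrahedral2 S"
  unfolding spectrahedral2_def
  by (rule exI[of _ l1], rule exI[of _ l2], rule exI[of _ l3], rule exI[of _ l4], rule exI[of _ l5],
      rule exI[of _ l6], intro conjI; rule assms)

lemma affine_fun_comp:
  assumes "affine_map \<phi>" "affine_fun l"
  shows "affine_fun (\<lambda>x. l (\<phi> x))"
proof -
  obtain a b c d r t where
    \<phi>: "\<phi> = (\<lambda>x. (a * fst x + b * snd x + r, c * fst x + d * snd x + t))"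
    using assms unfolding affine_map_def by blast
  obtain p q s where l: "l = (\<lambda>x. p + q * fst x + s * snd x)"
    using assms unfolding affine_fun_def by blast
  show ?thesis unfolding affine_fun_def l \<phi>
    by (intro exI[of _ "p + q * r + s * t"] exI[of _ "q * a + s * c"] exI[of _ "q * b + s * d"])
       (simp add: fun_eq_iff algebra_simps)
qed

lemma spectrahedral2_aff_image:
  assumes "affine_map \<phi>" "spectrahedral2 S"
  shows "spectrahedral2 (\<phi> ` S)"
proof -
  obtain \<psi> where \<psi>: "affine_map \<psi>" "\<And>x. \<psi> (\<phi> x) = x" "\<And>x. \<phi> (\<psi> x) = x"
    using affine_map_inverse assms by metis
  obtain l1 l2 l3 l4 l5 l6 where l: "affine_fun l1" "affine_fun l2" "affine_fun l3" "affine_fun l4" "affine_fun l5" "affine_fun l6"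
    "S = {x. 0 \<le> l1 x \<and> 0 \<le> l2 x \<and> (l3 x)\<^sup>2 \<le> l1 x * l2 x \<and> 0 < l4 x \<and> (l6 x)\<^sup>2 < l4 x * l5 x}"
    using assms(2) unfolding spectrahedral2_def by (elim exE conjE) (rule that; assumption)
  have "\<phi> ` S = {x. \<psi> x \<in> S}"
  proof (intro Set.set_eqI iffI)
    fix x assume "x \<in> {x. \<psi> x \<in> S}"
    then show "x \<in> \<phi> ` S" by (metis \<psi>(3) image_eqI mem_Collect_eq)
  qed (use \<psi>(2) in auto)
  then have "\<phi> ` S = {x. 0 \<le> l1 (\<psi> x) \<and> 0 \<le> l2 (\<psi> x) \<and> (l3 (\<psi> x))\<^sup>2 \<le> l1 (\<psi> x) * l2 (\<psi> x)
      \<and> 0 < l4 (\<psi> x) \<and> (l6 (\<psi> x))\<^sup>2 < l4 (\<psi> x) * l5 (\<psi> x)}"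
    unfolding l(7) by simp
  then show ?thesis
    by (intro spectrahedral2I[OF affine_fun_comp[OF \<psi>(1) l(1)] affine_fun_comp[OF \<psi>(1) l(2)] affine_fun_comp[OF \<psi>(1) l(3)]
       affine_fun_comp[OF \<psi>(1) l(4)] affine_fun_comp[OF \<psi>(1) l(5)] affine_fun_comp[OF \<psi>(1) l(6)]])
qed

lemma pencil2:
  assumes "affine_fun l1" "affine_fun l2" "affine_fun l3"
  obtains A0 A where "sym_mat 2 A0" "\<And>b. sym_mat 2 (A b)"
    "\<And>x. lin_pencil 2 A0 A x = mat 2 2 (\<lambda>(i, j). if i = j then if i = 0 then l1 x else l2 x else l3 x)"
proof -
  obtain r1 a1 b1 where l1: "l1 = (\<lambda>x. r1 + a1 * fst x + b1 * snd x)"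
    using assms(1) unfolding affine_fun_def by blast
  obtain r2 a2 b2 where l2: "l2 = (\<lambda>x. r2 + a2 * fst x + b2 * snd x)"
    using assms(2) unfolding affine_fun_def by blast
  obtain r3 a3 b3 where l3: "l3 = (\<lambda>x. r3 + a3 * fst x + b3 * snd x)"
    using assms(3) unfolding affine_fun_def by blast
  define A0 :: "real mat" where "A0 = mat 2 2 (\<lambda>(i, j). if i = j then if i = 0 then r1 else r2 else r3)"
  define A :: "real \<times> real \<Rightarrow> real mat" where
    "A b = mat 2 2 (\<lambda>(i, j). if i = j then if i = 0 then a1 * fst b + b1 * snd b else a2 * fst b + b2 * snd b
       else a3 * fst b + b3 * snd b)" for b
  have "sym_mat 2 A0" "sym_mat 2 (A b)" for b
    unfolding sym_mat_def A0_def A_def by auto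
  moreover have "lin_pencil 2 A0 A x = mat 2 2 (\<lambda>(i, j). if i = j then if i = 0 then l1 x else l2 x else l3 x)" for x
    unfolding lin_pencil_def A0_def A_def l1 l2 l3
    by (intro cong_mat) (auto simp: Basis_prod_def sum.union_disjoint inner_prod_def algebra_simps)
  ultimately show thesis using that by blast
qed

lemma quad_form2:
  fixes p q r :: real
  assumes "v \<in> carrier_vec 2"
  shows "scalar_prod v (mat 2 2 (\<lambda>(i, j). if i = j then if i = 0 then p else q else r) *\<^sub>v v)
    = p * (v $ 0)\<^sup>2 + 2 * r * (v $ 0) * (v $ 1) + q * (v $ 1)\<^sup>2"
  using assms by (simp add: scalar_prod_def row_def numeral_2_eq_2 power2_eq_square algebra_simps)

lemma spectrahedron2:
  assumes "affine_fun l1" "affine_fun l2" "affine_fun l3"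
  shows "spectrahedron {x. 0 \<le> l1 x \<and> 0 \<le> l2 x \<and> (l3 x)\<^sup>2 \<le> l1 x * l2 x}"
proof -
  obtain A0 A where A: "sym_mat 2 A0" "\<And>b. sym_mat 2 (A b)"
    "\<And>x. lin_pencil 2 A0 A x = mat 2 2 (\<lambda>(i, j). if i = j then if i = 0 then l1 x else l2 x else l3 x)"
    by (rule pencil2[OF assms]) (rule that)
  have "pos_semidef (mat 2 2 (\<lambda>(i, j). if i = j then if i = 0 then p else q else r)) \<longleftrightarrow> 0 \<le> p \<and> 0 \<le> q \<and> r\<^sup>2 \<le> p * q"
    (is "?L \<longleftrightarrow> ?R") for p q r :: real
  proof
    assume ?L
    then have *: "0 \<le> p * (v $ 0)\<^sup>2 + 2 * r * (v $ 0) * (v $ 1) + q * (v $ 1)\<^sup>2" if "v \<in> carrier_vec 2" for v :: "real vec"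
      by (subst quad_form2[OF that, symmetric]) (use \<open>?L\<close> that in \<open>simp add: pos_semidef_def\<close>)
    have **: "0 \<le> p * s\<^sup>2 + 2 * r * s * t + q * t\<^sup>2" for s t
      using *[of "vec_of_list [s, t]"] by (simp add: vec_of_list_index carrier_vecI)
    have pq: "0 \<le> p" "0 \<le> q" using **[of 1 0] **[of 0 1] by auto
    have "r\<^sup>2 \<le> p * q"
    proof (cases "p = 0")
      case True
      have "r = 0"
      proof (rule ccontr)
        assume "r \<noteq> 0"
        \<comment> \<open>With p = 0 the form takes the value -1 at this vector.\<close>
        then show False using **[of "- (q + 1) / (2 * r)" 1] True by (simp add: field_simps)
      qed
      then show ?thesis using pq by simp
    next
      case False
      \<comment> \<open>The vector (- r, p) is proportional to the minimizer on the line t = 1; the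
        form there is p times the determinant.\<close>
      have "0 \<le> p * (p * q - r\<^sup>2)" using **[of "- r" p] by (simp add: power2_eq_square algebra_simps)
      then show ?thesis using False pq by (simp add: zero_le_mult_iff)
    qed
    then show ?R using pq by simp
  next
    assume R: ?R
    have "0 \<le> p * s\<^sup>2 + 2 * r * s * t + q * t\<^sup>2" for s t
    proof (cases "p = 0")
      case True
      then show ?thesis using R by simp
    next
      case False
      have "p * (p * s\<^sup>2 + 2 * r * s * t + q * t\<^sup>2) = (p * s + r * t)\<^sup>2 + (p * q - r\<^sup>2) * t\<^sup>2"
        by (simp add: power2_eq_square algebra_simps)
      also have "\<dots> \<ge> 0" using R by simp
      finally show ?thesis using False R by (simp add: zero_le_mult_iff)
    qed
    then show ?L by (simp add: pos_semidef_def quad_form2)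
  qed
  then show ?thesis unfolding spectrahedron_def
    by (intro exI[of _ 2] exI[of _ A0] exI[of _ A]) (simp add: A)
qed

lemma strict_spectrahedron2:
  assumes "affine_fun l1" "affine_fun l2" "affine_fun l3"
  shows "strict_spectrahedron {x. 0 < l1 x \<and> (l3 x)\<^sup>2 < l1 x * l2 x}"
proof -
  obtain A0 A where A: "sym_mat 2 A0" "\<And>b. sym_mat 2 (A b)"
    "\<And>x. lin_pencil 2 A0 A x = mat 2 2 (\<lambda>(i, j). if i = j then if i = 0 then l1 x else l2 x else l3 x)"
    by (rule pencil2[OF assms]) (rule that)
  have "pos_def (mat 2 2 (\<lambda>(i, j). if i = j then if i = 0 then p else q else r)) \<longleftrightarrow> 0 < p \<and> r\<^sup>2 < p * q"
    (is "?L \<longleftrightarrow> ?R") for p q r :: real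
  proof
    assume ?L
    then have *: "0 < p * (v $ 0)\<^sup>2 + 2 * r * (v $ 0) * (v $ 1) + q * (v $ 1)\<^sup>2" if "v \<in> carrier_vec 2" "v \<noteq> 0\<^sub>v 2" for v :: "real vec"
      by (subst quad_form2[OF that(1), symmetric]) (use \<open>?L\<close> that in \<open>simp add: pos_def_def\<close>)
    have **: "0 < p * s\<^sup>2 + 2 * r * s * t + q * t\<^sup>2" if "s \<noteq> 0 \<or> t \<noteq> 0" for s t
    proof -
      have "vec_of_list [s, t] $ 0 = s" "vec_of_list [s, t] $ 1 = t" by simp_all
      moreover from this have "vec_of_list [s, t] \<noteq> 0\<^sub>v 2"
        using that by (metis index_zero_vec(1) one_less_numeral_iff pos2 semiring_norm(76))
      ultimately show ?thesis using *[of "vec_of_list [s, t]"] by (simp add: carrier_vecI)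
    qed
    have p: "0 < p" using **[of 1 0] by auto
    have "0 < p * (p * q - r\<^sup>2)" using **[of "- r" p] p by (simp add: power2_eq_square algebra_simps)
    then show ?R using p by (simp add: zero_less_mult_iff)
  next
    assume R: ?R
    have "0 < p * s\<^sup>2 + 2 * r * s * t + q * t\<^sup>2" if "s \<noteq> 0 \<or> t \<noteq> 0" for s t
    proof -
      have "p * (p * s\<^sup>2 + 2 * r * s * t + q * t\<^sup>2) = (p * s + r * t)\<^sup>2 + (p * q - r\<^sup>2) * t\<^sup>2"
        by (simp add: power2_eq_square algebra_simps)
      also have "\<dots> > 0"
      proof (cases "t = 0")
        case True
        then show ?thesis using R that by simp
      next
        case False
        then show ?thesis using R by (simp add: add_nonneg_pos)
      qed
      finally show ?thesis using R by (simp add: zero_less_mult_iff)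
    qed
    moreover have "v $ 0 \<noteq> 0 \<or> v $ 1 \<noteq> 0" if "v \<in> carrier_vec 2" "v \<noteq> 0\<^sub>v 2" for v :: "real vec"
    proof (rule ccontr)
      assume "\<not> ?thesis"
      then have "v = 0\<^sub>v 2" using that(1) by (intro eq_vecI) (auto simp: less_2_cases_iff)
      then show False using that by simp
    qed
    ultimately show ?L by (simp add: pos_def_def quad_form2)
  qed
  then show ?thesis unfolding strict_spectrahedron_def
    by (intro exI[of _ 2] exI[of _ A0] exI[of _ A]) (simp add: A)
qed

lemma spectrahedral2_imp_spectrahedral:
  assumes "spectrahedral2 S"
  shows "spectrahedral S"
proof -
  obtain l1 l2 l3 l4 l5 l6 where l: "affine_fun l1" "affine_fun l2" "affine_fun l3" "affine_fun l4" "affine_fun l5" "affine_fun l6"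
    "S = {x. 0 \<le> l1 x \<and> 0 \<le> l2 x \<and> (l3 x)\<^sup>2 \<le> l1 x * l2 x \<and> 0 < l4 x \<and> (l6 x)\<^sup>2 < l4 x * l5 x}"
    using assms unfolding spectrahedral2_def by (elim exE conjE) (rule that; assumption)
  have "S = {x. 0 \<le> l1 x \<and> 0 \<le> l2 x \<and> (l3 x)\<^sup>2 \<le> l1 x * l2 x} \<inter> {x. 0 < l4 x \<and> (l6 x)\<^sup>2 < l4 x * l5 x}"
    using l(7) by blast
  then show ?thesis unfolding spectrahedral_def
    using spectrahedron2[OF l(1-3)] strict_spectrahedron2[OF l(4-6)] by (rule_tac exI, rule_tac exI) simp
qed

section \<open>Both roots in one half plane\<close>

text \<open>Dividing w by exp (g w / 2) would give a continuous square root of 1, constant on the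
  connected circle. Then w itself has a continuous logarithm, which is purely imaginary, so the
  identity of the circle is homotopic to a constant; but the circle is not contractible.\<close>

lemma no_logarithm_of_square_on_circle:
  fixes g :: "complex \<Rightarrow> complex"
  assumes "continuous_on (sphere 0 1) g"
  shows "\<exists>w\<in>sphere 0 1. w\<^sup>2 \<noteq> exp (g w)"
proof (rule ccontr)
  assume "\<not> ?thesis"
  then have g: "w\<^sup>2 = exp (g w)" if "w \<in> sphere 0 1" for w using that by blast
  define s where "s w = w * exp (- g w / 2)" for w
  have cont_s: "continuous_on (sphere 0 1) s"
    unfolding s_def by (intro continuous_intros assms) auto
  have s2: "s w = 1 \<or> s w = -1" if "w \<in> sphere 0 1" for w
  proof -
    have "(s w)\<^sup>2 = w\<^sup>2 * exp (- g w)"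
      unfolding s_def by (simp add: power_mult_distrib flip: exp_double)
    also have "\<dots> = 1" using g[OF that] by (simp flip: exp_add)
    finally show ?thesis by (simp add: power2_eq_1_iff)
  qed
  have "connected (sphere (0 :: complex) 1)" by (intro connected_sphere) simp
  then have "connected (s ` sphere 0 1)" using cont_s connected_continuous_image by blast
  moreover have "s ` sphere 0 1 \<subseteq> {1, -1}" using s2 by blast
  then have "finite (s ` sphere 0 1)" by (rule finite_subset) simp
  ultimately have "s ` sphere 0 1 = {} \<or> (\<exists>x. s ` sphere 0 1 = {x})"
    using connected_finite_iff_sing by blast
  moreover have "s 1 \<in> s ` sphere 0 1" by (intro imageI) simp
  ultimately obtain c where "s ` sphere 0 1 = {c}" by blast
  then have c: "s w = c" if "w \<in> sphere 0 1" for w using that by blast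
  have "c = s 1" using c[of 1] by simp
  then have c1: "c \<noteq> 0" using s2[of 1] by force
  define K where "K w = g w / 2 + Ln c" for w
  have K: "w = exp (K w)" if "w \<in> sphere 0 1" for w
  proof -
    have "w = w * exp (- g w / 2) * exp (g w / 2)" by (simp add: mult.assoc flip: exp_add)
    also have "\<dots> = c * exp (g w / 2)" using c[OF that] unfolding s_def by simp
    also have "\<dots> = exp (K w)" unfolding K_def using c1 by (simp add: exp_add)
    finally show ?thesis .
  qed
  have "w = exp (\<i> * of_real (Im (K w)))" if w: "w \<in> sphere 0 1" for w
  proof -
    have "norm (exp (K w)) = 1" using K[OF w] w by simp
    then have "Re (K w) = 0" by simp
    then have "K w = \<i> * of_real (Im (K w))" by (simp add: complex_eq_iff)
    then show ?thesis using K[OF w] by metis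
  qed
  moreover have "continuous_on (sphere 0 1) (\<lambda>w. Im (K w))"
    unfolding K_def by (intro continuous_intros assms) auto
  ultimately obtain a where "homotopic_with_canon (\<lambda>h. True) (sphere 0 1) (sphere 0 1) (\<lambda>w::complex. w) (\<lambda>t. a)"
    using inessential_eq_continuous_logarithm_circle[of "sphere 0 1" "\<lambda>w. w"] by blast
  then have "contractible (sphere (0::complex) 1)" unfolding contractible_def id_def by blast
  then show False by (simp add: contractible_sphere)
qed

text \<open>The set is star-shaped about (1, 0): on a segment from there the first coordinate stays
  positive before the endpoint, so the missing origin is never met.\<close>

lemma half_space_punctured_contractible:
  "contractible {(t::real, w::complex). 0 \<le> t \<and> (t, w) \<noteq> (0, 0)}" (is "contractible ?T")
proof (rule starlike_imp_contractible)
  have "closed_segment (1, 0) x \<subseteq> ?T" if x: "x \<in> ?T" for x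
  proof
    fix p assume "p \<in> closed_segment (1, 0) x"
    then obtain u where u: "0 \<le> u" "u \<le> 1" "p = (1 - u) *\<^sub>R (1, 0) + u *\<^sub>R x"
      unfolding closed_segment_def by blast
    obtain t w where tw: "x = (t, w)" by fastforce
    have p: "p = ((1 - u) + u * t, u *\<^sub>R w)" unfolding u tw by simp
    have t: "0 \<le> t" "t \<noteq> 0 \<or> w \<noteq> 0" using x tw by auto
    have "u * t \<ge> 0" using t u by simp
    show "p \<in> ?T"
    proof (cases "u = 0")
      case True
      then show ?thesis unfolding p by simp
    next
      case False
      then show ?thesis unfolding p using t u \<open>u * t \<ge> 0\<close> by (auto simp: add_nonneg_eq_0_iff)
    qed
  qed
  then show "starlike ?T" unfolding starlike_def by (intro bexI[of _ "(1, 0)"]) auto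
qed

text \<open>Since both roots lie in the same half plane, the conic restricted to a translate of the real plane
  winds twice around 0 at infinity. If it had no zero there, its homogenization would have a logarithm
  on the closed half space minus the origin, and so \<open>w\<^sup>2\<close> would have one on the unit circle.\<close>

lemma same_half_plane_imaginary_set:
  fixes a d e f \<rho> \<sigma> :: complex
  assumes a: "a \<noteq> 0" and same: "Im \<rho> * Im \<sigma> > 0"
  shows "imaginary_set (\<lambda>z1 z2. a * (z1 - \<rho> * z2) * (z1 - \<sigma> * z2) + d * z1 + e * z2 + f = 0) = UNIV"
proof (rule ccontr)
  define F where "F z1 z2 = a * (z1 - \<rho> * z2) * (z1 - \<sigma> * z2) + d * z1 + e * z2 + f" for z1 z2
  assume "imaginary_set (\<lambda>z1 z2. a * (z1 - \<rho> * z2) * (z1 - \<sigma> * z2) + d * z1 + e * z2 + f = 0) \<noteq> UNIV"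
  then obtain y where "y \<notin> imaginary_set (\<lambda>z1 z2. F z1 z2 = 0)" unfolding F_def by blast
  then obtain y1 y2 where "(y1, y2) \<notin> imaginary_set (\<lambda>z1 z2. F z1 z2 = 0)" by (metis surj_pair)
  then have nz: "F (Complex x1 y1) (Complex x2 y2) \<noteq> 0" for x1 x2
    unfolding imaginary_set_iff by blast
  \<comment> \<open>The sign fixes the orientation in which the real plane is identified with the
    complex numbers w: with it, both linear factors wind in the same direction as w.\<close>
  define s where "s = sgn (Im \<rho>)"
  have s: "s * Im \<rho> > 0" "s * Im \<sigma> > 0" "s * s = 1"
    using same unfolding s_def by (auto simp: sgn_if zero_less_mult_iff split: if_splits)
  \<comment> \<open>For t > 0 this is t^2 times \<open>F\<close> at the point with real part (Re w,
    - s * Im w) / t and imaginary part (y1, y2). It is written without division so that it also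
    makes sense at t = 0, where only the initial form remains.\<close>
  define h where "h = (\<lambda>(t::real, w).
      a * ((of_real (Re w) + of_real t * (\<i> * y1)) - \<rho> * (of_real (- s * Im w) + of_real t * (\<i> * y2)))
        * ((of_real (Re w) + of_real t * (\<i> * y1)) - \<sigma> * (of_real (- s * Im w) + of_real t * (\<i> * y2)))
      + of_real t * (d * (of_real (Re w) + of_real t * (\<i> * y1)))
      + of_real t * (e * (of_real (- s * Im w) + of_real t * (\<i> * y2))) + of_real t * of_real t * f)"
  define T where "T = {(t::real, w::complex). 0 \<le> t \<and> (t, w) \<noteq> (0, 0)}"
  \<comment> \<open>The quotient of a linear factor by w. It avoids the nonpositive reals, so the
    principal logarithm \<open>Ln\<close> is continuous along it; this is the precise form of the
    statement that the factor winds like w.\<close>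
  define r where "r \<tau> w = (of_real (Re w) - \<tau> * of_real (- s * Im w)) / w" for \<tau> w
  have r: "r \<tau> w \<notin> \<real>\<^sub>\<le>\<^sub>0" if \<tau>: "s * Im \<tau> > 0" and w: "w \<noteq> 0" for \<tau> w
  proof
    assume "r \<tau> w \<in> \<real>\<^sub>\<le>\<^sub>0"
    then obtain m where m: "m \<le> 0" "r \<tau> w = of_real m" by (metis nonpos_Reals_cases)
    then have *: "of_real (Re w) - \<tau> * of_real (- s * Im w) = of_real m * w"
      unfolding r_def using w by (simp add: field_simps)
    have "(s * Im \<tau> - m) * Im w = 0"
      using arg_cong[OF *, of Im] by (simp add: algebra_simps)
    moreover have "s * Im \<tau> - m > 0" using \<tau> m by simp
    ultimately have im: "Im w = 0" by simp
    have "(1 - m) * Re w = 0" using arg_cong[OF *, of Re] im by (simp add: algebra_simps)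
    then have "Re w = 0" using m by auto
    then show False using im w by (simp add: complex_eq_iff)
  qed
  have h0: "h (0, w) = a * w\<^sup>2 * r \<rho> w * r \<sigma> w" if "w \<noteq> 0" for w
    unfolding h_def r_def using that by (simp add: power2_eq_square)
  have "h (t, w) \<noteq> 0" if "(t, w) \<in> T" for t w
  proof (cases "t = 0")
    case True
    then have w: "w \<noteq> 0" using that unfolding T_def by auto
    have "r \<rho> w \<noteq> 0" "r \<sigma> w \<noteq> 0" using r[OF s(1) w] r[OF s(2) w] by auto
    then show ?thesis using h0 w True a by simp
  next
    case False
    have c: "of_real t * Complex (Re w / t) y1 = of_real (Re w) + of_real t * (\<i> * y1)"
      "of_real t * Complex (- s * Im w / t) y2 = of_real (- s * Im w) + of_real t * (\<i> * y2)"
      using False by (simp_all add: complex_eq_iff)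
    have "h (t, w) = of_real t * of_real t * F (Complex (Re w / t) y1) (Complex (- s * Im w / t) y2)"
      unfolding h_def prod.case c[symmetric] F_def by (simp add: algebra_simps)
    then show ?thesis using nz False by simp
  qed
  moreover have "continuous_on T h"
    unfolding h_def case_prod_unfold by (intro continuous_intros)
  moreover have "contractible T" unfolding T_def by (rule half_space_punctured_contractible)
  ultimately obtain G where G: "continuous_on T G" "\<And>x. x \<in> T \<Longrightarrow> h x = exp (G x)"
    using continuous_logarithm_on_contractible[of T h] by (metis surj_pair)
  have sub: "Pair 0 ` sphere 0 1 \<subseteq> T" unfolding T_def by auto
  \<comment> \<open>On the circle at t = 0, subtracting the logarithms of the factors other than w^2
    leaves a logarithm of w^2.\<close>
  define g where "g w = G (0, w) - Ln a - Ln (r \<rho> w) - Ln (r \<sigma> w)" for w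
  have cont_r: "continuous_on (sphere 0 1) (r \<tau>)" for \<tau>
    unfolding r_def by (intro continuous_intros) auto
  have "continuous_on (sphere 0 1) (\<lambda>w. G (0, w))"
    by (rule continuous_on_compose2[OF G(1) _ sub]) (intro continuous_intros)
  then have "continuous_on (sphere 0 1) g"
    unfolding g_def by (intro continuous_intros cont_r r s) auto
  moreover have "w\<^sup>2 = exp (g w)" if w: "w \<in> sphere 0 1" for w
  proof -
    have w0: "w \<noteq> 0" using w by auto
    have rr: "r \<rho> w \<noteq> 0" "r \<sigma> w \<noteq> 0" using r[OF s(1) w0] r[OF s(2) w0] by auto
    have "exp (G (0, w)) = a * w\<^sup>2 * r \<rho> w * r \<sigma> w" using G(2) sub w h0[OF w0] by fastforce
    then show ?thesis unfolding g_def using rr a by (simp add: exp_diff)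
  qed
  ultimately show False using no_logarithm_of_square_on_circle by blast
qed

section \<open>Roots in opposite half planes\<close>

text \<open>For u = w^2 the left side equals 2 * (Im w)^2, so Im w is y up to sign, and the choice
  between w and - w settles the sign.\<close>

lemma square_with_im:
  assumes "cmod u - Re u = 2 * y\<^sup>2"
  shows "\<exists>x. (Complex x y)\<^sup>2 = u"
proof -
  define w where "w = csqrt u"
  have w: "w\<^sup>2 = u" unfolding w_def by simp
  have "cmod u = (Re w)\<^sup>2 + (Im w)\<^sup>2" unfolding w[symmetric] norm_power cmod_power2 ..
  moreover have "Re u = (Re w)\<^sup>2 - (Im w)\<^sup>2" unfolding w[symmetric] by (simp add: power2_eq_square)
  ultimately have "(Im w)\<^sup>2 = y\<^sup>2" using assms by simp
  then consider "Im w = y" | "Im w = - y" by (auto simp: power2_eq_iff)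
  then show ?thesis
  proof cases
    case 1
    then show ?thesis using w by (intro exI[of _ "Re w"]) (auto simp: complex_eq_iff)
  next
    case 2
    then have "Complex (- Re w) y = - w" by (simp add: complex_eq_iff)
    then show ?thesis using w by (intro exI[of _ "- Re w"]) simp
  qed
qed

lemma norm_minus_Re_square: "cmod ((Complex x y)\<^sup>2) - Re ((Complex x y)\<^sup>2) = 2 * y\<^sup>2"
  unfolding norm_power cmod_power2 by (simp add: power2_eq_square)

text \<open>The squares of the numbers with imaginary part \<open>y\<close> form the parabola
  \<open>cmod u - Re u = 2 * y\<^sup>2\<close>, so enlarging the first imaginary part amounts to moving along the second
  parabola, whose axis is not opposite to that of the first, until the larger parabola is met.\<close>

lemma diagonal_enlarge_fst:
  assumes \<omega>: "\<omega> \<notin> \<real>\<^sub>\<le>\<^sub>0" and sol: "(Complex x1 v1)\<^sup>2 + \<omega> * (Complex x2 v2)\<^sup>2 = k" and le: "\<bar>v1\<bar> \<le> \<bar>y1\<bar>"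
  shows "\<exists>x1 x2. (Complex x1 y1)\<^sup>2 + \<omega> * (Complex x2 v2)\<^sup>2 = k"
proof -
  define u where "u t = k - \<omega> * (Complex t v2)\<^sup>2" for t
  \<comment> \<open>By \<open>square_with_im\<close>, a zero t of \<open>H\<close> is a second real
    part for which the equation is solvable with first imaginary part \<open>y1\<close>. At the
    given solution \<open>H\<close> is nonpositive, so growth at infinity suffices.\<close>
  define H where "H t = cmod (u t) - Re (u t) - 2 * y1\<^sup>2" for t
  have Cx: "Complex t v2 = of_real t + \<i> * of_real v2" for t by (simp add: complex_eq_iff)
  have cont: "continuous_on {a..b} H" for a b
    unfolding H_def u_def Cx by (intro continuous_intros)
  have "u x2 = (Complex x1 v1)\<^sup>2" unfolding u_def using sol by (simp add: algebra_simps)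
  then have "H x2 = 2 * v1\<^sup>2 - 2 * y1\<^sup>2" unfolding H_def by (simp add: norm_minus_Re_square)
  then have H1: "H x2 \<le> 0" using le by (simp add: abs_le_square_iff)
  \<comment> \<open>This is the coefficient of t^2 in the lower bound \<open>low\<close>. It is 0
    exactly for nonpositive real \<omega>, the case of opposite parabola axes.\<close>
  define c where "c = cmod \<omega> + Re \<omega>"
  have c: "c > 0"
  proof -
    have "- Re \<omega> \<noteq> cmod \<omega>"
    proof
      assume e: "- Re \<omega> = cmod \<omega>"
      then have "(Re \<omega>)\<^sup>2 = (cmod \<omega>)\<^sup>2" by (metis power2_minus)
      then have "Im \<omega> = 0" unfolding cmod_power2 by simp
      moreover have "Re \<omega> \<le> 0" using e by (metis neg_0_le_iff_le norm_ge_zero)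
      ultimately show False using \<omega> complex_nonpos_Reals_iff by blast
    qed
    moreover have "- Re \<omega> \<le> cmod \<omega>" using abs_Re_le_cmod[of \<omega>] by linarith
    ultimately show ?thesis unfolding c_def by linarith
  qed
  define B where "B = 2 * \<bar>Im \<omega>\<bar> * \<bar>v2\<bar>"
  define M where "M = 2 * cmod k + 2 * y1\<^sup>2"
  have BM: "B \<ge> 0" "M \<ge> 0" unfolding B_def M_def by auto
  have low: "H t \<ge> c * t\<^sup>2 - B * t - M" if t: "t \<ge> 0" for t
  proof -
    define z where "z = (Complex t v2)\<^sup>2"
    have nz: "cmod z = t\<^sup>2 + v2\<^sup>2" unfolding z_def norm_power cmod_power2 by simp
    have Rz: "Re (\<omega> * z) = Re \<omega> * (t\<^sup>2 - v2\<^sup>2) - 2 * Im \<omega> * v2 * t"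
      unfolding z_def by (simp add: power2_eq_square algebra_simps)
    have "cmod (u t) \<ge> cmod (\<omega> * z) - cmod k"
      unfolding u_def z_def[symmetric] by (metis norm_minus_commute norm_triangle_ineq2)
    moreover have "cmod (\<omega> * z) = cmod \<omega> * t\<^sup>2 + cmod \<omega> * v2\<^sup>2" by (simp add: norm_mult nz algebra_simps)
    moreover have "Re (u t) \<le> cmod k - Re (\<omega> * z)"
      unfolding u_def z_def[symmetric] using complex_Re_le_cmod[of k] by simp
    moreover have "Re \<omega> * v2\<^sup>2 \<le> cmod \<omega> * v2\<^sup>2" by (intro mult_right_mono complex_Re_le_cmod) auto
    moreover have "2 * Im \<omega> * v2 * t \<le> B * t" unfolding B_def
    proof (intro mult_right_mono t)
      have "Im \<omega> * v2 \<le> \<bar>Im \<omega> * v2\<bar>" by simp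
      then show "2 * Im \<omega> * v2 \<le> 2 * \<bar>Im \<omega>\<bar> * \<bar>v2\<bar>" by (simp add: abs_mult)
    qed
    ultimately show ?thesis unfolding H_def M_def c_def Rz by (simp add: algebra_simps)
  qed
  \<comment> \<open>Since T is at least 1 and c * T at least B + M, the bound c * T^2 - B * T - M is
    nonnegative; T also lies to the right of \<open>x2\<close>, as the intermediate value theorem
    requires.\<close>
  define T where "T = max x2 (max 1 ((B + M) / c))"
  have T: "T \<ge> x2" "T \<ge> 1" "T \<ge> (B + M) / c" unfolding T_def by auto
  then have "c * T \<ge> B + M" using c by (simp add: field_simps)
  then have "c * T * T \<ge> (B + M) * T" using T(2) by (intro mult_right_mono) auto
  moreover have "M * T \<ge> M" using T(2) BM by (simp add: mult_le_cancel_left1)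
  ultimately have H2: "H T \<ge> 0" using low[of T] T(2) by (simp add: power2_eq_square algebra_simps)
  obtain t where "H t = 0" using IVT'[of H x2 0 T] H1 H2 T(1) cont by auto
  then have "cmod (u t) - Re (u t) = 2 * y1\<^sup>2" unfolding H_def by simp
  then obtain x where "(Complex x y1)\<^sup>2 = u t" using square_with_im by blast
  then show ?thesis unfolding u_def by (intro exI[of _ x] exI[of _ t]) simp
qed

text \<open>Division by \<omega> exchanges the roles of the two coordinates and replaces \<omega> by
  its inverse, which again is not a nonpositive real. So \<open>diagonal_enlarge_fst\<close>,
  applied twice, enlarges both coordinates.\<close>

lemma diagonal_imaginary_set_mono:
  assumes \<omega>: "\<omega> \<notin> \<real>\<^sub>\<le>\<^sub>0" and v: "(v1, v2) \<in> imaginary_set (\<lambda>z1 z2. z1\<^sup>2 + \<omega> * z2\<^sup>2 = k)"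
    and le: "\<bar>v1\<bar> \<le> \<bar>y1\<bar>" "\<bar>v2\<bar> \<le> \<bar>y2\<bar>"
  shows "(y1, y2) \<in> imaginary_set (\<lambda>z1 z2. z1\<^sup>2 + \<omega> * z2\<^sup>2 = k)"
proof -
  have \<omega>0: "\<omega> \<noteq> 0" using \<omega> by auto
  have inv: "inverse \<omega> \<notin> \<real>\<^sub>\<le>\<^sub>0"
  proof
    assume "inverse \<omega> \<in> \<real>\<^sub>\<le>\<^sub>0"
    then obtain r where r: "r \<le> 0" "inverse \<omega> = of_real r" by (metis nonpos_Reals_cases)
    then have "\<omega> = of_real (inverse r)" by (metis inverse_inverse_eq of_real_inverse)
    moreover have "inverse r \<le> 0" using r(1) by simp
    ultimately show False using \<omega> by (metis nonpos_Reals_of_real_iff)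
  qed
  have sw: "z1\<^sup>2 + inverse \<omega> * z2\<^sup>2 = inverse \<omega> * k \<longleftrightarrow> z2\<^sup>2 + \<omega> * z1\<^sup>2 = k" for z1 z2
    using \<omega>0 by (auto simp: field_simps)
  obtain u1 u2 where "(Complex u1 v1)\<^sup>2 + \<omega> * (Complex u2 v2)\<^sup>2 = k"
    using v unfolding imaginary_set_iff by blast
  from diagonal_enlarge_fst[OF \<omega> this le(1)]
  obtain x1 x2 where "(Complex x1 y1)\<^sup>2 + \<omega> * (Complex x2 v2)\<^sup>2 = k" by blast
  then have "(Complex x2 v2)\<^sup>2 + inverse \<omega> * (Complex x1 y1)\<^sup>2 = inverse \<omega> * k" unfolding sw .
  from diagonal_enlarge_fst[OF inv this le(2)] obtain x1' x2' where
    "(Complex x1' y2)\<^sup>2 + inverse \<omega> * (Complex x2' y1)\<^sup>2 = inverse \<omega> * k" by blast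
  then have "(Complex x2' y1)\<^sup>2 + \<omega> * (Complex x1' y2)\<^sup>2 = k" unfolding sw .
  then show ?thesis unfolding imaginary_set_iff by (intro exI)
qed

lemma diagonal_imaginary_set_compl:
  fixes \<omega> k :: complex
  assumes \<omega>: "\<omega> \<notin> \<real>\<^sub>\<le>\<^sub>0"
  defines "S \<equiv> - imaginary_set (\<lambda>z1 z2. z1\<^sup>2 + \<omega> * z2\<^sup>2 = k)"
  shows "connected S" "bounded S"
proof -
  have down: "(v1, v2) \<in> S" if "(y1, y2) \<in> S" "\<bar>v1\<bar> \<le> \<bar>y1\<bar>" "\<bar>v2\<bar> \<le> \<bar>y2\<bar>" for v1 v2 y1 y2
    using diagonal_imaginary_set_mono[OF \<omega> _ that(2,3)] that(1) unfolding S_def by blast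
  show "connected S"
  proof (cases "S = {}")
    case False
    then obtain y1 y2 where "(y1, y2) \<in> S" by (metis ex_in_conv surj_pair)
    then have "(0, 0) \<in> S" using down by simp
    moreover have "closed_segment (0, 0) y \<subseteq> S" if "y \<in> S" for y
    proof
      fix p assume "p \<in> closed_segment (0, 0) y"
      then obtain u where u: "0 \<le> u" "u \<le> 1" "p = u *\<^sub>R y"
        unfolding closed_segment_def by (auto simp: zero_prod_def[symmetric])
      have "\<bar>u * fst y\<bar> \<le> \<bar>fst y\<bar>" "\<bar>u * snd y\<bar> \<le> \<bar>snd y\<bar>"
        using u by (simp_all add: abs_mult mult_left_le_one_le)
      then have "(u * fst y, u * snd y) \<in> S" using down[of "fst y" "snd y"] that by simp
      then show "p \<in> S" unfolding u by (metis prod.collapse real_scaleR_def scaleR_Pair)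
    qed
    ultimately have "starlike S" unfolding starlike_def by blast
    then show ?thesis using starlike_imp_connected by blast
  qed simp
  have \<omega>0: "\<omega> \<noteq> 0" using \<omega> by auto
  \<comment> \<open>The solutions with z2 = 0 and with z1 = 0 give points of the imaginary
    projection on the two axes; by monotonicity the complement cannot extend beyond them.\<close>
  have "(Im (csqrt k), 0) \<in> imaginary_set (\<lambda>z1 z2. z1\<^sup>2 + \<omega> * z2\<^sup>2 = k)" unfolding imaginary_set_def
    by (intro CollectI exI[of _ "csqrt k"] exI[of _ 0]) simp
  then have "\<bar>y1\<bar> \<le> \<bar>Im (csqrt k)\<bar>" if "(y1, y2) \<in> S" for y1 y2
    using down[OF that, of "Im (csqrt k)" 0] unfolding S_def by force
  moreover have "(0, Im (csqrt (k / \<omega>))) \<in> imaginary_set (\<lambda>z1 z2. z1\<^sup>2 + \<omega> * z2\<^sup>2 = k)" unfolding imaginary_set_def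
    by (intro CollectI exI[of _ "csqrt (k / \<omega>)"] exI[of _ 0]) (simp add: \<omega>0)
  then have "\<bar>y2\<bar> \<le> \<bar>Im (csqrt (k / \<omega>))\<bar>" if "(y1, y2) \<in> S" for y1 y2
    using down[OF that, of 0 "Im (csqrt (k / \<omega>))"] unfolding S_def by force
  ultimately have "S \<subseteq> {- \<bar>Im (csqrt k)\<bar>..\<bar>Im (csqrt k)\<bar>} \<times> {- \<bar>Im (csqrt (k / \<omega>))\<bar>..\<bar>Im (csqrt (k / \<omega>))\<bar>}"
    by (fastforce simp: abs_le_iff)
  then show "bounded S" by (rule bounded_subset[rotated]) (intro bounded_Times bounded_closed_interval)
qed

text \<open>The second equation says that the mixed coefficient of (z1 - \<rho> * z2) * (z1 -
  \<sigma> * z2) vanishes in the real basis (a, c), (b, d). For vectors (s, 1), (t, 1) its real and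
  imaginary parts are two real linear equations for s + t and s * t. The discriminant of the
  quadratic with this sum and product is positive because the product of Im \<rho> and - Im \<sigma>
  is.\<close>

lemma opposite_roots_conjugate_basis:
  assumes "Im \<rho> > 0" "Im \<sigma> < 0"
  obtains a b c d :: real where "a * d - b * c \<noteq> 0"
    "2 * of_real (a * b) - (\<rho> + \<sigma>) * of_real (a * d + b * c) + 2 * \<rho> * \<sigma> * of_real (c * d) = 0"
proof (cases "Im \<rho> + Im \<sigma> = 0")
  case True
  \<comment> \<open>If \<rho> + \<sigma> is real, one basis vector moves to infinity: the basis is
    (1, 0) and ((\<rho> + \<sigma>) / 2, 1). The arguments of \<open>that\<close> follow the order
    of occurrence a, d, b, c.\<close>
  show thesis by (rule that[of 1 1 "(Re \<rho> + Re \<sigma>) / 2" 0]) (use True in \<open>simp_all add: complex_eq_iff\<close>)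
next
  case False
  define m n u v \<delta> where "m = Re \<rho>" "n = Re \<sigma>" "u = Im \<rho>" "v = - Im \<sigma>" "\<delta> = u - v"
  note defs = this
  have uv: "u > 0" "v > 0" "\<delta> \<noteq> 0" using assms False unfolding defs by auto
  define S where "S = 2 * (u * n - v * m) / \<delta>"
  have S: "S * \<delta> = 2 * (u * n - v * m)" unfolding S_def using uv by simp
  define T where "T = (S * (m + n)) / 2 - (m * n + u * v)"
  define D where "D = S\<^sup>2 - 4 * T"
  have "\<delta>\<^sup>2 * D = (S * \<delta>)\<^sup>2 - 2 * (S * \<delta>) * \<delta> * (m + n) + 4 * (m * n + u * v) * \<delta>\<^sup>2"
    unfolding D_def T_def by (simp add: power2_eq_square algebra_simps)
  also have "\<dots> = 4 * (u * v * ((m - n)\<^sup>2 + \<delta>\<^sup>2))"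
    unfolding S unfolding defs(5) by (simp add: power2_eq_square algebra_simps)
  also have "\<dots> > 0" using uv by (simp add: add_nonneg_pos)
  finally have D: "D > 0" by (simp add: zero_less_mult_iff)
  define s t where "s = (S + sqrt D) / 2" "t = (S - sqrt D) / 2"
  note st_def = this
  have sum: "s + t = S" "s - t = sqrt D" unfolding st_def by (simp_all add: field_simps)
  have "s * t = (S\<^sup>2 - (sqrt D)\<^sup>2) / 4" unfolding st_def by (simp add: power2_eq_square field_simps)
  then have prod: "s * t = T" using D unfolding D_def by simp
  have "2 * of_real (s * t) - (\<rho> + \<sigma>) * of_real (s * 1 + t * 1) + 2 * \<rho> * \<sigma> * of_real (1 * 1) = 0"
  proof (rule complex_eqI)
    show "Re (2 * of_real (s * t) - (\<rho> + \<sigma>) * of_real (s * 1 + t * 1) + 2 * \<rho> * \<sigma> * of_real (1 * 1)) = Re 0"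
      unfolding prod T_def by (simp add: sum defs algebra_simps)
    show "Im (2 * of_real (s * t) - (\<rho> + \<sigma>) * of_real (s * 1 + t * 1) + 2 * \<rho> * \<sigma> * of_real (1 * 1)) = Im 0"
      using S unfolding prod by (simp add: sum defs algebra_simps)
  qed
  moreover have "s * 1 - t * 1 \<noteq> 0" using sum D by simp
  ultimately show thesis by (rule that[rotated])
qed

lemma opposite_half_planes_imaginary_set:
  fixes a d e f \<rho> \<sigma> :: complex
  assumes a: "a \<noteq> 0" and op: "Im \<rho> > 0" "Im \<sigma> < 0"
  defines "S \<equiv> - imaginary_set (\<lambda>z1 z2. a * (z1 - \<rho> * z2) * (z1 - \<sigma> * z2) + d * z1 + e * z2 + f = 0)"
  shows "connected S" "bounded S"
proof -
  obtain p q r s :: real where D: "p * s - q * r \<noteq> 0"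
    and B: "2 * of_real (p * q) - (\<rho> + \<sigma>) * of_real (p * s + q * r) + 2 * \<rho> * \<sigma> * of_real (r * s) = 0"
    using opposite_roots_conjugate_basis[OF op] by metis
  have no_real_root: "x = 0 \<and> y = 0" if "(of_real x - \<rho> * of_real y) * (of_real x - \<sigma> * of_real y) = 0" for x y :: real
  proof -
    have "of_real x - \<rho> * of_real y = 0 \<or> of_real x - \<sigma> * of_real y = 0" using that by simp
    then show ?thesis using op by (auto simp: complex_eq_iff)
  qed
  define A1 where "A1 = (of_real p - \<rho> * of_real r) * (of_real p - \<sigma> * of_real r)"
  define A2 where "A2 = (of_real q - \<rho> * of_real s) * (of_real q - \<sigma> * of_real s)"
  have A1: "A1 \<noteq> 0" using no_real_root[of p r] D unfolding A1_def by fastforce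
  have A2: "A2 \<noteq> 0" using no_real_root[of q s] D unfolding A2_def by fastforce
  define \<omega> where "\<omega> = A2 / A1"
  \<comment> \<open>If \<omega> were - t^2 with t real, then t times the first basis vector plus the
    second would be a real zero of the initial form, since the mixed term is gone; but that form has
    no nontrivial real zero.\<close>
  have \<omega>: "\<omega> \<notin> \<real>\<^sub>\<le>\<^sub>0"
  proof
    assume "\<omega> \<in> \<real>\<^sub>\<le>\<^sub>0"
    then obtain m where m: "m \<le> 0" "\<omega> = of_real m" by (metis nonpos_Reals_cases)
    define t where "t = sqrt (- m)"
    have t: "complex_of_real t * of_real t = - of_real m" unfolding t_def using m(1)
      by (metis neg_0_le_iff_le of_real_minus of_real_mult real_sqrt_mult_self abs_of_nonneg)
    have "A2 = of_real m * A1" using m(2) A1 unfolding \<omega>_def by (simp add: field_simps)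
    then have "of_real t * of_real t * A1 + A2 + of_real t *
        (2 * of_real (p * q) - (\<rho> + \<sigma>) * of_real (p * s + q * r) + 2 * \<rho> * \<sigma> * of_real (r * s)) = 0"
      unfolding t B by simp
    then have "(of_real (t * p + q) - \<rho> * of_real (t * r + s)) * (of_real (t * p + q) - \<sigma> * of_real (t * r + s)) = 0"
      unfolding A1_def A2_def by (simp add: algebra_simps)
    then have "t * p + q = 0 \<and> t * r + s = 0" by (rule no_real_root)
    then have "q = - (t * p)" "s = - (t * r)" by linarith+
    then show False using D by simp
  qed
  define d' where "d' = d * of_real p + e * of_real r"
  define e' where "e' = d * of_real q + e * of_real s"
  have step1: "a * (z1 - \<rho> * z2) * (z1 - \<sigma> * z2) + d * z1 + e * z2 + f
      = a * A1 * Z1\<^sup>2 + a * A2 * Z2\<^sup>2 + d' * Z1 + e' * Z2 + f"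
    if "z1 = of_real p * Z1 + of_real q * Z2 + 0" "z2 = of_real r * Z1 + of_real s * Z2 + 0" for z1 z2 Z1 Z2
  proof -
    have "a * (z1 - \<rho> * z2) * (z1 - \<sigma> * z2) + d * z1 + e * z2 + f
      = a * A1 * Z1\<^sup>2 + a * A2 * Z2\<^sup>2 + d' * Z1 + e' * Z2 + f + a * Z1 * Z2 *
        (2 * of_real (p * q) - (\<rho> + \<sigma>) * of_real (p * s + q * r) + 2 * \<rho> * \<sigma> * of_real (r * s))"
      unfolding that A1_def A2_def d'_def e'_def by (simp add: power2_eq_square algebra_simps)
    then show ?thesis unfolding B by simp
  qed
  have "\<exists>\<phi>. affine_map \<phi> \<and> S = \<phi> ` (- imaginary_set (\<lambda>Z1 Z2. a * A1 * Z1\<^sup>2 + a * A2 * Z2\<^sup>2 + d' * Z1 + e' * Z2 + f = 0))"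
    unfolding S_def by (rule compl_imaginary_set_aff[OF D, of _ 0 0]) (simp only: step1[OF refl refl])
  then obtain \<phi>1 where \<phi>1: "affine_map \<phi>1"
    "S = \<phi>1 ` (- imaginary_set (\<lambda>Z1 Z2. a * A1 * Z1\<^sup>2 + a * A2 * Z2\<^sup>2 + d' * Z1 + e' * Z2 + f = 0))" by blast
  \<comment> \<open>Both partial derivatives of the diagonal polynomial vanish at (c1, c2), so
    translating there removes the linear terms.\<close>
  define c1 where "c1 = - d' / (2 * a * A1)"
  define c2 where "c2 = - e' / (2 * a * A2)"
  define k where "k = (a * A1 * c1\<^sup>2 + a * A2 * c2\<^sup>2 - f) / (a * A1)"
  have step2: "a * A1 * (of_real 1 * Z1 + of_real 0 * Z2 + c1)\<^sup>2 + a * A2 * (of_real 0 * Z1 + of_real 1 * Z2 + c2)\<^sup>2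
       + d' * (of_real 1 * Z1 + of_real 0 * Z2 + c1) + e' * (of_real 0 * Z1 + of_real 1 * Z2 + c2) + f = 0
     \<longleftrightarrow> Z1\<^sup>2 + \<omega> * Z2\<^sup>2 = k" for Z1 Z2
  proof -
    have d: "d' = - 2 * a * A1 * c1" "e' = - 2 * a * A2 * c2" unfolding c1_def c2_def using a A1 A2 by simp_all
    have A2\<omega>: "A2 = A1 * \<omega>" unfolding \<omega>_def using A1 by simp
    have "a * A1 * k = a * A1 * c1\<^sup>2 + a * A2 * c2\<^sup>2 - f" unfolding k_def using A1 a by simp
    then have f: "f = a * A1 * c1\<^sup>2 + a * A2 * c2\<^sup>2 - a * A1 * k" by (simp add: algebra_simps)
    have "a * A1 * (of_real 1 * Z1 + of_real 0 * Z2 + c1)\<^sup>2 + a * A2 * (of_real 0 * Z1 + of_real 1 * Z2 + c2)\<^sup>2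
       + d' * (of_real 1 * Z1 + of_real 0 * Z2 + c1) + e' * (of_real 0 * Z1 + of_real 1 * Z2 + c2) + f
       = a * A1 * (Z1\<^sup>2 + \<omega> * Z2\<^sup>2 - k)"
      unfolding d f A2\<omega> by (simp add: power2_eq_square algebra_simps)
    then show ?thesis using a A1 by simp
  qed
  have "\<exists>\<phi>. affine_map \<phi> \<and> - imaginary_set (\<lambda>Z1 Z2. a * A1 * Z1\<^sup>2 + a * A2 * Z2\<^sup>2 + d' * Z1 + e' * Z2 + f = 0)
       = \<phi> ` (- imaginary_set (\<lambda>Z1 Z2. Z1\<^sup>2 + \<omega> * Z2\<^sup>2 = k))"
    by (rule compl_imaginary_set_aff[of 1 1 0 0 _ c1 c2]) (simp, rule step2)
  then obtain \<phi>2 where \<phi>2: "affine_map \<phi>2"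
    "- imaginary_set (\<lambda>Z1 Z2. a * A1 * Z1\<^sup>2 + a * A2 * Z2\<^sup>2 + d' * Z1 + e' * Z2 + f = 0)
       = \<phi>2 ` (- imaginary_set (\<lambda>Z1 Z2. Z1\<^sup>2 + \<omega> * Z2\<^sup>2 = k))" by blast
  have S: "S = \<phi>1 ` \<phi>2 ` (- imaginary_set (\<lambda>Z1 Z2. Z1\<^sup>2 + \<omega> * Z2\<^sup>2 = k))" using \<phi>1(2) \<phi>2(2) by simp
  show "connected S" unfolding S
    by (intro connected_continuous_image affine_map_continuous \<phi>1 \<phi>2 diagonal_imaginary_set_compl \<omega>)
  show "bounded S" unfolding S bounded_aff_image[OF \<phi>1(1)] bounded_aff_image[OF \<phi>2(1)]
    by (intro diagonal_imaginary_set_compl \<omega>)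
qed

section \<open>A boundary that is not spectrahedral\<close>

text \<open>The index set is an arbitrary finite set so that an induction can split off one
  variable; a matrix of size k corresponds to \<open>{..<k}\<close>.\<close>

definition qform :: "nat set \<Rightarrow> (nat \<Rightarrow> nat \<Rightarrow> real) \<Rightarrow> (nat \<Rightarrow> real) \<Rightarrow> real" where
  "qform I p v = (\<Sum>i\<in>I. \<Sum>j\<in>I. p i j * v i * v j)"

lemma qform_add: "qform I (\<lambda>i j. p i j + q i j) v = qform I p v + qform I q v"
  unfolding qform_def by (simp add: sum.distrib algebra_simps)

lemma qform_scale: "qform I (\<lambda>i j. c * p i j) v = c * qform I p v"
  unfolding qform_def by (simp add: sum_distrib_left algebra_simps)

lemma qform_insert:
  assumes "finite I" "e \<notin> I" "\<And>i. i \<in> I \<Longrightarrow> p i e = p e i"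
  shows "qform (insert e I) p v = p e e * (v e)\<^sup>2 + 2 * v e * (\<Sum>i\<in>I. p e i * v i) + qform I p v"
proof -
  have "qform (insert e I) p v = p e e * v e * v e + (\<Sum>j\<in>I. p e j * v e * v j)
      + (\<Sum>i\<in>I. p i e * v i * v e + (\<Sum>j\<in>I. p i j * v i * v j))"
    unfolding qform_def using assms by simp
  also have "(\<Sum>i\<in>I. p i e * v i * v e + (\<Sum>j\<in>I. p i j * v i * v j))
      = (\<Sum>i\<in>I. p e i * v i * v e) + qform I p v"
    unfolding qform_def sum.distrib using assms(3) by simp
  also have "(\<Sum>j\<in>I. p e j * v e * v j) = v e * (\<Sum>i\<in>I. p e i * v i)"
    by (simp add: sum_distrib_left algebra_simps)
  also have "(\<Sum>i\<in>I. p e i * v i * v e) = v e * (\<Sum>i\<in>I. p e i * v i)"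
    by (simp add: sum_distrib_left algebra_simps)
  finally show ?thesis by (simp add: power2_eq_square algebra_simps)
qed

lemma qform_cong:
  assumes "\<And>i. i \<in> I \<Longrightarrow> v i = w i"
  shows "qform I p v = qform I p w"
  unfolding qform_def using assms by simp

lemma square_complete:
  fixes p x b q :: real
  assumes "p \<noteq> 0"
  shows "p * x\<^sup>2 + 2 * x * b + q = p * (x + b / p)\<^sup>2 + (q - b\<^sup>2 / p)"
  using assms by (simp add: power2_eq_square field_simps)

text \<open>The induction eliminates one variable by completing the square.\<close>

lemma psd_kernel_distance:
  assumes "finite I" "\<And>i j. i \<in> I \<Longrightarrow> j \<in> I \<Longrightarrow> p i j = p j i" "\<And>v. qform I p v \<ge> 0"
  shows "\<exists>l>0. \<forall>v. \<exists>n. qform I p n = 0 \<and> (\<Sum>i\<in>I. (v i - n i)\<^sup>2) \<le> l * qform I p v"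
  using assms
proof (induction I arbitrary: p rule: finite_induct)
  case empty
  show ?case by (intro exI[of _ 1]) (auto simp: qform_def)
next
  case (insert e I)
  have sym: "p i e = p e i" if "i \<in> I" for i using insert.prems(1) that by blast
  define b where "b v = (\<Sum>i\<in>I. p e i * v i)" for v
  have exp: "qform (insert e I) p v = p e e * (v e)\<^sup>2 + 2 * v e * b v + qform I p v" for v
    unfolding b_def by (rule qform_insert[OF insert.hyps(1,2)]) (rule sym)
  have b_cong: "b (v(e := t)) = b v" "qform I q (v(e := t)) = qform I q v" for v t q
    unfolding b_def using insert.hyps by (auto intro!: sum.cong qform_cong)
  have exp_upd: "qform (insert e I) p (v(e := t)) = p e e * t\<^sup>2 + 2 * t * b v + qform I p v" for v t
    unfolding exp b_cong by simp
  have "p e e \<ge> 0"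
  proof -
    have "b (\<lambda>_. 0) = 0" "qform I p (\<lambda>_. 0) = 0" unfolding b_def qform_def by simp_all
    then show ?thesis using insert.prems(2)[of "(\<lambda>_. 0)(e := 1)"] unfolding exp_upd by simp
  qed
  show ?case
  proof (cases "p e e = 0")
    case True
    \<comment> \<open>In a semidefinite form a zero on the diagonal forces its whole row to vanish:
      otherwise the form is -1 at the vector chosen below.\<close>
    have b0: "b v = 0" for v
    proof (rule ccontr)
      assume "b v \<noteq> 0"
      then show False
        using insert.prems(2)[of "v(e := - (qform I p v + 1) / (2 * b v))"] True
        unfolding exp_upd by (simp add: field_simps)
    qed
    have e: "qform (insert e I) p v = qform I p v" for v unfolding exp b0 using True by simp
    obtain l where l: "l > 0" "\<And>v. \<exists>n. qform I p n = 0 \<and> (\<Sum>i\<in>I. (v i - n i)\<^sup>2) \<le> l * qform I p v"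
      using insert.IH[of p] insert.prems unfolding e by blast
    show ?thesis
    proof (intro exI[of _ l] conjI l allI)
      fix v
      obtain n where n: "qform I p n = 0" "(\<Sum>i\<in>I. (v i - n i)\<^sup>2) \<le> l * qform I p v" using l(2) by blast
      have "(\<Sum>i\<in>I. (v i - (n(e := v e)) i)\<^sup>2) = (\<Sum>i\<in>I. (v i - n i)\<^sup>2)"
        using insert.hyps by (intro sum.cong) auto
      then show "\<exists>n. qform (insert e I) p n = 0 \<and>
          (\<Sum>i\<in>insert e I. (v i - n i)\<^sup>2) \<le> l * qform (insert e I) p v"
        using n insert.hyps by (intro exI[of _ "n(e := v e)"]) (simp add: e b_cong)
    qed
  next
    case False
    with \<open>p e e \<ge> 0\<close> have pos: "p e e > 0" by simp
    \<comment> \<open>The Schur complement of the entry \<open>p e e\<close>: what remains after the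
      square containing \<open>v e\<close> is split off.\<close>
    define q where "q i j = p i j + (- 1 / p e e) * (p e i * p e j)" for i j
    have q: "qform I q v = qform I p v - (b v)\<^sup>2 / p e e" for v
    proof -
      have "qform I (\<lambda>i j. p e i * p e j) v = (b v)\<^sup>2"
        unfolding qform_def b_def power2_eq_square sum_product by (simp add: algebra_simps)
      then show ?thesis unfolding q_def qform_add qform_scale by simp
    qed
    have exp': "qform (insert e I) p v = p e e * (v e + b v / p e e)\<^sup>2 + qform I q v" for v
      unfolding exp q using square_complete False by blast
    have "qform I q v \<ge> 0" for v
      using insert.prems(2)[of "v(e := - b v / p e e)"] unfolding exp' b_cong by simp
    moreover have "q i j = q j i" if "i \<in> I" "j \<in> I" for i j
      unfolding q_def using insert.prems(1) that by (simp add: mult.commute)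
    ultimately obtain l where l: "l > 0"
      "\<And>v. \<exists>n. qform I q n = 0 \<and> (\<Sum>i\<in>I. (v i - n i)\<^sup>2) \<le> l * qform I q v"
      using insert.IH[of q] by blast
    define B where "B = (\<Sum>i\<in>I. (p e i)\<^sup>2) / (p e e)\<^sup>2"
    have B: "B \<ge> 0" unfolding B_def by (simp add: sum_nonneg)
    \<comment> \<open>The summands pay for the distance within \<open>I\<close>, for the change of
      the coordinate e caused by it (bounded through \<open>B\<close> by Cauchy-Schwarz), and for
      the completed square. The factors 2 come from (t - s)^2 \<le> 2 * t^2 + 2 * s^2.\<close>
    define l' where "l' = l + 2 * B * l + 2 / p e e"
    have "l' > 0" unfolding l'_def using l B pos by (simp add: add_pos_nonneg)
    then show ?thesis
    proof (intro exI[of _ l'] conjI allI)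
      fix v
      obtain n where n: "qform I q n = 0" "(\<Sum>i\<in>I. (v i - n i)\<^sup>2) \<le> l * qform I q v" using l(2) by blast
      \<comment> \<open>A zero of \<open>q\<close> becomes a zero of the full form once the
        coordinate e makes the completed square vanish.\<close>
      define n' where "n' = n(e := - b n / p e e)"
      have n'0: "qform (insert e I) p n' = 0" unfolding exp' n'_def b_cong n(1) by simp
      define w where "w = (\<Sum>i\<in>I. (v i - n i)\<^sup>2)"
      have w: "0 \<le> w" "w \<le> l * qform I q v" unfolding w_def using n(2) by (auto intro: sum_nonneg)
      have "b (\<lambda>i. v i - n i) = b v - b n" unfolding b_def by (simp add: algebra_simps sum_subtractf)
      then have "(b v - b n)\<^sup>2 \<le> (\<Sum>i\<in>I. (p e i)\<^sup>2) * w"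
        using Cauchy_Schwarz_ineq_sum[of "p e" "\<lambda>i. v i - n i" I] unfolding b_def w_def by simp
      then have a: "((b v - b n) / p e e)\<^sup>2 \<le> B * w"
        unfolding B_def power_divide using pos by (simp add: divide_right_mono)
      define t where "t = v e + b v / p e e"
      have "v e - n' e = t - (b v - b n) / p e e" unfolding n'_def t_def by (simp add: diff_divide_distrib)
      moreover have "(t - s)\<^sup>2 \<le> 2 * t\<^sup>2 + 2 * s\<^sup>2" for s
        using zero_le_power2[of "t + s"] by (simp add: power2_eq_square algebra_simps)
      ultimately have "(v e - n' e)\<^sup>2 \<le> 2 * t\<^sup>2 + 2 * ((b v - b n) / p e e)\<^sup>2" by simp
      also have "\<dots> \<le> 2 * t\<^sup>2 + 2 * (B * w)" using a by simp
      finally have ve: "(v e - n' e)\<^sup>2 \<le> 2 * t\<^sup>2 + 2 * (B * w)" .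
      have "(\<Sum>i\<in>I. (v i - n' i)\<^sup>2) = w" unfolding w_def n'_def
        using insert.hyps by (intro sum.cong) auto
      then have "(\<Sum>i\<in>insert e I. (v i - n' i)\<^sup>2) \<le> w + 2 * (B * w) + 2 * t\<^sup>2" using ve insert.hyps by simp
      also have "w + 2 * (B * w) = (1 + 2 * B) * w" by (simp add: algebra_simps)
      also have "\<dots> \<le> (1 + 2 * B) * (l * qform I q v)" using w B by (intro mult_left_mono) auto
      also have "(1 + 2 * B) * (l * qform I q v) + 2 * t\<^sup>2 \<le> l' * (p e e * t\<^sup>2 + qform I q v)"
      proof -
        have "l' * (p e e * t\<^sup>2 + qform I q v) - ((1 + 2 * B) * (l * qform I q v) + 2 * t\<^sup>2)
            = (l + 2 * B * l) * (p e e * t\<^sup>2) + 2 / p e e * qform I q v"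
          unfolding l'_def using False by (simp add: field_simps)
        also have "\<dots> \<ge> 0" using l B pos \<open>\<And>v. qform I q v \<ge> 0\<close> by simp
        finally show ?thesis by simp
      qed
      finally show "\<exists>n. qform (insert e I) p n = 0 \<and>
          (\<Sum>i\<in>insert e I. (v i - n i)\<^sup>2) \<le> l' * qform (insert e I) p v"
        unfolding exp' t_def[symmetric] using n'0 by (intro exI[of _ n']) (simp add: exp' b_cong)
    qed
  qed
qed

lemma qform_diff_expand:
  "qform I p (\<lambda>i. v i - t * n i) = qform I p v - t * (\<Sum>i\<in>I. \<Sum>j\<in>I. p i j * (v i * n j + n i * v j)) + t\<^sup>2 * qform I p n"
  unfolding qform_def by (simp add: sum_distrib_left sum_subtractf sum.distrib algebra_simps power2_eq_square)

text \<open>On the line v - t * n the coefficient of t^2 is 0, so the form is affine in t; being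
  nonnegative for all t, it is constant.\<close>

lemma psd_diff_kernel:
  assumes psd: "\<And>v. qform I p v \<ge> 0" and n: "qform I p n = 0"
  shows "qform I p (\<lambda>i. v i - n i) = qform I p v"
proof -
  define b where "b = (\<Sum>i\<in>I. \<Sum>j\<in>I. p i j * (v i * n j + n i * v j))"
  have e: "qform I p (\<lambda>i. v i - t * n i) = qform I p v - t * b" for t
    unfolding qform_diff_expand b_def n by simp
  have "b = 0"
  proof (rule ccontr)
    assume "b \<noteq> 0"
    then show False using psd[of "\<lambda>i. v i - ((qform I p v + 1) / b) * n i"] unfolding e by simp
  qed
  then show ?thesis using e[of 1] by simp
qed

text \<open>With m = x - n, the value at x differs from the value 0 at n only by terms containing m,
  of size sqrt X * sqrt Y and Y, where X and Y are the square norms of x and m. Thus a form is small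
  near its zeros, at a rate given by the distance. Squaring removes the roots from the
  statement.\<close>

lemma qform_diff_bound:
  assumes "finite I"
  shows "\<exists>M\<ge>0. \<forall>x n. qform I c n = 0 \<longrightarrow>
    (qform I c x)\<^sup>2 \<le> M * (\<Sum>i\<in>I. (x i - n i)\<^sup>2) * ((\<Sum>i\<in>I. (x i)\<^sup>2) + (\<Sum>i\<in>I. (x i - n i)\<^sup>2))"
proof -
  define A where "A = (\<Sum>i\<in>I. \<Sum>j\<in>I. \<bar>c i j\<bar>)"
  have A: "A \<ge> 0" unfolding A_def by (simp add: sum_nonneg)
  show ?thesis
  proof (intro exI[of _ "8 * A\<^sup>2"] conjI allI impI)
    fix x n assume n: "qform I c n = 0"
    define m where "m i = x i - n i" for i
    define X Y where "X = (\<Sum>i\<in>I. (x i)\<^sup>2)" "Y = (\<Sum>i\<in>I. (m i)\<^sup>2)"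
    note XY = this
    have XY0: "X \<ge> 0" "Y \<ge> 0" unfolding XY by (simp_all add: sum_nonneg)
    have bound: "\<bar>\<Sum>i\<in>I. \<Sum>j\<in>I. c i j * (u i * w j)\<bar> \<le> A * (sqrt (\<Sum>i\<in>I. (u i)\<^sup>2) * sqrt (\<Sum>i\<in>I. (w i)\<^sup>2))" for u w
    proof -
      have 1: "\<bar>u i\<bar> \<le> sqrt (\<Sum>i\<in>I. (u i)\<^sup>2)" if "i \<in> I" for i and u :: "nat \<Rightarrow> real"
      proof -
        have "(u i)\<^sup>2 \<le> (\<Sum>i\<in>I. (u i)\<^sup>2)" using assms that by (intro member_le_sum) auto
        then show ?thesis using real_le_rsqrt[of "\<bar>u i\<bar>"] by simp
      qed
      have "\<bar>\<Sum>i\<in>I. \<Sum>j\<in>I. c i j * (u i * w j)\<bar> \<le> (\<Sum>i\<in>I. \<Sum>j\<in>I. \<bar>c i j * (u i * w j)\<bar>)"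
        by (intro order.trans[OF sum_abs] sum_mono sum_abs)
      also have "\<dots> \<le> (\<Sum>i\<in>I. \<Sum>j\<in>I. \<bar>c i j\<bar> * (sqrt (\<Sum>i\<in>I. (u i)\<^sup>2) * sqrt (\<Sum>i\<in>I. (w i)\<^sup>2)))"
        unfolding abs_mult using 1 by (intro sum_mono mult_left_mono mult_mono) (auto simp: sum_nonneg)
      also have "\<dots> = A * (sqrt (\<Sum>i\<in>I. (u i)\<^sup>2) * sqrt (\<Sum>i\<in>I. (w i)\<^sup>2))"
        unfolding A_def by (simp add: sum_distrib_right)
      finally show ?thesis .
    qed
    have "qform I c x = (\<Sum>i\<in>I. \<Sum>j\<in>I. c i j * (x i * m j)) + (\<Sum>i\<in>I. \<Sum>j\<in>I. c i j * (m i * x j))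
        - (\<Sum>i\<in>I. \<Sum>j\<in>I. c i j * (m i * m j)) + qform I c n"
      unfolding qform_def m_def by (simp add: sum.distrib[symmetric] sum_subtractf[symmetric] algebra_simps)
    then have "\<bar>qform I c x\<bar> \<le> A * (sqrt X * sqrt Y) + A * (sqrt Y * sqrt X) + A * (sqrt Y * sqrt Y)"
      using bound[of x m] bound[of m x] bound[of m m] n unfolding XY by linarith
    also have "\<dots> = A * (2 * (sqrt X * sqrt Y) + Y)" using XY0 by (simp add: algebra_simps)
    finally have "(qform I c x)\<^sup>2 \<le> (A * (2 * (sqrt X * sqrt Y) + Y))\<^sup>2" by (metis abs_ge_zero power2_abs power_mono)
    also have "\<dots> \<le> A\<^sup>2 * (8 * (X * Y) + 8 * Y\<^sup>2)"
    proof -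
      have "(2 * s + Y)\<^sup>2 \<le> 8 * s\<^sup>2 + 8 * Y\<^sup>2" for s
      proof -
        have "(2 * s + Y)\<^sup>2 = 8 * s\<^sup>2 + 2 * Y\<^sup>2 - (2 * s - Y)\<^sup>2" by (simp add: power2_eq_square algebra_simps)
        then show ?thesis using zero_le_power2[of "2 * s - Y"] zero_le_power2[of Y] by linarith
      qed
      from this[of "sqrt X * sqrt Y"] show ?thesis
        unfolding power_mult_distrib using XY0 by (intro mult_left_mono) auto
    qed
    also have "\<dots> = 8 * A\<^sup>2 * Y * (X + Y)" by (simp add: power2_eq_square algebra_simps)
    finally show "(qform I c x)\<^sup>2 \<le> 8 * A\<^sup>2 * (\<Sum>i\<in>I. (x i - n i)\<^sup>2) * ((\<Sum>i\<in>I. (x i)\<^sup>2) + (\<Sum>i\<in>I. (x i - n i)\<^sup>2))"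
      unfolding XY m_def .
  qed simp
qed

text \<open>Near the boundary point (1, 0) a linear pencil stays semidefinite up to second order: if it is
  semidefinite at distance \<open>o(\<epsilon>)\<close> from the points (1, \<open>\<epsilon>\<close>), then already at distance \<open>O(\<epsilon>\<^sup>2)\<close>.\<close>

lemma pencil_second_order:
  fixes a0 a1 a2 :: "nat \<Rightarrow> nat \<Rightarrow> real"
  assumes fin: "finite I"
    and sym: "\<And>i j. i \<in> I \<Longrightarrow> j \<in> I \<Longrightarrow> a0 i j = a0 j i" "\<And>i j. i \<in> I \<Longrightarrow> j \<in> I \<Longrightarrow> a1 i j = a1 j i"
    and zero: "\<And>v. qform I a0 v \<ge> 0"
    and near: "\<And>\<eta> s v. 0 < \<eta> \<Longrightarrow> \<eta> \<le> 1 / 4 \<Longrightarrow> \<bar>s\<bar> = 1 \<Longrightarrow>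
      qform I a0 v + (1 - 9 * \<eta>^4) * qform I a1 v + s * \<eta>^3 * qform I a2 v \<ge> 0"
  shows "\<exists>L\<ge>0. \<forall>K \<epsilon> v. K > L \<longrightarrow> \<epsilon> > 0 \<longrightarrow> (K + L) * \<epsilon>\<^sup>2 \<le> 3 / 4 \<longrightarrow>
     qform I a0 v + (1 - K * \<epsilon>\<^sup>2) * qform I a1 v + \<epsilon> * qform I a2 v \<ge> 0 \<and>
     (qform I a0 v > 0 \<longrightarrow> qform I a0 v + (1 - K * \<epsilon>\<^sup>2) * qform I a1 v + \<epsilon> * qform I a2 v > 0)"
proof -
  \<comment> \<open>\<open>P\<close>, \<open>R\<close> and \<open>C\<close> are the forms of the
    pencil at (1, 0), at the origin, and of its y2-coefficient. The point (1 - s, e) then has the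
    form (1 - s) * P + s * R + e * C, and \<open>W\<close> = \<open>P\<close> + \<open>R\<close> is
    positive wherever one of the two is.\<close>
  define P where "P v = qform I (\<lambda>i j. a0 i j + a1 i j) v" for v
  define R where "R v = qform I a0 v" for v
  define C where "C v = qform I a2 v" for v
  define W where "W v = qform I (\<lambda>i j. 2 * a0 i j + a1 i j) v" for v
  have P: "P v = R v + qform I a1 v" for v unfolding P_def R_def qform_add ..
  have W: "W v = P v + R v" for v unfolding W_def P R_def qform_add qform_scale by simp
  have F: "qform I a0 v + (1 - s) * qform I a1 v + e * qform I a2 v = (1 - s) * P v + s * R v + e * C v" for s e v
    unfolding P by (simp add: R_def C_def algebra_simps)
  have near': "(1 - 9 * \<eta>^4) * P v + 9 * \<eta>^4 * R v + s * \<eta>^3 * C v \<ge> 0"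
    if "0 < \<eta>" "\<eta> \<le> 1 / 4" "\<bar>s\<bar> = 1" for \<eta> s v
    using near[OF that, of v] unfolding F .
  have R0: "R v \<ge> 0" for v using zero unfolding R_def .
  \<comment> \<open>Semidefiniteness passes to the limit point (1, 0).\<close>
  have P0: "P v \<ge> 0" for v
  proof (rule tendsto_lowerbound)
    show "((\<lambda>\<eta>. (1 - 9 * \<eta>^4) * P v + 9 * \<eta>^4 * R v + 1 * \<eta>^3 * C v) \<longlongrightarrow> P v) (at_right 0)"
      by (auto intro!: tendsto_eq_intros)
    show "\<forall>\<^sub>F \<eta> in at_right 0. 0 \<le> (1 - 9 * \<eta>^4) * P v + 9 * \<eta>^4 * R v + 1 * \<eta>^3 * C v"
      unfolding eventually_at_right_field by (intro exI[of _ "1/4"]) (use near'[of _ 1] in auto)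
  qed simp
  have W0: "W v \<ge> 0" for v unfolding W using P0 R0 by (simp add: add_nonneg_nonneg)
  \<comment> \<open>Where \<open>P\<close> vanishes, only 9 * \<eta>^4 * R is left to dominate
    \<eta>^3 * C, for both signs of the latter; dividing by \<eta>^3 and letting \<eta> tend to 0
    gives C = 0. This is the first-order condition.\<close>
  have C0: "C n = 0" if "P n = 0" for n
  proof -
    have *: "\<bar>C n\<bar> \<le> 9 * \<eta> * R n" if \<eta>: "0 < \<eta>" "\<eta> \<le> 1 / 4" for \<eta>
    proof -
      have "\<eta>^3 * (9 * \<eta> * R n + s * C n) \<ge> 0" if "\<bar>s\<bar> = 1" for s
        using near'[OF \<eta> that, of n] \<open>P n = 0\<close> by (simp add: algebra_simps power4_eq_xxxx power3_eq_cube)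
      then have "9 * \<eta> * R n + s * C n \<ge> 0" if "\<bar>s\<bar> = 1" for s
        using \<eta>(1) that by (simp add: zero_le_mult_iff)
      from this[of 1] this[of "-1"] show ?thesis by simp
    qed
    have "\<bar>C n\<bar> \<le> 0"
    proof (rule tendsto_lowerbound)
      show "((\<lambda>\<eta>. 9 * \<eta> * R n) \<longlongrightarrow> 0) (at_right 0)" by (auto intro!: tendsto_eq_intros)
      show "\<forall>\<^sub>F \<eta> in at_right 0. \<bar>C n\<bar> \<le> 9 * \<eta> * R n"
        unfolding eventually_at_right_field by (intro exI[of _ "1/4"]) (use * in auto)
    qed simp
    then show ?thesis by simp
  qed
  \<comment> \<open>The hypothesis at \<eta> = 1 / 4 shows that \<open>W\<close> stays nonnegative
    after adding \<open>\<delta>\<close> * \<open>C\<close> with either sign. Hence zeros of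
    \<open>W\<close> are zeros of both perturbed forms, and subtracting such a zero from v changes
    neither \<open>P\<close> nor \<open>C\<close>.\<close>
  define \<delta> :: real where "\<delta> = (1 / 4) ^ 3"
  have \<delta>: "\<delta> > 0" unfolding \<delta>_def by simp
  define G where "G s v = qform I (\<lambda>i j. (2 * a0 i j + a1 i j) + s * \<delta> * a2 i j) v" for s v
  have G: "G s v = W v + s * \<delta> * C v" for s v unfolding G_def qform_add qform_scale W_def C_def ..
  have G0: "G s v \<ge> 0" if "\<bar>s\<bar> = 1" for s v
  proof -
    have "(1 - 9 * (1/4)^4) * P v + 9 * (1/4)^4 * R v + s * \<delta> * C v \<ge> 0"
      unfolding \<delta>_def by (rule near') (use that in auto)
    moreover have "(1 - 9 * (1/4)^4) * P v \<le> P v" "9 * (1/4)^4 * R v \<le> R v"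
      using P0[of v] R0[of v] by (simp_all add: mult_left_le_one_le power_divide)
    ultimately show ?thesis unfolding G W by linarith
  qed
  have ker: "P (\<lambda>i. v i - n i) = P v \<and> C (\<lambda>i. v i - n i) = C v" if "W n = 0" for v n
  proof -
    have "P n = 0" using that P0[of n] R0[of n] unfolding W by linarith
    then have 1: "P (\<lambda>i. v i - n i) = P v" using psd_diff_kernel P0 unfolding P_def by blast
    have "C n = 0" using C0 \<open>P n = 0\<close> by simp
    then have Gn: "G s n = 0" for s unfolding G using that by simp
    have Gs: "G s (\<lambda>i. v i - n i) = G s v" if "\<bar>s\<bar> = 1" for s
      unfolding G_def by (rule psd_diff_kernel) (use G0[OF that] Gn[of s] in \<open>simp_all add: G_def\<close>)
    have "2 * \<delta> * C w = G 1 w - G (-1) w" for w unfolding G by (simp add: algebra_simps)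
    then have "2 * \<delta> * C (\<lambda>i. v i - n i) = 2 * \<delta> * C v" using Gs[of 1] Gs[of "-1"] by simp
    then show ?thesis using 1 \<delta> by simp
  qed
  have "\<exists>l>0. \<forall>v. \<exists>n. P n = 0 \<and> (\<Sum>i\<in>I. (v i - n i)\<^sup>2) \<le> l * P v"
    unfolding P_def by (rule psd_kernel_distance[OF fin]) (use P0 sym in \<open>simp_all add: P_def\<close>)
  then obtain lP where lP: "lP > 0" "\<And>v. \<exists>n. P n = 0 \<and> (\<Sum>i\<in>I. (v i - n i)\<^sup>2) \<le> lP * P v"
    by blast
  have "\<exists>l>0. \<forall>v. \<exists>n. W n = 0 \<and> (\<Sum>i\<in>I. (v i - n i)\<^sup>2) \<le> l * W v"
    unfolding W_def by (rule psd_kernel_distance[OF fin]) (use W0 sym in \<open>simp_all add: W_def\<close>)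
  then obtain lW where lW: "lW > 0" "\<And>v. \<exists>n. W n = 0 \<and> (\<Sum>i\<in>I. (v i - n i)\<^sup>2) \<le> lW * W v"
    by blast
  obtain M where M: "M \<ge> 0" "\<And>x n. C n = 0 \<Longrightarrow>
    (C x)\<^sup>2 \<le> M * (\<Sum>i\<in>I. (x i - n i)\<^sup>2) * ((\<Sum>i\<in>I. (x i)\<^sup>2) + (\<Sum>i\<in>I. (x i - n i)\<^sup>2))"
    using qform_diff_bound[OF fin, of a2] unfolding C_def by blast
  define L where "L = M * lP * (lW + lP)"
  have L: "L \<ge> 0" unfolding L_def using M lP lW by simp
  \<comment> \<open>Subtracting a nearby zero of \<open>W\<close> makes the square norm of v at most
    lW * W; the distance to a zero of \<open>P\<close>, where \<open>C\<close> vanishes too, is then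
    controlled by \<open>P\<close>. Inserting both in \<open>M\<close> gives the second-order
    estimate.\<close>
  have main: "(C v)\<^sup>2 \<le> L * P v * W v" for v
  proof -
    obtain n where n: "W n = 0" "(\<Sum>i\<in>I. (v i - n i)\<^sup>2) \<le> lW * W v" using lW by blast
    define x where "x = (\<lambda>i. v i - n i)"
    have x: "P x = P v" "C x = C v" using ker[OF n(1)] unfolding x_def by auto
    obtain m where m: "P m = 0" "(\<Sum>i\<in>I. (x i - m i)\<^sup>2) \<le> lP * P x" using lP by blast
    define X Y where "X = (\<Sum>i\<in>I. (x i)\<^sup>2)" "Y = (\<Sum>i\<in>I. (x i - m i)\<^sup>2)"
    note XY = this
    have XY0: "0 \<le> X" "0 \<le> Y" unfolding XY by (simp_all add: sum_nonneg)
    have X: "X \<le> lW * W v" using n(2) unfolding XY x_def .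
    have Y: "Y \<le> lP * P v" using m(2) unfolding XY x .
    have "P v \<le> W v" unfolding W using R0[of v] by simp
    then have "lP * P v \<le> lP * W v" using lP(1) by (intro mult_left_mono) auto
    then have XpY: "X + Y \<le> (lW + lP) * W v" using X Y by (simp add: algebra_simps)
    have "(C v)\<^sup>2 \<le> M * Y * (X + Y)" using M(2)[OF C0[OF m(1)], of x] unfolding XY x(2) .
    also have "\<dots> \<le> M * (lP * P v) * ((lW + lP) * W v)"
      using M(1) Y XpY XY0 P0[of v] lP(1) by (intro mult_mono mult_nonneg_nonneg) auto
    also have "\<dots> = L * P v * W v" unfolding L_def by simp
    finally show ?thesis .
  qed
  show ?thesis
  proof (intro exI[of _ L] conjI allI impI L)
    fix K \<epsilon> :: real and v
    assume K: "K > L" and \<epsilon>: "\<epsilon> > 0" "(K + L) * \<epsilon>\<^sup>2 \<le> 3 / 4"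
    \<comment> \<open>By the inequality of arithmetic and geometric means, \<epsilon> * sqrt (L * P
      * W) is at most P / 4 + L * \<epsilon>^2 * W. Spending a quarter of \<open>P\<close> here
      leaves the 3 / 4 of the smallness condition on \<epsilon>.\<close>
    define E where "E = 1 / 4 * P v + L * \<epsilon>\<^sup>2 * W v"
    have E0: "E \<ge> 0" unfolding E_def using P0 W0 L by simp
    have "(\<epsilon> * C v)\<^sup>2 = \<epsilon>\<^sup>2 * (C v)\<^sup>2" by (simp add: power_mult_distrib)
    also have "\<dots> \<le> \<epsilon>\<^sup>2 * (L * P v * W v)" using main by (intro mult_left_mono) auto
    also have "\<dots> \<le> E\<^sup>2"
      using zero_le_power2[of "1 / 4 * P v - L * \<epsilon>\<^sup>2 * W v"] unfolding E_def
      by (simp add: power2_eq_square algebra_simps)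
    finally have "\<bar>\<epsilon> * C v\<bar> \<le> E" using E0 by (simp add: power2_le_iff_abs_le)
    then have "(1 - K * \<epsilon>\<^sup>2) * P v + K * \<epsilon>\<^sup>2 * R v + \<epsilon> * C v
       \<ge> (1 - K * \<epsilon>\<^sup>2) * P v + K * \<epsilon>\<^sup>2 * R v - E" by linarith
    also have "(1 - K * \<epsilon>\<^sup>2) * P v + K * \<epsilon>\<^sup>2 * R v - E
      = (3 / 4 - (K + L) * \<epsilon>\<^sup>2) * P v + (K - L) * \<epsilon>\<^sup>2 * R v"
      unfolding E_def W by (simp add: algebra_simps)
    finally have ge: "(1 - K * \<epsilon>\<^sup>2) * P v + K * \<epsilon>\<^sup>2 * R v + \<epsilon> * C v
      \<ge> (3 / 4 - (K + L) * \<epsilon>\<^sup>2) * P v + (K - L) * \<epsilon>\<^sup>2 * R v" .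
    have 1: "(3 / 4 - (K + L) * \<epsilon>\<^sup>2) * P v \<ge> 0" using \<epsilon> P0 by simp
    show "qform I a0 v + (1 - K * \<epsilon>\<^sup>2) * qform I a1 v + \<epsilon> * qform I a2 v \<ge> 0"
      using ge 1 K R0[of v] unfolding F by (smt (verit) mult_nonneg_nonneg zero_le_power2)
    assume "qform I a0 v > 0"
    then have "(K - L) * \<epsilon>\<^sup>2 * R v > 0" using K \<epsilon> unfolding R_def by simp
    then show "qform I a0 v + (1 - K * \<epsilon>\<^sup>2) * qform I a1 v + \<epsilon> * qform I a2 v > 0"
      using ge 1 unfolding F by linarith
  qed
qed

section \<open>Linear pencils as quadratic forms\<close>

lemma pencil_quadratic_form:
  fixes A :: "real \<times> real \<Rightarrow> real mat" and v :: "nat \<Rightarrow> real"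
  shows "scalar_prod (vec k v) (lin_pencil k A0 A (y1, y2) *\<^sub>v vec k v) =
    qform {..<k} (\<lambda>i j. A0 $$ (i, j)) v + y1 * qform {..<k} (\<lambda>i j. A (1, 0) $$ (i, j)) v
      + y2 * qform {..<k} (\<lambda>i j. A (0, 1) $$ (i, j)) v"
proof -
  have entry: "lin_pencil k A0 A (y1, y2) $$ (i, j) = A0 $$ (i, j) + y1 * A (1, 0) $$ (i, j) + y2 * A (0, 1) $$ (i, j)"
    if "i < k" "j < k" for i j
    using that unfolding lin_pencil_def by (simp add: Basis_prod_def sum.union_disjoint inner_prod_def)
  have "scalar_prod (vec k v) (lin_pencil k A0 A (y1, y2) *\<^sub>v vec k v)
    = (\<Sum>i<k. \<Sum>j<k. lin_pencil k A0 A (y1, y2) $$ (i, j) * v i * v j)"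
    unfolding scalar_prod_def by (simp add: lin_pencil_def scalar_prod_def sum_distrib_left atLeast0LessThan algebra_simps)
  also have "\<dots> = qform {..<k} (\<lambda>i j. A0 $$ (i, j) + y1 * A (1, 0) $$ (i, j) + y2 * A (0, 1) $$ (i, j)) v"
    unfolding qform_def by (intro sum.cong refl) (simp add: entry)
  finally show ?thesis unfolding qform_add qform_scale .
qed

lemma pos_semidef_pencil_iff:
  fixes A :: "real \<times> real \<Rightarrow> real mat"
  shows "pos_semidef (lin_pencil k A0 A (y1, y2)) \<longleftrightarrow>
    (\<forall>v. qform {..<k} (\<lambda>i j. A0 $$ (i, j)) v + y1 * qform {..<k} (\<lambda>i j. A (1, 0) $$ (i, j)) v
      + y2 * qform {..<k} (\<lambda>i j. A (0, 1) $$ (i, j)) v \<ge> 0)"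
proof -
  have "pos_semidef (lin_pencil k A0 A (y1, y2)) \<longleftrightarrow>
     (\<forall>v. scalar_prod (vec k v) (lin_pencil k A0 A (y1, y2) *\<^sub>v vec k v) \<ge> 0)"
    (is "_ \<longleftrightarrow> ?R")
  proof
    have d: "dim_row (lin_pencil k A0 A (y1, y2)) = k" unfolding lin_pencil_def by simp
    show "pos_semidef (lin_pencil k A0 A (y1, y2)) \<Longrightarrow> ?R" unfolding pos_semidef_def d by simp
    assume R: ?R
    show "pos_semidef (lin_pencil k A0 A (y1, y2))" unfolding pos_semidef_def d
    proof
      fix w :: "real vec" assume "w \<in> carrier_vec k"
      then have "w = vec k (\<lambda>i. vec_index w i)" by auto
      then show "scalar_prod w (lin_pencil k A0 A (y1, y2) *\<^sub>v w) \<ge> 0" using R by metis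
    qed
  qed
  then show ?thesis unfolding pencil_quadratic_form .
qed

lemma pos_def_pencil_iff:
  fixes A :: "real \<times> real \<Rightarrow> real mat"
  shows "pos_def (lin_pencil k A0 A (y1, y2)) \<longleftrightarrow>
    (\<forall>v. (\<exists>i<k. v i \<noteq> 0) \<longrightarrow> qform {..<k} (\<lambda>i j. A0 $$ (i, j)) v + y1 * qform {..<k} (\<lambda>i j. A (1, 0) $$ (i, j)) v
      + y2 * qform {..<k} (\<lambda>i j. A (0, 1) $$ (i, j)) v > 0)"
proof -
  have nz: "vec k v \<noteq> 0\<^sub>v k \<longleftrightarrow> (\<exists>i<k. v i \<noteq> 0)" for v :: "nat \<Rightarrow> real"
    by (auto simp: vec_eq_iff)
  have "pos_def (lin_pencil k A0 A (y1, y2)) \<longleftrightarrow>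
     (\<forall>v. (\<exists>i<k. v i \<noteq> 0) \<longrightarrow> scalar_prod (vec k v) (lin_pencil k A0 A (y1, y2) *\<^sub>v vec k v) > 0)"
    (is "_ \<longleftrightarrow> ?R")
  proof
    have d: "dim_row (lin_pencil k A0 A (y1, y2)) = k" unfolding lin_pencil_def by simp
    show "pos_def (lin_pencil k A0 A (y1, y2)) \<Longrightarrow> ?R" unfolding pos_def_def d nz[symmetric] by simp
    assume R: ?R
    show "pos_def (lin_pencil k A0 A (y1, y2))" unfolding pos_def_def d
    proof (intro ballI impI)
      fix w :: "real vec" assume w: "w \<in> carrier_vec k" "w \<noteq> 0\<^sub>v k"
      then have "w = vec k (\<lambda>i. vec_index w i)" by auto
      then show "scalar_prod w (lin_pencil k A0 A (y1, y2) *\<^sub>v w) > 0" using R w(2) nz by metis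
    qed
  qed
  then show ?thesis unfolding pencil_quadratic_form .
qed

text \<open>The boundary of \<open>S\<close> at (1, 0) behaves like \<open>y1 = 1 - c * \<bar>y2\<bar> powr (4/3)\<close>.\<close>

lemma four_thirds_cusp_not_spectrahedral:
  fixes S :: "(real \<times> real) set"
  assumes zero: "(0, 0) \<in> S"
    and near: "\<And>\<eta> s. 0 < \<eta> \<Longrightarrow> \<eta> \<le> 1 / 4 \<Longrightarrow> \<bar>s\<bar> = 1 \<Longrightarrow> (1 - 9 * \<eta>^4, s * \<eta>^3) \<in> S"
    and out: "\<And>K. K \<ge> 0 \<Longrightarrow> \<forall>\<^sub>F \<eta> in at_right 0. (1 - K * \<eta>^6, \<eta>^3) \<notin> S"
  shows "\<not> spectrahedral S"
proof
  assume "spectrahedral S"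
  then obtain T U where TU: "spectrahedron T" "strict_spectrahedron U" "S = T \<inter> U"
    unfolding spectrahedral_def by blast
  obtain k A0 A where T: "sym_mat k A0" "\<forall>b\<in>Basis. sym_mat k (A b)" "T = {x. pos_semidef (lin_pencil k A0 A x)}"
    using TU(1) unfolding spectrahedron_def by blast
  obtain l B0 B where U: "sym_mat l B0" "\<forall>b\<in>Basis. sym_mat l (B b)" "U = {x. pos_def (lin_pencil l B0 B x)}"
    using TU(2) unfolding strict_spectrahedron_def by blast
  have basis: "(1, 0) \<in> (Basis :: (real \<times> real) set)" by (simp add: Basis_prod_def)
  have sym: "M $$ (i, j) = M $$ (j, i)" if "sym_mat m M" "i < m" "j < m" for m M i j
    using that unfolding sym_mat_def by (metis carrier_matD index_transpose_mat(1))
  define a0 a1 a2 where "a0 i j = A0 $$ (i, j)" "a1 i j = A (1, 0) $$ (i, j)" "a2 i j = A (0, 1) $$ (i, j)" for i j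
  note a = this
  define b0 b1 b2 where "b0 i j = B0 $$ (i, j)" "b1 i j = B (1, 0) $$ (i, j)" "b2 i j = B (0, 1) $$ (i, j)" for i j
  note b = this
  have T_iff: "(y1, y2) \<in> T \<longleftrightarrow> (\<forall>v. qform {..<k} a0 v + y1 * qform {..<k} a1 v + y2 * qform {..<k} a2 v \<ge> 0)" for y1 y2
    unfolding T(3) mem_Collect_eq pos_semidef_pencil_iff a ..
  have U_iff: "(y1, y2) \<in> U \<longleftrightarrow>
      (\<forall>v. (\<exists>i<l. v i \<noteq> 0) \<longrightarrow> qform {..<l} b0 v + y1 * qform {..<l} b1 v + y2 * qform {..<l} b2 v > 0)" for y1 y2
    unfolding U(3) mem_Collect_eq pos_def_pencil_iff b ..
  \<comment> \<open>The weak inequality also covers vectors vanishing on the index set, so the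
    definite pencil satisfies the hypotheses of the same second-order lemma.\<close>
  have U_nonneg: "qform {..<l} b0 v + y1 * qform {..<l} b1 v + y2 * qform {..<l} b2 v \<ge> 0" if "(y1, y2) \<in> U" for y1 y2 v
  proof (cases "\<exists>i<l. v i \<noteq> 0")
    case True
    then show ?thesis using that unfolding U_iff by (intro less_imp_le) blast
  next
    case False
    then have "qform {..<l} p v = 0" for p unfolding qform_def by simp
    then show ?thesis by simp
  qed
  have ST: "S \<subseteq> T" "S \<subseteq> U" using TU(3) by auto
  have zT: "qform {..<k} a0 v \<ge> 0" for v using zero ST(1) T_iff[of 0 0] by auto
  have zU: "qform {..<l} b0 v \<ge> 0" for v using U_nonneg[of 0 0 v] zero ST(2) by auto
  have nT: "qform {..<k} a0 v + (1 - 9 * \<eta>^4) * qform {..<k} a1 v + s * \<eta>^3 * qform {..<k} a2 v \<ge> 0"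
    if "0 < \<eta>" "\<eta> \<le> 1 / 4" "\<bar>s\<bar> = 1" for \<eta> s v
    using near[OF that] ST(1) T_iff[of "1 - 9 * \<eta>^4" "s * \<eta>^3"] by blast
  have nU: "qform {..<l} b0 v + (1 - 9 * \<eta>^4) * qform {..<l} b1 v + s * \<eta>^3 * qform {..<l} b2 v \<ge> 0"
    if "0 < \<eta>" "\<eta> \<le> 1 / 4" "\<bar>s\<bar> = 1" for \<eta> s v
    using U_nonneg near[OF that] ST(2) by blast
  have "\<exists>L\<ge>0. \<forall>K \<epsilon> v. K > L \<longrightarrow> \<epsilon> > 0 \<longrightarrow> (K + L) * \<epsilon>\<^sup>2 \<le> 3 / 4 \<longrightarrow>
     qform {..<k} a0 v + (1 - K * \<epsilon>\<^sup>2) * qform {..<k} a1 v + \<epsilon> * qform {..<k} a2 v \<ge> 0 \<and>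
     (qform {..<k} a0 v > 0 \<longrightarrow> qform {..<k} a0 v + (1 - K * \<epsilon>\<^sup>2) * qform {..<k} a1 v + \<epsilon> * qform {..<k} a2 v > 0)"
    by (rule pencil_second_order[OF _ _ _ zT nT]) (auto simp: a intro: sym[OF T(1)] sym[OF T(2)[rule_format, OF basis]])
  then obtain LT where LT: "LT \<ge> 0" "\<And>K \<epsilon> v. K > LT \<Longrightarrow> \<epsilon> > 0 \<Longrightarrow> (K + LT) * \<epsilon>\<^sup>2 \<le> 3 / 4 \<Longrightarrow>
     qform {..<k} a0 v + (1 - K * \<epsilon>\<^sup>2) * qform {..<k} a1 v + \<epsilon> * qform {..<k} a2 v \<ge> 0" by blast
  have "\<exists>L\<ge>0. \<forall>K \<epsilon> v. K > L \<longrightarrow> \<epsilon> > 0 \<longrightarrow> (K + L) * \<epsilon>\<^sup>2 \<le> 3 / 4 \<longrightarrow>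
     qform {..<l} b0 v + (1 - K * \<epsilon>\<^sup>2) * qform {..<l} b1 v + \<epsilon> * qform {..<l} b2 v \<ge> 0 \<and>
     (qform {..<l} b0 v > 0 \<longrightarrow> qform {..<l} b0 v + (1 - K * \<epsilon>\<^sup>2) * qform {..<l} b1 v + \<epsilon> * qform {..<l} b2 v > 0)"
    by (rule pencil_second_order[OF _ _ _ zU nU]) (auto simp: b intro: sym[OF U(1)] sym[OF U(2)[rule_format, OF basis]])
  then obtain LU where LU: "LU \<ge> 0" "\<And>K \<epsilon> v. K > LU \<Longrightarrow> \<epsilon> > 0 \<Longrightarrow> (K + LU) * \<epsilon>\<^sup>2 \<le> 3 / 4 \<Longrightarrow> qform {..<l} b0 v > 0 \<Longrightarrow>
     qform {..<l} b0 v + (1 - K * \<epsilon>\<^sup>2) * qform {..<l} b1 v + \<epsilon> * qform {..<l} b2 v > 0" by blast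
  \<comment> \<open>Above both thresholds, so that with \<epsilon> = \<eta>^3 one and the same point
    lies in \<open>T\<close> and in \<open>U\<close> although it is outside
    \<open>S\<close>.\<close>
  define K where "K = LT + LU + 1"
  have K: "K > LT" "K > LU" "K \<ge> 0" unfolding K_def using LT(1) LU(1) by auto
  have small: "\<forall>\<^sub>F \<eta> in at_right 0. (K + L) * (\<eta>^3)\<^sup>2 < 3 / 4" for L :: real
  proof (rule order_tendstoD)
    show "((\<lambda>\<eta>. (K + L) * (\<eta>^3)\<^sup>2) \<longlongrightarrow> 0) (at_right 0)" by (auto intro!: tendsto_eq_intros)
  qed simp
  have "\<forall>\<^sub>F \<eta>::real in at_right 0. \<eta> > 0" by (rule eventually_at_right_less)
  with out[OF K(3)] small[of LT] small[of LU]
  have "\<forall>\<^sub>F \<eta> in at_right 0. \<eta> > 0 \<and> (1 - K * \<eta>^6, \<eta>^3) \<notin> S \<and> (K + LT) * (\<eta>^3)\<^sup>2 < 3 / 4 \<and> (K + LU) * (\<eta>^3)\<^sup>2 < 3 / 4"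
    by eventually_elim simp
  then obtain \<eta> where \<eta>: "\<eta> > 0" "(1 - K * \<eta>^6, \<eta>^3) \<notin> S" "(K + LT) * (\<eta>^3)\<^sup>2 < 3 / 4" "(K + LU) * (\<eta>^3)\<^sup>2 < 3 / 4"
    using eventually_happens'[OF trivial_limit_at_right_real] by blast
  have e: "\<eta>^6 = (\<eta>^3)\<^sup>2" by simp
  have "(1 - K * \<eta>^6, \<eta>^3) \<in> T" unfolding T_iff e using LT(2)[OF K(1), of "\<eta>^3"] \<eta> by simp
  moreover have "(1 - K * \<eta>^6, \<eta>^3) \<in> U" unfolding U_iff e
  proof (intro allI impI)
    fix v :: "nat \<Rightarrow> real" assume "\<exists>i<l. v i \<noteq> 0"
    then have "qform {..<l} b0 v > 0" using zero ST(2) U_iff[of 0 0] by auto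
    then show "qform {..<l} b0 v + (1 - K * (\<eta>^3)\<^sup>2) * qform {..<l} b1 v + \<eta>^3 * qform {..<l} b2 v > 0"
      using LU(2)[OF K(2), of "\<eta>^3"] \<eta> by simp
  qed
  ultimately show False using \<eta>(2) TU(3) by blast
qed

section \<open>The conic z1^2 + i * z2^2 + 1\<close>

lemma cusp_conic_iff:
  "(y1, y2) \<in> imaginary_set (\<lambda>z1 z2. z1\<^sup>2 + \<i> * z2\<^sup>2 = - 1) \<longleftrightarrow>
    (\<exists>x1 x2. x1\<^sup>2 - y1\<^sup>2 - 2 * x2 * y2 = - 1 \<and> 2 * x1 * y1 + x2\<^sup>2 - y2\<^sup>2 = 0)"
  unfolding imaginary_set_iff by (simp add: complex_eq_iff power2_eq_square algebra_simps)

text \<open>Near (1, 0) the second equation gives x1 close to - x2^2 / 2, and the first becomes x2^4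
  / 4 = 2 * x2 * y2 - 2 * (1 - y1) to leading order. The maximum of 2 * x2 * y2 - x2^4 / 4 is (3 /
  2) * 2 powr (1/3) * \<bar>y2\<bar> powr (4/3), so the boundary lies at 1 - y1 of order
  \<bar>y2\<bar> powr (4/3). With \<bar>y2\<bar> = \<eta>^3 this is \<eta>^4; the constant 9 is
  generously beyond it, while K * \<eta>^6 is of smaller order.\<close>

lemma cusp_conic_not_spectrahedral:
  "\<not> spectrahedral (- imaginary_set (\<lambda>z1 z2. z1\<^sup>2 + \<i> * z2\<^sup>2 = - 1))"
proof (rule four_thirds_cusp_not_spectrahedral)
  show "(0, 0) \<in> - imaginary_set (\<lambda>z1 z2. z1\<^sup>2 + \<i> * z2\<^sup>2 = - 1)"
    unfolding Compl_iff cusp_conic_iff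
  proof (clarsimp)
    fix x :: real assume "x\<^sup>2 = - 1"
    then show False using zero_le_power2[of x] by linarith
  qed
next
  fix \<eta> s :: real assume \<eta>: "0 < \<eta>" "\<eta> \<le> 1 / 4" and s: "\<bar>s\<bar> = 1"
  show "(1 - 9 * \<eta>^4, s * \<eta>^3) \<in> - imaginary_set (\<lambda>z1 z2. z1\<^sup>2 + \<i> * z2\<^sup>2 = - 1)"
    unfolding Compl_iff cusp_conic_iff
  proof clarify
    define y where "y = 1 - 9 * \<eta>^4"
    fix x1 x2 assume "x1\<^sup>2 - (1 - 9 * \<eta>^4)\<^sup>2 - 2 * x2 * (s * \<eta>^3) = - 1"
      "2 * x1 * (1 - 9 * \<eta>^4) + x2\<^sup>2 - (s * \<eta>^3)\<^sup>2 = 0"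
    then have e: "x1\<^sup>2 = y\<^sup>2 - 1 + 2 * x2 * (s * \<eta>^3)" "x2\<^sup>2 - (s * \<eta>^3)\<^sup>2 = - 2 * x1 * y"
      unfolding y_def by simp_all
    have s2: "s\<^sup>2 = 1" using s by (metis one_power2 power2_abs)
    have \<eta>4: "\<eta>^4 \<le> (1/4)^4" using \<eta> by (intro power_mono) auto
    then have y: "0 \<le> y" "y \<le> 1" unfolding y_def by (simp_all add: power_divide)
    have "y\<^sup>2 \<le> y" using y by (simp add: power2_eq_square mult_left_le)
    then have y2: "y\<^sup>2 - 1 \<le> - 9 * \<eta>^4" unfolding y_def by simp
    define x where "x = \<bar>x2\<bar>"
    have x0: "x \<ge> 0" unfolding x_def by simp
    have "x2 * s \<le> \<bar>x2 * s\<bar>" by simp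
    then have "x2 * s \<le> x" unfolding x_def abs_mult s by simp
    then have "x2 * s * \<eta>^3 \<le> x * \<eta>^3" using \<eta> by (intro mult_right_mono) auto
    then have x1: "x1\<^sup>2 \<le> 2 * (x * \<eta>^3) - 9 * \<eta>^4" using e(1) y2 by (simp add: algebra_simps)
    \<comment> \<open>For x up to 4 * \<eta> the first equation would make x1^2 negative. For larger
      x the second equation makes x1 quadratic in x, so x1^2 grows like x^4 and exceeds its upper
      bound of order x * \<eta>^3.\<close>
    show False
    proof (cases "x \<le> 4 * \<eta>")
      case True
      then have "x * \<eta>^3 \<le> 4 * \<eta> * \<eta>^3" using \<eta> by (intro mult_right_mono) auto
      also have "\<dots> = 4 * \<eta>^4" by (simp add: power4_eq_xxxx power3_eq_cube)
      finally have "x1\<^sup>2 \<le> - (\<eta>^4)" using x1 by simp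
      moreover have "\<eta>^4 > 0" using \<eta> by simp
      ultimately show False using zero_le_power2[of x1] by linarith
    next
      case False
      then have x: "x > 4 * \<eta>" by simp
      have \<eta>40: "0 \<le> \<eta>^4" using \<eta> by simp
      have "(x2\<^sup>2 - \<eta>^6)\<^sup>2 = 4 * x1\<^sup>2 * y\<^sup>2"
      proof -
        have "(s * \<eta>^3)\<^sup>2 = \<eta>^6" unfolding power_mult_distrib s2 by simp
        then have "x2\<^sup>2 - \<eta>^6 = - 2 * x1 * y" using e(2) by argo
        then show ?thesis by (simp add: power_mult_distrib)
      qed
      also have "\<dots> \<le> 4 * x1\<^sup>2 * 1" using y by (intro mult_left_mono power_le_one) auto
      also have "\<dots> \<le> 8 * (x * \<eta>^3)" using x1 \<eta>40 by linarith
      finally have up: "(x\<^sup>2 - \<eta>^6)\<^sup>2 \<le> 8 * (x * \<eta>^3)" unfolding x_def by simp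
      have "\<eta>^6 \<le> \<eta>\<^sup>2" using \<eta> by (intro power_decreasing) auto
      moreover have "16 * \<eta>\<^sup>2 \<le> x\<^sup>2"
        using power_mono[of "4 * \<eta>" x 2] x \<eta> by (simp add: power_mult_distrib)
      moreover have "0 \<le> \<eta>\<^sup>2" by simp
      ultimately have "3 / 4 * x\<^sup>2 \<le> x\<^sup>2 - \<eta>^6" by linarith
      then have "(3 / 4 * x\<^sup>2)\<^sup>2 \<le> (x\<^sup>2 - \<eta>^6)\<^sup>2" by (intro power_mono) auto
      then have "9 / 16 * x^4 \<le> 8 * (x * \<eta>^3)" using up by (simp add: power_mult_distrib power_divide)
      moreover have "x^4 = x * x^3" by (simp add: power4_eq_xxxx power3_eq_cube)
      ultimately have "x * (9 / 16 * x^3) \<le> x * (8 * \<eta>^3)" by simp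
      moreover have "x > 0" using x \<eta> by simp
      ultimately have "9 / 16 * x^3 \<le> 8 * \<eta>^3" by simp
      moreover have "(4 * \<eta>)^3 \<le> x^3" using x \<eta> by (intro power_mono) auto
      moreover have "\<eta>^3 > 0" using \<eta> by simp
      ultimately show False unfolding power_mult_distrib by simp
    qed
  qed
next
  fix K :: real assume K: "K \<ge> 0"
  have "((\<lambda>\<eta>. 2 * K * \<eta>\<^sup>2) \<longlongrightarrow> 0) (at_right 0)" by (auto intro!: tendsto_eq_intros)
  then have "\<forall>\<^sub>F \<eta> in at_right 0. 2 * K * \<eta>\<^sup>2 < 1" by (rule order_tendstoD) simp
  moreover have "((\<lambda>\<eta>. K * \<eta>^6) \<longlongrightarrow> 0) (at_right 0)" by (auto intro!: tendsto_eq_intros)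
  then have "\<forall>\<^sub>F \<eta> in at_right 0. K * \<eta>^6 < 1 / 2" by (rule order_tendstoD) simp
  moreover have "\<forall>\<^sub>F \<eta>::real in at_right 0. \<eta> < 1"
    by (rule order_tendstoD[OF tendsto_ident_at]) simp
  moreover have "\<forall>\<^sub>F \<eta>::real in at_right 0. \<eta> > 0" by (rule eventually_at_right_less)
  ultimately show "\<forall>\<^sub>F \<eta> in at_right 0. (1 - K * \<eta>^6, \<eta>^3) \<notin> - imaginary_set (\<lambda>z1 z2. z1\<^sup>2 + \<i> * z2\<^sup>2 = - 1)"
  proof eventually_elim
    case (elim \<eta>)
    note \<eta> = this
    define y1 y2 where "y1 = 1 - K * \<eta>^6" "y2 = \<eta>^3"
    note y = this
    have y1: "1 / 2 \<le> y1" "y1 \<le> 1" unfolding y using \<eta> K by simp_all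
    \<comment> \<open>The first equation after solving the second for x1. At x = \<eta> the term 2 *
      x * y2 = 2 * \<eta>^4 outweighs the square, at most \<eta>^4, and 1 - y1^2, which is at most 2
      * K * \<eta>^6; at x = 4 the square dominates.\<close>
    define h where "h x = ((y2\<^sup>2 - x\<^sup>2) / (2 * y1))\<^sup>2 - y1\<^sup>2 - 2 * x * y2 + 1" for x
    have cont: "continuous_on {a..b} h" for a b
      unfolding h_def using y1 by (intro continuous_intros) auto
    have sq: "1 \<le> (2 * y1)\<^sup>2" "(2 * y1)\<^sup>2 \<le> 4"
      using power_mono[of 1 "2 * y1" 2] power_mono[of "2 * y1" 2 2] y1 by simp_all
    have "h \<eta> \<le> 0"
    proof -
      have y22: "y2\<^sup>2 = \<eta>^6" unfolding y by simp
      have "\<eta>^6 \<le> \<eta>\<^sup>2" using \<eta> by (intro power_decreasing) auto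
      then have "(\<eta>\<^sup>2 - \<eta>^6)\<^sup>2 \<le> (\<eta>\<^sup>2)\<^sup>2" using \<eta> by (intro power_mono) auto
      then have "(y2\<^sup>2 - \<eta>\<^sup>2)\<^sup>2 \<le> \<eta>^4" unfolding y22 by (simp add: power2_commute)
      moreover have "((y2\<^sup>2 - \<eta>\<^sup>2) / (2 * y1))\<^sup>2 \<le> (y2\<^sup>2 - \<eta>\<^sup>2)\<^sup>2"
        unfolding power_divide using sq(1) by (simp add: divide_le_eq mult_le_cancel_left1)
      moreover have "1 - y1\<^sup>2 \<le> 2 * (K * \<eta>^6)"
      proof -
        have "1 - y1\<^sup>2 = (1 - y1) * (1 + y1)" by (simp add: power2_eq_square algebra_simps)
        also have "\<dots> \<le> (1 - y1) * 2" using y1 by (intro mult_left_mono) auto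
        finally show ?thesis unfolding y by simp
      qed
      moreover have "2 * (K * \<eta>^6) \<le> \<eta>^4"
      proof -
        have "2 * (K * \<eta>^6) = (2 * K * \<eta>\<^sup>2) * \<eta>^4" by (simp add: power_add[symmetric])
        also have "\<dots> \<le> 1 * \<eta>^4" using \<eta> by (intro mult_right_mono) auto
        finally show ?thesis by simp
      qed
      moreover have "2 * \<eta> * y2 = 2 * \<eta>^4" unfolding y by (simp add: power4_eq_xxxx power3_eq_cube)
      ultimately show ?thesis unfolding h_def by linarith
    qed
    moreover have "h 4 \<ge> 0"
    proof -
      have y21: "0 \<le> y2" "y2 \<le> 1" "y2\<^sup>2 \<le> 1" unfolding y using \<eta> by (simp_all add: power_le_one)
      have "225 \<le> (y2\<^sup>2 - 4\<^sup>2)\<^sup>2" using power_mono[of 15 "16 - y2\<^sup>2" 2] y21 by (simp add: power2_commute)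
      then have "((y2\<^sup>2 - 4\<^sup>2) / (2 * y1))\<^sup>2 \<ge> 225 / 4"
        unfolding power_divide using sq by (intro frac_le) auto
      moreover have "y1\<^sup>2 \<le> 1" using y1 by (intro power_le_one) auto
      ultimately show ?thesis unfolding h_def using y21 by simp
    qed
    ultimately obtain x where x: "h x = 0" using IVT'[of h \<eta> 0 4] \<eta> cont by auto
    have "((y2\<^sup>2 - x\<^sup>2) / (2 * y1))\<^sup>2 - y1\<^sup>2 - 2 * x * y2 = - 1" using x unfolding h_def by simp
    moreover have "2 * ((y2\<^sup>2 - x\<^sup>2) / (2 * y1)) * y1 = y2\<^sup>2 - x\<^sup>2" using y1 by (simp add: field_simps)
    then have "2 * ((y2\<^sup>2 - x\<^sup>2) / (2 * y1)) * y1 + x\<^sup>2 - y2\<^sup>2 = 0" by simp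
    ultimately have "(y1, y2) \<in> imaginary_set (\<lambda>z1 z2. z1\<^sup>2 + \<i> * z2\<^sup>2 = - 1)"
      unfolding cusp_conic_iff by blast
    then show ?case unfolding y by simp
  qed
qed

section \<open>Real roots\<close>

text \<open>This is the nonnegativity of the trace of one semidefinite matrix times the adjugate of
  another. After squaring it follows from the inequality of arithmetic and geometric means for
  \<open>l1 * m2\<close> and \<open>m1 * l2\<close>.\<close>

lemma psd2_cross:
  fixes l1 l2 l3 m1 m2 m3 :: real
  assumes "0 \<le> l1" "0 \<le> l2" "l3\<^sup>2 \<le> l1 * l2" "0 \<le> m1" "0 \<le> m2" "m3\<^sup>2 \<le> m1 * m2"
  shows "2 * (l3 * m3) \<le> l1 * m2 + m1 * l2"
proof (rule power2_le_imp_le)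
  have "(2 * (l3 * m3))\<^sup>2 = 4 * (l3\<^sup>2 * m3\<^sup>2)" by (simp add: power_mult_distrib)
  also have "\<dots> \<le> 4 * ((l1 * l2) * (m1 * m2))" using assms by (intro mult_left_mono mult_mono) auto
  also have "\<dots> \<le> (l1 * m2 + m1 * l2)\<^sup>2"
    using zero_le_power2[of "l1 * m2 - m1 * l2"] by (simp add: power2_eq_square algebra_simps)
  finally show "(2 * (l3 * m3))\<^sup>2 \<le> (l1 * m2 + m1 * l2)\<^sup>2" .
qed (use assms in auto)

text \<open>The determinant of u * X + v * Y is u^2 * det X + v^2 * det Y plus u * v times the mixed
  term of \<open>psd2_cross\<close>. Convexity supplies the connectedness of all candidate
  components below.\<close>

lemma spectrahedral2_convex:
  assumes "spectrahedral2 S"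
  shows "convex S"
proof -
  obtain l1 l2 l3 l4 l5 l6 where l: "affine_fun l1" "affine_fun l2" "affine_fun l3" "affine_fun l4" "affine_fun l5" "affine_fun l6"
    "S = {x. 0 \<le> l1 x \<and> 0 \<le> l2 x \<and> (l3 x)\<^sup>2 \<le> l1 x * l2 x \<and> 0 < l4 x \<and> (l6 x)\<^sup>2 < l4 x * l5 x}"
    using assms unfolding spectrahedral2_def by (elim exE conjE) (rule that; assumption)
  have aff: "l (u *\<^sub>R x + v *\<^sub>R y) = u * l x + v * l y" if l: "affine_fun l" and uv: "u + v = 1" for l u v x y
  proof -
    obtain r a b where "l = (\<lambda>x. r + a * fst x + b * snd x)" using l unfolding affine_fun_def by blast
    moreover have "r = u * r + v * r" using uv by (metis distrib_right mult_1)
    ultimately show ?thesis by (simp add: algebra_simps)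
  qed
  have exp: "(u * p1 + v * q1) * (u * p2 + v * q2) - (u * p3 + v * q3)\<^sup>2
     = u\<^sup>2 * (p1 * p2 - p3\<^sup>2) + v\<^sup>2 * (q1 * q2 - q3\<^sup>2) + u * v * (p1 * q2 + q1 * p2 - 2 * (p3 * q3))"
    for u v p1 p2 p3 q1 q2 q3 :: real by (simp add: power2_eq_square algebra_simps)
  show ?thesis
  proof (rule convexI)
    fix x y u v assume x: "x \<in> S" and y: "y \<in> S" and uv: "0 \<le> u" "0 \<le> v" "u + v = (1::real)"
    have x': "0 \<le> l1 x" "0 \<le> l2 x" "(l3 x)\<^sup>2 \<le> l1 x * l2 x" "0 < l4 x" "(l6 x)\<^sup>2 < l4 x * l5 x"
      using x unfolding l(7) by auto
    have y': "0 \<le> l1 y" "0 \<le> l2 y" "(l3 y)\<^sup>2 \<le> l1 y * l2 y" "0 < l4 y" "(l6 y)\<^sup>2 < l4 y * l5 y"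
      using y unfolding l(7) by auto
    have "l4 x * l5 x > 0" "l4 y * l5 y > 0"
      using x'(5) y'(5) zero_le_power2[of "l6 x"] zero_le_power2[of "l6 y"] by linarith+
    then have 5: "l5 x > 0" "l5 y > 0" using x'(4) y'(4) by (auto simp: zero_less_mult_iff)
    let ?z = "u *\<^sub>R x + v *\<^sub>R y"
    have "l1 x * l2 y + l1 y * l2 x - 2 * (l3 x * l3 y) \<ge> 0" using psd2_cross[OF x'(1-3) y'(1-3)] by simp
    then have E: "l1 ?z * l2 ?z - (l3 ?z)\<^sup>2 \<ge> 0"
      unfolding aff[OF l(1) uv(3)] aff[OF l(2) uv(3)] aff[OF l(3) uv(3)] exp
      using x' y' uv by (intro add_nonneg_nonneg mult_nonneg_nonneg) auto
    have "l4 x * l5 y + l4 y * l5 x - 2 * (l6 x * l6 y) \<ge> 0"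
      using psd2_cross[of "l4 x" "l5 x" "l6 x" "l4 y" "l5 y" "l6 y"] x' y' 5 by simp
    then have c: "u * v * (l4 x * l5 y + l4 y * l5 x - 2 * (l6 x * l6 y)) \<ge> 0" using uv by simp
    have "u > 0 \<or> v > 0" using uv by linarith
    then have "u\<^sup>2 * (l4 x * l5 x - (l6 x)\<^sup>2) > 0 \<or> v\<^sup>2 * (l4 y * l5 y - (l6 y)\<^sup>2) > 0"
      using x'(5) y'(5) by auto
    moreover have "u\<^sup>2 * (l4 x * l5 x - (l6 x)\<^sup>2) \<ge> 0" "v\<^sup>2 * (l4 y * l5 y - (l6 y)\<^sup>2) \<ge> 0"
      using x'(5) y'(5) by auto
    ultimately have "l4 ?z * l5 ?z - (l6 ?z)\<^sup>2 > 0"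
      unfolding aff[OF l(4) uv(3)] aff[OF l(5) uv(3)] aff[OF l(6) uv(3)] exp using c by linarith
    moreover have "l4 ?z > 0" unfolding aff[OF l(4) uv(3)] using \<open>u > 0 \<or> v > 0\<close> uv x'(4) y'(4)
      by (auto intro: add_pos_nonneg add_nonneg_pos)
    moreover have "l1 ?z \<ge> 0" "l2 ?z \<ge> 0" unfolding aff[OF l(1) uv(3)] aff[OF l(2) uv(3)] using uv x' y' by auto
    ultimately show "?z \<in> S" using E unfolding l(7) by simp
  qed
qed

lemma affine_fun_const: "affine_fun (\<lambda>x. c)"
  unfolding affine_fun_def by (rule exI[of _ c], rule exI[of _ 0], rule exI[of _ 0]) simp

lemma affine_funI: "(\<And>x. l x = r + a * fst x + b * snd x) \<Longrightarrow> affine_fun l"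
  unfolding affine_fun_def by blast

lemma not_bounded_if_ray:
  fixes C :: "(real \<times> real) set"
  assumes ray: "\<And>r. r \<ge> 1 \<Longrightarrow> (a + r * b, c + r * d) \<in> C" and "b \<noteq> 0 \<or> d \<noteq> 0"
  shows "\<not> bounded C"
proof
  assume "bounded C"
  then obtain B where B: "\<And>x. x \<in> C \<Longrightarrow> norm x \<le> B" unfolding bounded_iff by blast
  have *: "False" if "q \<noteq> 0" "\<And>r. r \<ge> 1 \<Longrightarrow> \<bar>p + r * q\<bar> \<le> B" for p q :: real
  proof -
    define r where "r = 1 + (B + \<bar>p\<bar>) / \<bar>q\<bar>"
    have "\<bar>p + 1 * q\<bar> \<le> B" using that(2)[of 1] by simp
    then have "B \<ge> 0" by linarith
    then have r: "r \<ge> 1" unfolding r_def by simp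
    have "\<bar>r * q\<bar> = r * \<bar>q\<bar>" using r by (simp add: abs_mult)
    also have "(B + \<bar>p\<bar>) / \<bar>q\<bar> * \<bar>q\<bar> = B + \<bar>p\<bar>" using that(1) by simp
    then have "r * \<bar>q\<bar> = \<bar>q\<bar> + B + \<bar>p\<bar>" unfolding r_def distrib_right by simp
    finally show False using that(2)[OF r] that(1) by linarith
  qed
  have "\<bar>a + r * b\<bar> \<le> B" "\<bar>c + r * d\<bar> \<le> B" if "r \<ge> 1" for r
    using B[OF ray[OF that]] norm_fst_le[of "a + r * b" "c + r * d"] norm_snd_le[of "c + r * d" "a + r * b"] by simp_all
  then show False using * assms(2) by blast
qed

section \<open>Real zeros of quadratics and cubics\<close>

lemma quadratic_solvable_iff:
  fixes a b c :: real
  assumes "a \<noteq> 0"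
  shows "(\<exists>x. a * x\<^sup>2 + 2 * b * x + c = 0) \<longleftrightarrow> a * c \<le> b\<^sup>2"
proof
  assume "\<exists>x. a * x\<^sup>2 + 2 * b * x + c = 0"
  then obtain x where "a * x\<^sup>2 + 2 * b * x + c = 0" by blast
  then have "a * (a * x\<^sup>2 + 2 * b * x + c) = 0" by simp
  then have "(a * x + b)\<^sup>2 = b\<^sup>2 - a * c" by (simp add: power2_eq_square algebra_simps)
  then show "a * c \<le> b\<^sup>2" using zero_le_power2[of "a * x + b"] by linarith
next
  assume le: "a * c \<le> b\<^sup>2"
  define w where "w = sqrt (b\<^sup>2 - a * c)"
  define x where "x = (- b + w) / a"
  have "a * x = - b + w" unfolding x_def using assms by simp
  then have "(a * x + b)\<^sup>2 = b\<^sup>2 - a * c" unfolding w_def using le by simp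
  then have "a * (a * x\<^sup>2 + 2 * b * x + c) = 0" by (simp add: power2_eq_square algebra_simps)
  then show "\<exists>x. a * x\<^sup>2 + 2 * b * x + c = 0" using assms by auto
qed

lemma monic_cubic_has_root:
  fixes a b c :: real
  shows "\<exists>x. x^3 + a * x\<^sup>2 + b * x + c = 0"
proof -
  define f where "f x = x^3 + a * x\<^sup>2 + b * x + c" for x
  define N where "N = 1 + \<bar>a\<bar> + \<bar>b\<bar> + \<bar>c\<bar>"
  have N: "N \<ge> 1" unfolding N_def by simp
  have bound: "\<bar>a * x\<^sup>2 + b * x + c\<bar> \<le> N^3" if x: "\<bar>x\<bar> = N" for x
  proof -
    have x2: "x\<^sup>2 = N\<^sup>2" using x by (metis power2_abs)
    have N2: "1 \<le> N\<^sup>2" "N \<le> N\<^sup>2" using N by (simp_all add: self_le_power)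
    have "\<bar>a * x\<^sup>2 + b * x + c\<bar> \<le> \<bar>a * x\<^sup>2\<bar> + \<bar>b * x\<bar> + \<bar>c\<bar>" by linarith
    also have "\<dots> = \<bar>a\<bar> * N\<^sup>2 + \<bar>b\<bar> * N + \<bar>c\<bar> * 1" by (simp add: abs_mult x x2)
    also have "\<dots> \<le> \<bar>a\<bar> * N\<^sup>2 + \<bar>b\<bar> * N\<^sup>2 + \<bar>c\<bar> * N\<^sup>2"
      using N2 by (intro add_mono mult_left_mono) auto
    also have "\<dots> = (N - 1) * N\<^sup>2" unfolding N_def by (simp add: algebra_simps)
    also have "\<dots> \<le> N * N\<^sup>2" using N by (intro mult_right_mono) auto
    finally show ?thesis by (simp add: power3_eq_cube power2_eq_square)
  qed
  have "f (- N) \<le> 0" "f N \<ge> 0" using bound[of "- N"] bound[of N] N unfolding f_def by simp_all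
  moreover have "continuous_on {- N..N} f" unfolding f_def by (intro continuous_intros)
  ultimately obtain x where "f x = 0" using IVT'[of f "- N" 0 N] N by auto
  then show ?thesis unfolding f_def by blast
qed

section \<open>Normal forms with a double real root\<close>

text \<open>Count, unboundedness and spectrahedral description are bundled because all three are
  carried along by an affine change of coordinates.\<close>

definition class_1a_shape :: "(real \<times> real) set \<Rightarrow> bool" where
  "class_1a_shape S \<longleftrightarrow> card (components S) \<in> {1, 2, 3} \<and> (\<forall>C\<in>components S. \<not> bounded C \<and> spectrahedral2 C)"

lemma card_components_aff_image:
  assumes "affine_map \<phi>"
  shows "card (components (\<phi> ` S)) = card (components S)"
  unfolding components_aff_image[OF assms]
  by (intro card_image inj_onI) (simp add: inj_image_eq_iff affine_map_inj assms)

lemma class_1a_shape_aff_image: "affine_map \<phi> \<Longrightarrow> class_1a_shape S \<Longrightarrow> class_1a_shape (\<phi> ` S)"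
  unfolding class_1a_shape_def by (simp add: card_components_aff_image)
    (simp add: components_aff_image bounded_aff_image spectrahedral2_aff_image)

lemma class_1a_shape_partition:
  assumes "S = \<Union>F" "card F \<in> {1, 2, 3}" "\<And>C. C \<in> F \<Longrightarrow> spectrahedral2 C \<and> \<not> bounded C"
    "\<And>C D. C \<in> F \<Longrightarrow> D \<in> F \<Longrightarrow> C \<noteq> D \<Longrightarrow> C \<inter> D = {}"
    "\<And>C. C \<in> F \<Longrightarrow> \<exists>U. open U \<and> S \<inter> U = C"
  shows "class_1a_shape S"
proof -
  have "connected C \<and> C \<noteq> {}" if "C \<in> F" for C
    using assms(3)[OF that] spectrahedral2_convex convex_connected by auto
  then have "components S = F" by (intro components_partition assms(1,4,5))
  then show ?thesis unfolding class_1a_shape_def using assms(2,3) by simp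
qed

lemma spectrahedral2_strict:
  assumes "affine_fun l1" "affine_fun l2" "affine_fun l3"
  shows "spectrahedral2 {x. 0 < l1 x \<and> (l3 x)\<^sup>2 < l1 x * l2 x}"
  by (rule spectrahedral2I[OF affine_fun_const[of 1] affine_fun_const[of 1] affine_fun_const[of 0] assms]) simp

lemma spectrahedral2_strict_half_plane:
  assumes "affine_fun l"
  shows "spectrahedral2 {x. 0 < l x}"
proof -
  have "{x. 0 < l x} = {x. 0 < l x \<and> 0\<^sup>2 < l x * 1}" by auto
  then show ?thesis using spectrahedral2_strict[OF assms affine_fun_const[of 1] affine_fun_const[of 0]] by simp
qed

lemma imaginary_set_square_iff:
  "(y1, y2) \<in> imaginary_set (\<lambda>z1 z2. z1\<^sup>2 = k) \<longleftrightarrow> \<bar>y1\<bar> = \<bar>Im (csqrt k)\<bar>"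
proof -
  define w where "w = csqrt k"
  have "z\<^sup>2 = k \<longleftrightarrow> z = w \<or> z = - w" for z
    unfolding w_def by (metis power2_csqrt power2_eq_iff)
  then have "(y1, y2) \<in> imaginary_set (\<lambda>z1 z2. z1\<^sup>2 = k) \<longleftrightarrow> y1 = Im w \<or> y1 = - Im w"
    unfolding imaginary_set_iff by (auto simp: complex_eq_iff)
  then show ?thesis unfolding w_def by (auto simp: abs_eq_iff)
qed

lemma open_half_planes:
  "open {x::real \<times> real. fst x > m}" "open {x::real \<times> real. fst x < m}"
  "open {x::real \<times> real. snd x > m}" "open {x::real \<times> real. snd x < m}"
  by (auto intro!: open_Collect_less continuous_intros)

text \<open>The imaginary projection consists of the two lines where the first coordinate is plus or
  minus Im (csqrt k). They leave two half planes and a strip between them, or only the half planes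
  when they coincide.\<close>

lemma class_1a_shape_square: "class_1a_shape (- imaginary_set (\<lambda>z1 z2. z1\<^sup>2 = k))"
proof -
  define m where "m = \<bar>Im (csqrt k)\<bar>"
  define S where "S = - imaginary_set (\<lambda>z1 z2. z1\<^sup>2 = k)"
  have m: "m \<ge> 0" unfolding m_def by simp
  have S: "x \<in> S \<longleftrightarrow> \<bar>fst x\<bar> \<noteq> m" for x
    unfolding S_def Compl_iff using imaginary_set_square_iff[of "fst x" "snd x" k] m_def by simp
  define R where "R = {x::real \<times> real. fst x > m}"
  define L where "L = {x::real \<times> real. fst x < - m}"
  define M where "M = {x::real \<times> real. - m < fst x \<and> fst x < m}"
  have R: "spectrahedral2 R" "\<not> bounded R" "open R"
  proof -
    have R: "R = {x. 0 < fst x - m}" unfolding R_def by auto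
    show "spectrahedral2 R" unfolding R by (intro spectrahedral2_strict_half_plane affine_funI[of _ "- m" 1 0]) simp
    show "\<not> bounded R" by (rule not_bounded_if_ray[of m 1 0 0]) (auto simp: R_def)
    show "open R" unfolding R_def by (rule open_half_planes)
  qed
  have L: "spectrahedral2 L" "\<not> bounded L" "open L"
  proof -
    have L: "L = {x. 0 < - m - fst x}" unfolding L_def by auto
    show "spectrahedral2 L" unfolding L by (intro spectrahedral2_strict_half_plane affine_funI[of _ "- m" "-1" 0]) simp
    show "\<not> bounded L" by (rule not_bounded_if_ray[of "- m" "-1" 0 0]) (auto simp: L_def)
    show "open L" unfolding L_def by (rule open_half_planes)
  qed
  have RL: "R \<inter> L = {}" unfolding R_def L_def using m by auto
  have ne: "R \<noteq> {}" "L \<noteq> {}" using R L by auto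
  show ?thesis
  proof (cases "m = 0")
    case True
    have SU: "S = \<Union>{R, L}" unfolding set_eq_iff S R_def L_def using True by auto
    have "R \<noteq> L" using RL ne by auto
    then have "card {R, L} = 2" by simp
    then have "class_1a_shape S"
    proof (intro class_1a_shape_partition[OF SU])
      fix C assume "C \<in> {R, L}"
      then have "open C" "S \<inter> C = C" using R L SU by auto
      then show "\<exists>U. open U \<and> S \<inter> U = C" by blast
    qed (use R L RL in auto)
    then show ?thesis unfolding S_def .
  next
    case False
    have M: "spectrahedral2 M" "\<not> bounded M" "open M"
    proof -
      have M: "M = {x. 0 < m - fst x \<and> 0\<^sup>2 < (m - fst x) * (m + fst x)}"
        unfolding M_def by (auto simp: zero_less_mult_iff)
      show "spectrahedral2 M" unfolding M
        by (rule spectrahedral2_strict) (auto intro: affine_funI[of _ m "-1" 0] affine_funI[of _ m 1 0] affine_fun_const)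
      show "\<not> bounded M" by (rule not_bounded_if_ray[of 0 0 0 1]) (use False m in \<open>auto simp: M_def\<close>)
      have "M = {x. fst x > - m} \<inter> {x. fst x < m}" unfolding M_def by auto
      then show "open M" using open_half_planes by (simp add: open_Int)
    qed
    have SU: "S = \<Union>{R, L, M}" unfolding set_eq_iff S R_def L_def M_def using m by auto
    have dis: "R \<inter> M = {}" "L \<inter> M = {}" unfolding R_def L_def M_def by auto
    have neM: "M \<noteq> {}" using M by auto
    have "R \<noteq> L" "R \<noteq> M" "L \<noteq> M" using RL dis ne by auto
    then have "card {R, L, M} = 3" by simp
    then have "class_1a_shape S"
    proof (intro class_1a_shape_partition[OF SU])
      fix C assume "C \<in> {R, L, M}"
      then have "open C" "S \<inter> C = C" using R L M SU by auto
      then show "\<exists>U. open U \<and> S \<inter> U = C" by blast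
    qed (use R L M RL dis in auto)
    then show ?thesis unfolding S_def .
  qed
qed

text \<open>As z2 is determined by z1, the only condition is Im (\<gamma> * z1^2) = y2, a polynomial
  equation in Re z1 with leading coefficient h = Im \<gamma>. For h = 0 it is linear and fails
  exactly on the line y1 = 0 without the origin, which gives two rays. Otherwise its discriminant is
  negative exactly inside a parabola, a single component.\<close>

lemma class_1a_shape_parabola:
  assumes \<gamma>: "\<gamma> \<noteq> 0"
  shows "class_1a_shape (- imaginary_set (\<lambda>z1 z2. z2 = \<gamma> * z1\<^sup>2))"
proof -
  define g where "g = Re \<gamma>"
  define h where "h = Im \<gamma>"
  define S where "S = - imaginary_set (\<lambda>z1 z2. z2 = \<gamma> * z1\<^sup>2)"
  have I: "(y1, y2) \<in> imaginary_set (\<lambda>z1 z2. z2 = \<gamma> * z1\<^sup>2) \<longleftrightarrow> (\<exists>x. h * x\<^sup>2 + 2 * (g * y1) * x + (- h * y1\<^sup>2 - y2) = 0)" for y1 y2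
  proof -
    have "(\<exists>x2. Complex x2 y2 = \<gamma> * (Complex x y1)\<^sup>2) \<longleftrightarrow> y2 = Im (\<gamma> * (Complex x y1)\<^sup>2)" for x
      by (auto simp: complex_eq_iff)
    moreover have "Im (\<gamma> * (Complex x y1)\<^sup>2) = h * x\<^sup>2 + 2 * (g * y1) * x - h * y1\<^sup>2" for x
      unfolding g_def h_def by (simp add: power2_eq_square algebra_simps)
    ultimately have "(\<exists>x2. Complex x2 y2 = \<gamma> * (Complex x y1)\<^sup>2) \<longleftrightarrow> h * x\<^sup>2 + 2 * (g * y1) * x + (- h * y1\<^sup>2 - y2) = 0" for x
      by (auto simp del: times_complex.sel)
    then show ?thesis unfolding imaginary_set_iff by simp
  qed
  show ?thesis
  proof (cases "h = 0")
    case True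
    have g: "g \<noteq> 0" using \<gamma> True unfolding g_def h_def by (simp add: complex_eq_iff)
    have "(\<exists>x. 2 * (g * y1) * x - y2 = 0) \<longleftrightarrow> y1 \<noteq> 0 \<or> y2 = 0" for y1 y2
    proof (cases "y1 = 0")
      case False
      then show ?thesis using g by (auto intro!: exI[of _ "y2 / (2 * (g * y1))"])
    qed auto
    then have S: "x \<in> S \<longleftrightarrow> fst x = 0 \<and> snd x \<noteq> 0" for x
      using I[of "fst x" "snd x"] True unfolding S_def by simp
    define R where "R s = {x::real \<times> real. fst x = 0 \<and> 0 < s * snd x}" for s
    have R: "spectrahedral2 (R s)" "\<not> bounded (R s)" "open {x::real \<times> real. 0 < s * snd x}" if s: "s = 1 \<or> s = -1" for s
    proof -
      have "spectrahedral2 {x. 0 \<le> fst x \<and> 0 \<le> - fst x \<and> 0\<^sup>2 \<le> fst x * - fst x \<and> 0 < s * snd x \<and> 0\<^sup>2 < s * snd x * 1}"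
        by (rule spectrahedral2I[OF _ _ _ _ _ _ refl])
           (auto intro: affine_funI[of _ 0 1 0] affine_funI[of _ 0 "-1" 0] affine_funI[of _ 0 0 s] affine_fun_const)
      moreover have "{x. 0 \<le> fst x \<and> 0 \<le> - fst x \<and> 0\<^sup>2 \<le> fst x * - fst x \<and> 0 < s * snd x \<and> 0\<^sup>2 < s * snd x * 1} = R s"
        unfolding R_def by (auto simp: antisym)
      ultimately show "spectrahedral2 (R s)" by simp
      show "\<not> bounded (R s)" by (rule not_bounded_if_ray[of 0 0 0 s]) (use s in \<open>auto simp: R_def\<close>)
      show "open {x::real \<times> real. 0 < s * snd x}" by (auto intro!: open_Collect_less continuous_intros)
    qed
    have SU: "S = \<Union>{R 1, R (-1)}" unfolding set_eq_iff S R_def by auto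
    have dis: "R 1 \<inter> R (-1) = {}" unfolding R_def by auto
    have "R 1 \<noteq> {}" using R(2)[of 1] by auto
    then have ne: "R 1 \<noteq> R (-1)" using dis by auto
    have "class_1a_shape S"
    proof (intro class_1a_shape_partition[OF SU])
      fix C assume "C \<in> {R 1, R (-1)}"
      then obtain s where s: "s = 1 \<or> s = -1" "C = R s" by auto
      have "S \<inter> {x. 0 < s * snd x} = C" unfolding s(2) R_def set_eq_iff Int_iff S using s(1) by auto
      then show "\<exists>U. open U \<and> S \<inter> U = C" using R(3)[OF s(1)] by blast
    qed (use R[of 1] R[of "-1"] dis ne in auto)
    then show ?thesis unfolding S_def .
  next
    case False
    define c where "c = cmod \<gamma>"
    have c: "c\<^sup>2 = g\<^sup>2 + h\<^sup>2" unfolding c_def g_def h_def cmod_power2 ..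
    have "(y1, y2) \<in> S \<longleftrightarrow> (c * y1)\<^sup>2 < 1 * (- h * y2)" for y1 y2
    proof -
      have "(y1, y2) \<in> S \<longleftrightarrow> (g * y1)\<^sup>2 < h * (- h * y1\<^sup>2 - y2)"
        unfolding S_def Compl_iff I quadratic_solvable_iff[OF False] by auto
      moreover have "(c * y1)\<^sup>2 - 1 * (- h * y2) = (g * y1)\<^sup>2 - h * (- h * y1\<^sup>2 - y2)"
        unfolding power_mult_distrib c by (simp add: power2_eq_square algebra_simps)
      ultimately show ?thesis by linarith
    qed
    then have S: "S = {x. 0 < (1::real) \<and> (c * fst x)\<^sup>2 < 1 * (- h * snd x)}" by (auto simp: set_eq_iff)
    have sp: "spectrahedral2 S" unfolding S
      by (rule spectrahedral2_strict) (auto intro: affine_fun_const affine_funI[of _ 0 0 "- h"] affine_funI[of _ 0 c 0])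
    have "\<not> bounded S"
    proof (rule not_bounded_if_ray[of 0 0 0 "- h"])
      fix r :: real assume "r \<ge> 1"
      then have "0 < r * h\<^sup>2" using False by simp
      then show "(0 + r * 0, 0 + r * - h) \<in> S" by (simp add: S power2_eq_square algebra_simps)
    qed (use False in simp)
    then have "class_1a_shape S" by (intro class_1a_shape_partition[of S "{S}"]) (use sp in auto)
    then show ?thesis unfolding S_def .
  qed
qed

section \<open>Normal form with two distinct real roots\<close>

definition class_1b_shape :: "(real \<times> real) set \<Rightarrow> bool" where
  "class_1b_shape S \<longleftrightarrow> card {C \<in> components S. \<not> bounded C} = 4 \<and>
     (\<exists>y. \<forall>C\<in>components S. bounded C \<longrightarrow> C = {y}) \<and> (\<forall>C\<in>components S. spectrahedral2 C)"

lemma class_1b_shape_aff_image: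
  assumes "affine_map \<phi>" "class_1b_shape S"
  shows "class_1b_shape (\<phi> ` S)"
proof -
  obtain y where y: "card {C \<in> components S. \<not> bounded C} = 4" "\<forall>C\<in>components S. bounded C \<longrightarrow> C = {y}"
    "\<forall>C\<in>components S. spectrahedral2 C" using assms(2) unfolding class_1b_shape_def by blast
  have "{C \<in> components (\<phi> ` S). \<not> bounded C} = image \<phi> ` {C \<in> components S. \<not> bounded C}"
    unfolding components_aff_image[OF assms(1)] using bounded_aff_image[OF assms(1)] by auto
  moreover have "card (image \<phi> ` {C \<in> components S. \<not> bounded C}) = card {C \<in> components S. \<not> bounded C}"
    by (intro card_image inj_onI) (simp add: inj_image_eq_iff affine_map_inj assms(1))
  moreover have "C = {\<phi> y}" if "C \<in> components (\<phi> ` S)" "bounded C" for C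
    using that y(2) unfolding components_aff_image[OF assms(1)] by (auto simp: bounded_aff_image[OF assms(1)])
  moreover have "\<forall>C\<in>components (\<phi> ` S). spectrahedral2 C"
    unfolding components_aff_image[OF assms(1)] using y(3) spectrahedral2_aff_image[OF assms(1)] by simp
  ultimately show ?thesis unfolding class_1b_shape_def using y(1) by (intro conjI exI[of _ "\<phi> y"]) simp_all
qed

lemma spectrahedral2_origin: "spectrahedral2 {(0, 0)}"
proof -
  have eq: "{(0, 0)} = {x::real \<times> real. 0 \<le> fst x \<and> 0 \<le> - fst x \<and> (snd x)\<^sup>2 \<le> fst x * - fst x \<and> 0 < (1::real) \<and> 0\<^sup>2 < (1::real) * 1}"
    by (auto dest: antisym)
  show ?thesis
    by (rule spectrahedral2I[OF _ _ _ _ _ _ eq])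
       (auto intro: affine_fun_const affine_funI[of _ 0 1 0] affine_funI[of _ 0 "-1" 0] affine_funI[of _ 0 0 1])
qed

text \<open>\<open>Q s t\<close> is the piece in the quadrant with signs s and t, and
  \<open>E\<close> is the possible isolated point at the origin. The two kinds of quadrant pieces
  that occur, open hyperbolic regions and closed quadrants without vertex, are treated
  uniformly.\<close>

lemma class_1b_shape_quadrants:
  fixes Q :: "real \<Rightarrow> real \<Rightarrow> (real \<times> real) set"
  assumes Q: "\<And>s t. s \<in> {1, -1} \<Longrightarrow> t \<in> {1, -1} \<Longrightarrow>
      spectrahedral2 (Q s t) \<and> \<not> bounded (Q s t) \<and> (\<exists>U. open U \<and> S \<inter> U = Q s t)"
    and dis: "\<And>s t s' t' x. s \<in> {1, -1} \<Longrightarrow> t \<in> {1, -1} \<Longrightarrow> s' \<in> {1, -1} \<Longrightarrow> t' \<in> {1, -1} \<Longrightarrow>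
      x \<in> Q s t \<Longrightarrow> x \<in> Q s' t' \<Longrightarrow> s = s' \<and> t = t'"
    and E: "E \<subseteq> {(0, 0)}" "\<And>s t. s \<in> {1, -1} \<Longrightarrow> t \<in> {1, -1} \<Longrightarrow> Q s t \<inter> E = {}"
      "\<exists>U. open U \<and> S \<inter> U = E"
    and S: "\<And>x. x \<in> S \<longleftrightarrow> x \<in> E \<or> (\<exists>s\<in>{1, -1}. \<exists>t\<in>{1, -1}. x \<in> Q s t)"
  shows "class_1b_shape S"
proof -
  define G where "G = (\<lambda>(s, t). Q s t) ` ({1, -1} \<times> {1, -1})"
  define F where "F = G \<union> ({E} - {{}})"
  have GD: "\<exists>s\<in>{1, -1}. \<exists>t\<in>{1, -1}. C = Q s t" if "C \<in> G" for C using that unfolding G_def by auto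
  have GI: "Q s t \<in> G" if "s \<in> {1, -1}" "t \<in> {1, -1}" for s t
    unfolding G_def using that by (intro image_eqI[of _ _ "(s, t)"]) auto
  have ne: "Q s t \<noteq> {}" if "s \<in> {1, -1}" "t \<in> {1, -1}" for s t using Q[OF that] by auto
  have G: "spectrahedral2 C \<and> \<not> bounded C \<and> (\<exists>U. open U \<and> S \<inter> U = C)" if "C \<in> G" for C
    using GD[OF that] Q by blast
  have spE: "E = {} \<or> E = {(0, 0)}" using E(1) by blast
  have SF: "S = \<Union>F"
  proof (intro Set.set_eqI iffI)
    fix x assume "x \<in> S"
    then show "x \<in> \<Union>F" unfolding S F_def using GI by blast
  next
    fix x assume "x \<in> \<Union>F"
    then consider "x \<in> E" | C where "C \<in> G" "x \<in> C" unfolding F_def by blast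
    then show "x \<in> S" using GD unfolding S by cases blast+
  qed
  have "components S = F"
  proof (rule components_partition[OF SF])
    fix C assume C: "C \<in> F"
    have "spectrahedral2 C \<and> C \<noteq> {}"
    proof (cases "C \<in> G")
      case True
      then show ?thesis using G[OF True] by auto
    next
      case False
      then have "C = {(0, 0)}" using C spE unfolding F_def by auto
      then show ?thesis using spectrahedral2_origin by simp
    qed
    then show "connected C \<and> C \<noteq> {}" using spectrahedral2_convex convex_connected by blast
    show "\<exists>U. open U \<and> S \<inter> U = C" using C G E(3) unfolding F_def by blast
  next
    fix C D assume CD: "C \<in> F" "D \<in> F" "C \<noteq> D"
    show "C \<inter> D = {}"
    proof (cases "C \<in> G \<and> D \<in> G")
      case True
      then obtain s t s' t' where st: "s \<in> {1, -1}" "t \<in> {1, -1}" "s' \<in> {1, -1}" "t' \<in> {1, -1}" "C = Q s t" "D = Q s' t'"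
        using GD by meson
      show ?thesis
      proof (rule ccontr)
        assume "C \<inter> D \<noteq> {}"
        then obtain x where "x \<in> C" "x \<in> D" by auto
        then have "s = s' \<and> t = t'" using dis[OF st(1-4)] st(5,6) by simp
        then show False using CD(3) st by simp
      qed
    next
      case False
      then have "C = E \<and> D \<in> G \<or> C \<in> G \<and> D = E" using CD unfolding F_def by auto
      then show ?thesis
      proof
        assume "C = E \<and> D \<in> G"
        then obtain s t where "s \<in> {1, -1}" "t \<in> {1, -1}" "D = Q s t" "C = E" using GD by meson
        then show ?thesis using E(2)[of s t] by auto
      next
        assume "C \<in> G \<and> D = E"
        then obtain s t where "s \<in> {1, -1}" "t \<in> {1, -1}" "C = Q s t" "D = E" using GD by meson
        then show ?thesis using E(2)[of s t] by auto
      qed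
    qed
  qed
  moreover have "{C \<in> F. \<not> bounded C} = G" unfolding F_def using G spE by auto
  moreover have "card G = 4"
  proof -
    have "inj_on (\<lambda>(s, t). Q s t) ({1, -1} \<times> {1, -1})"
    proof (rule inj_onI, clarify)
      fix s t s' t' :: real assume st: "s \<in> {1, -1}" "t \<in> {1, -1}" "s' \<in> {1, -1}" "t' \<in> {1, -1}" "Q s t = Q s' t'"
      obtain x where "x \<in> Q s t" using ne[OF st(1,2)] by auto
      then show "s = s' \<and> t = t'" using dis[OF st(1-4)] st(5) by simp
    qed
    then have "card G = card ({1, -1::real} \<times> {1, -1::real})" unfolding G_def by (rule card_image)
    also have "\<dots> = 4" by (simp add: card_cartesian_product)
    finally show ?thesis .
  qed
  moreover have "C = {(0, 0)}" if "C \<in> F" "bounded C" for C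
    using that G spE unfolding F_def by auto
  moreover have "spectrahedral2 C" if "C \<in> F" for C using that G spE spectrahedral2_origin unfolding F_def by auto
  ultimately show ?thesis unfolding class_1b_shape_def by (intro conjI exI[of _ "(0, 0)"]) simp_all
qed

text \<open>Off the axes, eliminating x2 leaves a quadratic in x1. With t = y1 * y2 it is solvable
  iff (t - A) * (t + B) \<le> 0, because B - A = Re k and A * B = (Im k)^2 / 4. On the axes the
  elimination degenerates, and the equations are solved directly.\<close>

lemma product_imaginary_set_compl:
  fixes k :: complex
  defines "A \<equiv> (cmod k - Re k) / 2" and "B \<equiv> (cmod k + Re k) / 2"
  shows "(y1, y2) \<notin> imaginary_set (\<lambda>z1 z2. z1 * z2 = k) \<longleftrightarrow> A < y1 * y2 \<or> y1 * y2 < - B \<or>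
    y1 * y2 = 0 \<and> (if y1 = 0 \<and> y2 = 0 then Im k \<noteq> 0 else Im k = 0 \<and> Re k \<noteq> 0)"
proof -
  define g h t where "g = Re k" "h = Im k" "t = y1 * y2"
  note defs = this
  have AB: "A \<ge> 0" "B \<ge> 0" "A * B = h\<^sup>2 / 4" "B - A = g"
  proof -
    show "A \<ge> 0" "B \<ge> 0" unfolding A_def B_def
      using complex_Re_le_cmod[of k] abs_Re_le_cmod[of k] by (auto simp: abs_le_iff)
    have "A * B = ((cmod k)\<^sup>2 - (Re k)\<^sup>2) / 4" unfolding A_def B_def by (simp add: power2_eq_square field_simps)
    then show "A * B = h\<^sup>2 / 4" unfolding cmod_power2 defs by simp
    show "B - A = g" unfolding A_def B_def defs by (simp add: field_simps)
  qed
  have I: "(y1, y2) \<in> imaginary_set (\<lambda>z1 z2. z1 * z2 = k) \<longleftrightarrow> (\<exists>x1 x2. x1 * x2 - t = g \<and> x1 * y2 + x2 * y1 = h)"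
    unfolding imaginary_set_iff defs by (simp add: complex_eq_iff algebra_simps)
  show ?thesis
  proof (cases "t = 0")
    case True
    have X: "(\<exists>x1 x2. x1 * x2 - t = g \<and> x1 * y2 + x2 * y1 = h) \<longleftrightarrow> (if y1 = 0 \<and> y2 = 0 then h = 0 else h \<noteq> 0 \<or> g = 0)"
    proof -
      consider "y1 = 0" "y2 = 0" | "y1 = 0" "y2 \<noteq> 0" | "y1 \<noteq> 0" "y2 = 0" using True unfolding defs by auto
      then show ?thesis
      proof cases
        case 1
        have "\<exists>x1 x2. x1 * x2 = g" by (rule exI[of _ g], rule exI[of _ 1]) simp
        then show ?thesis using 1 True by auto
      next
        case 2
        have "(\<exists>x1 x2. x1 * x2 = g \<and> x1 * y2 = h) \<longleftrightarrow> h \<noteq> 0 \<or> g = 0"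
        proof
          assume r: "h \<noteq> 0 \<or> g = 0"
          show "\<exists>x1 x2. x1 * x2 = g \<and> x1 * y2 = h"
            by (rule exI[of _ "h / y2"], rule exI[of _ "g / (h / y2)"]) (use 2 r in auto)
        qed (use 2 in auto)
        then show ?thesis using 2 True by simp
      next
        case 3
        have "(\<exists>x1 x2. x1 * x2 = g \<and> x2 * y1 = h) \<longleftrightarrow> h \<noteq> 0 \<or> g = 0"
        proof
          assume r: "h \<noteq> 0 \<or> g = 0"
          show "\<exists>x1 x2. x1 * x2 = g \<and> x2 * y1 = h"
            by (rule exI[of _ "g / (h / y1)"], rule exI[of _ "h / y1"]) (use 3 r in auto)
        qed (use 3 in auto)
        then show ?thesis using 3 True by simp
      qed
    qed
    show ?thesis unfolding I X using True AB(1,2) unfolding defs by auto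
  next
    case False
    then have y: "y1 \<noteq> 0" "y2 \<noteq> 0" unfolding defs by auto
    have "(\<exists>x1 x2. x1 * x2 - t = g \<and> x1 * y2 + x2 * y1 = h) \<longleftrightarrow> (\<exists>x. y2 * x\<^sup>2 + 2 * (- h / 2) * x + (g + t) * y1 = 0)"
    proof (intro iffI; elim exE conjE)
      fix x1 x2 assume e: "x1 * x2 - t = g" "x1 * y2 + x2 * y1 = h"
      have "y2 * x1\<^sup>2 + 2 * (- h / 2) * x1 + (g + t) * y1 = 0"
        unfolding e(1)[symmetric] e(2)[symmetric] by (simp add: power2_eq_square field_simps)
      then show "\<exists>x. y2 * x\<^sup>2 + 2 * (- h / 2) * x + (g + t) * y1 = 0" by blast
    next
      fix x assume e: "y2 * x\<^sup>2 + 2 * (- h / 2) * x + (g + t) * y1 = 0"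
      define x2 where "x2 = (h - x * y2) / y1"
      have x2: "x2 * y1 = h - x * y2" unfolding x2_def using y by simp
      have "y1 * (x * x2 - t - g) = x * (x2 * y1) - (g + t) * y1" by (simp add: algebra_simps)
      also have "\<dots> = 0" unfolding x2 using e by (simp add: power2_eq_square algebra_simps)
      finally have "x * x2 - t = g" using y by simp
      moreover have "x * y2 + x2 * y1 = h" using x2 by simp
      ultimately show "\<exists>x1 x2. x1 * x2 - t = g \<and> x1 * y2 + x2 * y1 = h" by blast
    qed
    also have "\<dots> \<longleftrightarrow> y2 * ((g + t) * y1) \<le> (- h / 2)\<^sup>2" by (rule quadratic_solvable_iff) (rule y)
    also have "y2 * ((g + t) * y1) - (- h / 2)\<^sup>2 = (t - A) * (t + B)"
    proof -
      have "(t - A) * (t + B) = t * t + (B - A) * t - A * B" by (simp add: algebra_simps)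
      then show ?thesis unfolding AB defs by (simp add: power2_eq_square algebra_simps)
    qed
    then have "y2 * ((g + t) * y1) \<le> (- h / 2)\<^sup>2 \<longleftrightarrow> (t - A) * (t + B) \<le> 0" by linarith
    also have "\<dots> \<longleftrightarrow> t \<le> A \<and> - B \<le> t" using AB(1,2) by (auto simp: mult_le_0_iff)
    finally show ?thesis unfolding I using False unfolding defs by auto
  qed
qed

text \<open>One side of a branch of a hyperbola, of determinant type with off-diagonal entry sqrt M.
  For M \<ge> 0 the sign of the first coordinate selects the branch, and the product condition then
  fixes the sign of the second.\<close>

definition hyperbolic_region :: "real \<Rightarrow> real \<Rightarrow> real \<Rightarrow> (real \<times> real) set" where
  "hyperbolic_region M s t = {x. 0 < s * fst x \<and> M < (s * fst x) * (t * snd x)}"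

lemma hyperbolic_region:
  assumes "M \<ge> 0" "s \<in> {1, -1}" "t \<in> {1, -1}"
  shows "spectrahedral2 (hyperbolic_region M s t)" "\<not> bounded (hyperbolic_region M s t)" "open (hyperbolic_region M s t)"
    "x \<in> hyperbolic_region M s t \<Longrightarrow> 0 < s * fst x \<and> 0 < t * snd x \<and> M < (s * fst x) * (t * snd x)"
proof -
  have eq: "hyperbolic_region M s t = {x. 0 < s * fst x \<and> (sqrt M)\<^sup>2 < (s * fst x) * (t * snd x)}"
    unfolding hyperbolic_region_def using assms by simp
  show "spectrahedral2 (hyperbolic_region M s t)" unfolding eq
    by (rule spectrahedral2_strict) (auto intro: affine_fun_const affine_funI[of _ 0 s 0] affine_funI[of _ 0 0 t])
  show "\<not> bounded (hyperbolic_region M s t)"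
  proof (rule not_bounded_if_ray[of 0 s 0 "t * (M + 1)"])
    fix r :: real assume r: "r \<ge> 1"
    have "M + 1 \<le> r * (r * (M + 1))" using r assms(1) by (smt (verit) mult_le_cancel_right1 mult_nonneg_nonneg)
    then have "M < r * (r * (M + 1))" by simp
    then show "(0 + r * s, 0 + r * (t * (M + 1))) \<in> hyperbolic_region M s t"
      unfolding hyperbolic_region_def using r assms(2,3) by (auto simp: algebra_simps)
  qed (use assms in auto)
  have "hyperbolic_region M s t = {x. 0 < s * fst x} \<inter> {x. M < (s * fst x) * (t * snd x)}"
    unfolding hyperbolic_region_def by auto
  then show "open (hyperbolic_region M s t)"
    by (auto intro!: open_Int open_Collect_less continuous_intros)
  show "0 < s * fst x \<and> 0 < t * snd x \<and> M < (s * fst x) * (t * snd x)" if "x \<in> hyperbolic_region M s t"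
  proof -
    have x: "0 < s * fst x" "M < (s * fst x) * (t * snd x)" using that unfolding hyperbolic_region_def by auto
    then have "0 < (s * fst x) * (t * snd x)" using assms(1) by linarith
    then show ?thesis using x by (simp add: zero_less_mult_iff)
  qed
qed

text \<open>If Im k is nonzero, both \<open>A\<close> and \<open>B\<close> are positive and the
  origin is isolated. For k = 0 the pieces are the four open quadrants. For real k > 0,
  \<open>A\<close> is 0 and the axes without the origin join the complement, so the quadrants with
  equal signs become closed ones without vertex.\<close>

lemma class_1b_shape_product_nonneg:
  assumes "Im k \<noteq> 0 \<or> Re k \<ge> 0"
  shows "class_1b_shape (- imaginary_set (\<lambda>z1 z2. z1 * z2 = k))"
proof -
  define A B where "A = (cmod k - Re k) / 2" "B = (cmod k + Re k) / 2"
  note AB_def = this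
  have AB: "A \<ge> 0" "B \<ge> 0" unfolding AB_def
    using complex_Re_le_cmod[of k] abs_Re_le_cmod[of k] by (auto simp: abs_le_iff)
  define S where "S = - imaginary_set (\<lambda>z1 z2. z1 * z2 = k)"
  have S: "x \<in> S \<longleftrightarrow> A < fst x * snd x \<or> fst x * snd x < - B \<or>
    fst x * snd x = 0 \<and> (if x = (0, 0) then Im k \<noteq> 0 else Im k = 0 \<and> Re k \<noteq> 0)" for x
    unfolding S_def Compl_iff AB_def using product_imaginary_set_compl[of "fst x" "snd x" k]
    by (simp add: prod_eq_iff)
  \<comment> \<open>Where the signs agree, the product y1 * y2 is positive and the bound is
    \<open>A\<close>; where they differ, it is negative and the bound is \<open>B\<close>.\<close>
  define M where "M s t = (if s * t = 1 then A else B)" for s t :: real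
  have M: "M s t \<ge> 0" for s t unfolding M_def using AB by simp
  have in_hyp: "(\<exists>s\<in>{1, -1}. \<exists>t\<in>{1, -1}. x \<in> hyperbolic_region (M s t) s t) \<longleftrightarrow> A < fst x * snd x \<or> fst x * snd x < - B" for x
    unfolding hyperbolic_region_def M_def using AB
    by (auto simp: zero_less_mult_iff mult_less_0_iff not_less)
       (smt (verit) mult_nonneg_nonneg mult_nonpos_nonpos mult_nonneg_nonpos mult_nonpos_nonneg)+
  have openprod: "open {x::real \<times> real. c < fst x * snd x}" "open {x::real \<times> real. fst x * snd x < c}"
    "open {x::real \<times> real. 0 < s * (fst x + snd x)}" for c s
    by (auto intro!: open_Collect_less continuous_intros)
  show ?thesis
  proof (cases "Im k \<noteq> 0 \<or> k = 0")
    case True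
    define E where "E = (if Im k \<noteq> 0 then {(0, 0)} else {} :: (real \<times> real) set)"
    have S': "x \<in> S \<longleftrightarrow> x \<in> E \<or> (\<exists>s\<in>{1, -1}. \<exists>t\<in>{1, -1}. x \<in> hyperbolic_region (M s t) s t)" for x
      unfolding in_hyp S E_def using True by auto
    have pos: "A > 0 \<and> B > 0" if "Im k \<noteq> 0"
    proof -
      have "\<bar>Re k\<bar> < cmod k" using that by (simp add: cmod_def real_less_rsqrt)
      then show ?thesis unfolding AB_def by (simp add: abs_less_iff)
    qed
    have "class_1b_shape S"
    proof (rule class_1b_shape_quadrants[of "\<lambda>s t. hyperbolic_region (M s t) s t" S E])
      fix s t :: real assume st: "s \<in> {1, -1}" "t \<in> {1, -1}"
      have "S \<inter> hyperbolic_region (M s t) s t = hyperbolic_region (M s t) s t" using S' st by auto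
      then show "spectrahedral2 (hyperbolic_region (M s t) s t) \<and> \<not> bounded (hyperbolic_region (M s t) s t) \<and>
          (\<exists>U. open U \<and> S \<inter> U = hyperbolic_region (M s t) s t)"
        using hyperbolic_region(1-3)[OF M[of s t] st] by (intro conjI exI[of _ "hyperbolic_region (M s t) s t"])
      show "hyperbolic_region (M s t) s t \<inter> E = {}" unfolding E_def hyperbolic_region_def by auto
    next
      fix s t s' t' x assume st: "s \<in> {1, -1}" "t \<in> {1, -1}" "s' \<in> {1, -1}" "t' \<in> {1, -1::real}"
        and x: "x \<in> hyperbolic_region (M s t) s t" "x \<in> hyperbolic_region (M s' t') s' t'"
      show "s = s' \<and> t = t'"
        using hyperbolic_region(4)[OF M[of s t] st(1,2) x(1)] hyperbolic_region(4)[OF M[of s' t'] st(3,4) x(2)] st by auto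
    next
      show "E \<subseteq> {(0, 0)}" unfolding E_def by auto
      show "\<exists>U. open U \<and> S \<inter> U = E"
      proof (cases "Im k = 0")
        case True
        then show ?thesis unfolding E_def by (intro exI[of _ "{}"]) simp
      next
        case False
        have "S \<inter> ({x. - B < fst x * snd x} \<inter> {x. fst x * snd x < A}) = E"
          unfolding E_def set_eq_iff Int_iff mem_Collect_eq S using False pos by auto
        then show ?thesis using openprod by (metis open_Int)
      qed
    qed (rule S')
    then show ?thesis unfolding S_def .
  next
    case False
    then have im: "Im k = 0" and re: "Re k > 0" using assms by (auto simp: complex_eq_iff)
    have "cmod k = Re k" using im re by (simp add: cmod_eq_Re)
    then have A0: "A = 0" and B: "B > 0" unfolding AB_def using re by auto
    \<comment> \<open>In a closed quadrant the coordinate sum vanishes only at the vertex, so one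
      strict linear condition removes the vertex.\<close>
    define Q where "Q s t = (if s = t then {x. 0 \<le> s * fst x \<and> 0 \<le> s * snd x \<and> 0 < s * (fst x + snd x)} else hyperbolic_region B s t)"
      for s t :: real
    have S'': "x \<in> S \<longleftrightarrow> 0 \<le> fst x * snd x \<and> x \<noteq> (0, 0) \<or> fst x * snd x < - B" for x
      unfolding S A0 using im re B by auto
    have sQ: "x \<in> Q 1 1 \<or> x \<in> Q (-1) (-1) \<longleftrightarrow> 0 \<le> fst x * snd x \<and> x \<noteq> (0, 0)" for x
      unfolding Q_def by (cases x) (auto simp: zero_le_mult_iff)
    have sH: "x \<in> Q 1 (-1) \<or> x \<in> Q (-1) 1 \<longleftrightarrow> fst x * snd x < - B" for x
      unfolding Q_def hyperbolic_region_def using B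
      by (auto simp: mult_less_0_iff) (smt (verit) mult_nonneg_nonneg mult_nonpos_nonpos)+
    have S': "x \<in> S \<longleftrightarrow> x \<in> {} \<or> (\<exists>s\<in>{1, -1}. \<exists>t\<in>{1, -1}. x \<in> Q s t)" for x
      unfolding S'' sQ[symmetric] sH[symmetric] by auto
    have "class_1b_shape S"
    proof (rule class_1b_shape_quadrants[of Q S "{}"])
      fix s t :: real assume st: "s \<in> {1, -1}" "t \<in> {1, -1}"
      show "spectrahedral2 (Q s t) \<and> \<not> bounded (Q s t) \<and> (\<exists>U. open U \<and> S \<inter> U = Q s t)"
      proof (cases "s = t")
        case True
        have eq: "Q s t = {x. 0 \<le> s * fst x \<and> 0 \<le> s * snd x \<and> 0\<^sup>2 \<le> (s * fst x) * (s * snd x) \<and>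
            0 < s * (fst x + snd x) \<and> 0\<^sup>2 < s * (fst x + snd x) * 1}"
          unfolding Q_def using True by auto
        have "spectrahedral2 (Q s t)"
          by (rule spectrahedral2I[OF _ _ _ _ _ _ eq])
            (auto intro: affine_fun_const affine_funI[of _ 0 s 0] affine_funI[of _ 0 0 s] affine_funI[of _ 0 s s] simp: algebra_simps)
        moreover have "\<not> bounded (Q s t)"
          by (rule not_bounded_if_ray[of 0 s 0 s]) (use True st in \<open>auto simp: Q_def\<close>)
        \<comment> \<open>The bound on the product excludes the two hyperbolic regions, and the sign
          of the coordinate sum separates the two remaining quadrants.\<close>
        moreover have "S \<inter> ({x. - B < fst x * snd x} \<inter> {x. 0 < s * (fst x + snd x)}) = Q s t"
          unfolding set_eq_iff Int_iff mem_Collect_eq S'' Q_def using True B st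
          by (auto simp: zero_le_mult_iff intro: less_le_trans[of "- B" 0] mult_nonneg_nonneg mult_nonpos_nonpos)
        then have "\<exists>U. open U \<and> S \<inter> U = Q s t" using openprod by (metis open_Int)
        ultimately show ?thesis by blast
      next
        case False
        have "S \<inter> Q s t = Q s t" using S' st by auto
        moreover have "open (Q s t)" "spectrahedral2 (Q s t)" "\<not> bounded (Q s t)"
          using False hyperbolic_region(1-3)[OF AB(2) st] unfolding Q_def by simp_all
        ultimately show ?thesis by (intro conjI exI[of _ "Q s t"])
      qed
    next
      fix s t s' t' x assume st: "s \<in> {1, -1}" "t \<in> {1, -1}" "s' \<in> {1, -1}" "t' \<in> {1, -1::real}"
        and x: "x \<in> Q s t" "x \<in> Q s' t'"
      have *: "0 \<le> s * fst x \<and> 0 \<le> t * snd x \<and> (if s = t then 0 \<le> fst x * snd x \<and> 0 < s * (fst x + snd x) else fst x * snd x < - B)"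
        if st: "s \<in> {1, -1}" "t \<in> {1, -1}" and x: "x \<in> Q s t" for s t
      proof (cases "s = t")
        case True
        then show ?thesis using x st unfolding Q_def by (auto simp: mult_nonpos_nonpos)
      next
        case False
        then have "x \<in> hyperbolic_region B s t" using x unfolding Q_def by simp
        then show ?thesis using hyperbolic_region(4)[OF AB(2) st, of x] False st by auto
      qed
      show "s = s' \<and> t = t'" using *[OF st(1,2) x(1)] *[OF st(3,4) x(2)] st B by (auto split: if_splits)
    qed (use S' in \<open>auto intro: exI[of _ "{}"]\<close>)
    then show ?thesis unfolding S_def .
  qed
qed

text \<open>The reflection z1 to - z1 turns k into - k and so reduces negative real k to the
  positive case.\<close>

lemma class_1b_shape_product: "class_1b_shape (- imaginary_set (\<lambda>z1 z2. z1 * z2 = k))"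
proof (cases "Im k \<noteq> 0 \<or> Re k \<ge> 0")
  case False
  have "\<exists>\<phi>. affine_map \<phi> \<and> - imaginary_set (\<lambda>z1 z2. z1 * z2 = k) = \<phi> ` (- imaginary_set (\<lambda>z1 z2. z1 * z2 = - k))"
    by (rule compl_imaginary_set_aff[of "-1" 1 0 0 _ 0 0]) (auto simp: minus_equation_iff)
  moreover have "class_1b_shape (- imaginary_set (\<lambda>z1 z2. z1 * z2 = - k))" by (rule class_1b_shape_product_nonneg) (use False in auto)
  ultimately show ?thesis using class_1b_shape_aff_image by metis
qed (rule class_1b_shape_product_nonneg)

section \<open>One real and one non-real root\<close>

definition class_2b_shape :: "(real \<times> real) set \<Rightarrow> bool" where
  "class_2b_shape S \<longleftrightarrow> (S = {} \<or> (\<exists>y. S = {y}) \<or>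
     (\<exists>y w. y \<noteq> w \<and> open_segment y w \<subseteq> S \<and> S \<subseteq> closed_segment y w)) \<and> (\<forall>C\<in>components S. spectrahedral2 C)"

lemma affine_map_closed_segment:
  assumes "affine_map \<phi>"
  shows "\<phi> ` closed_segment y w = closed_segment (\<phi> y) (\<phi> w)"
proof -
  obtain a b c d r t where \<phi>: "\<phi> = (\<lambda>x. (a * fst x + b * snd x + r, c * fst x + d * snd x + t))"
    using assms unfolding affine_map_def by blast
  have "\<phi> ((1 - u) *\<^sub>R y + u *\<^sub>R w) = (1 - u) *\<^sub>R \<phi> y + u *\<^sub>R \<phi> w" for u
    unfolding \<phi> by (simp add: algebra_simps)
  then show ?thesis unfolding closed_segment_image_interval image_image by simp
qed

lemma affine_map_open_segment:
  assumes "affine_map \<phi>"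
  shows "\<phi> ` open_segment y w = open_segment (\<phi> y) (\<phi> w)"
  unfolding open_segment_def using affine_map_closed_segment[OF assms] affine_map_inj[OF assms]
  by (simp add: image_set_diff)

lemma class_2b_shape_aff_image:
  assumes "affine_map \<phi>" "class_2b_shape S"
  shows "class_2b_shape (\<phi> ` S)"
proof -
  have "\<forall>C\<in>components (\<phi> ` S). spectrahedral2 C"
    using assms(2) spectrahedral2_aff_image[OF assms(1)] unfolding class_2b_shape_def components_aff_image[OF assms(1)] by simp
  moreover have "\<phi> ` S = {} \<or> (\<exists>y. \<phi> ` S = {y}) \<or>
     (\<exists>y w. y \<noteq> w \<and> open_segment y w \<subseteq> \<phi> ` S \<and> \<phi> ` S \<subseteq> closed_segment y w)"
  proof -
    consider "S = {}" | y where "S = {y}" | y w where "y \<noteq> w" "open_segment y w \<subseteq> S" "S \<subseteq> closed_segment y w"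
      using assms(2) unfolding class_2b_shape_def by blast
    then show ?thesis
    proof cases
      case (3 y w)
      have "\<phi> y \<noteq> \<phi> w" using 3(1) affine_map_inj[OF assms(1)] by (simp add: inj_eq)
      moreover have "open_segment (\<phi> y) (\<phi> w) \<subseteq> \<phi> ` S" "\<phi> ` S \<subseteq> closed_segment (\<phi> y) (\<phi> w)"
        using 3(2,3) affine_map_open_segment[OF assms(1)] affine_map_closed_segment[OF assms(1)] by (metis image_mono)+
      ultimately show ?thesis by blast
    qed auto
  qed
  ultimately show ?thesis unfolding class_2b_shape_def by simp
qed

lemma spectrahedral2_components:
  assumes "spectrahedral2 S"
  shows "\<forall>C\<in>components S. spectrahedral2 C"
proof (cases "S = {}")
  case False
  then have "components S = {S}" using assms spectrahedral2_convex convex_connected components_eq_sing_iff by blast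
  then show ?thesis using assms by simp
qed simp

text \<open>In the unknowns x = Re z2 and p = Re (z1 - i * z2), eliminating p for y2 \<noteq> 0
  leaves a real cubic, which has a root. The complement therefore lies on the line y2 = 0, where the
  system reduces to x * p = Re k and x * (y1 - x) = Im k.\<close>

lemma class_2b_shape_mixed_product: "class_2b_shape (- imaginary_set (\<lambda>z1 z2. z2 * (z1 - \<i> * z2) = k))"
proof -
  define g h where "g = Re k" "h = Im k"
  note gh = this
  define S where "S = - imaginary_set (\<lambda>z1 z2. z2 * (z1 - \<i> * z2) = k)"
  have I: "(y1, y2) \<in> imaginary_set (\<lambda>z1 z2. z2 * (z1 - \<i> * z2) = k) \<longleftrightarrow>
      (\<exists>x p. x * p - y2 * (y1 - x) = g \<and> x * (y1 - x) + y2 * p = h)" for y1 y2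
  proof -
    have "Complex x2 y2 * (Complex x1 y1 - \<i> * Complex x2 y2) = k \<longleftrightarrow>
      x2 * (x1 + y2) - y2 * (y1 - x2) = g \<and> x2 * (y1 - x2) + y2 * (x1 + y2) = h" for x1 x2
      unfolding gh by (simp add: complex_eq_iff)
    then show ?thesis unfolding imaginary_set_iff
      by simp (metis add.commute add_diff_cancel_left' diff_add_cancel)
  qed
  have off: "(y1, y2) \<in> imaginary_set (\<lambda>z1 z2. z2 * (z1 - \<i> * z2) = k)" if y2: "y2 \<noteq> 0" for y1 y2
  proof -
    \<comment> \<open>The cubic is y2 times the real-part equation, with y2 * p replaced from the
      imaginary-part equation.\<close>
    obtain x where x: "x^3 + (- y1) * x\<^sup>2 + (h + y2\<^sup>2) * x + (- (y2\<^sup>2 * y1) - g * y2) = 0"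
      using monic_cubic_has_root by blast
    define p where "p = (h - x * (y1 - x)) / y2"
    have p: "y2 * p = h - x * (y1 - x)" unfolding p_def using y2 by simp
    have "y2 * (x * p - y2 * (y1 - x) - g) = x * (y2 * p) - y2\<^sup>2 * (y1 - x) - g * y2"
      by (simp add: power2_eq_square algebra_simps)
    also have "\<dots> = 0" using x unfolding p by (simp add: power2_eq_square power3_eq_cube algebra_simps)
    finally have "x * p - y2 * (y1 - x) = g" using y2 by simp
    moreover have "x * (y1 - x) + y2 * p = h" using p by simp
    ultimately show ?thesis unfolding I by blast
  qed
  have on: "(y1, 0) \<in> imaginary_set (\<lambda>z1 z2. z2 * (z1 - \<i> * z2) = k) \<longleftrightarrow> k = 0 \<or> (if h = 0 then y1 \<noteq> 0 else 4 * h \<le> y1\<^sup>2)" for y1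
  proof -
    have "(y1, 0) \<in> imaginary_set (\<lambda>z1 z2. z2 * (z1 - \<i> * z2) = k) \<longleftrightarrow> (\<exists>x p. x * p = g \<and> x * (y1 - x) = h)"
      unfolding I by simp
    also have "\<dots> \<longleftrightarrow> (\<exists>x. x * (y1 - x) = h \<and> (x = 0 \<longrightarrow> g = 0))"
    proof
      assume "\<exists>x. x * (y1 - x) = h \<and> (x = 0 \<longrightarrow> g = 0)"
      then obtain x where x: "x * (y1 - x) = h" "x = 0 \<longrightarrow> g = 0" by blast
      then have "x * (g / x) = g" by auto
      then show "\<exists>x p. x * p = g \<and> x * (y1 - x) = h" using x by blast
    qed auto
    also have "\<dots> \<longleftrightarrow> k = 0 \<or> (if h = 0 then y1 \<noteq> 0 else 4 * h \<le> y1\<^sup>2)"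
    proof (cases "h = 0")
      case True
      have "k = 0 \<longleftrightarrow> g = 0" using True unfolding gh by (simp add: complex_eq_iff)
      then show ?thesis using True by auto
    next
      case False
      have "(\<exists>x. x * (y1 - x) = h \<and> (x = 0 \<longrightarrow> g = 0)) \<longleftrightarrow> (\<exists>x. 1 * x\<^sup>2 + 2 * (- y1 / 2) * x + h = 0)"
        using False by (intro ex_cong1) (auto simp: power2_eq_square algebra_simps)
      also have "\<dots> \<longleftrightarrow> 1 * h \<le> (- y1 / 2)\<^sup>2" by (rule quadratic_solvable_iff) simp
      also have "\<dots> \<longleftrightarrow> 4 * h \<le> y1\<^sup>2" by (simp add: power_divide field_simps)
      moreover have "k \<noteq> 0" using False unfolding gh by auto
      ultimately show ?thesis using False by simp
    qed
    finally show ?thesis .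
  qed
  have S: "x \<in> S \<longleftrightarrow> snd x = 0 \<and> k \<noteq> 0 \<and> (if h = 0 then fst x = 0 else (fst x)\<^sup>2 < 4 * h)" for x
    unfolding S_def Compl_iff using off[of "snd x" "fst x"] on[of "fst x"]
    by (cases x) (auto simp: not_le)
  consider "k = 0 \<or> h < 0" | "k \<noteq> 0" "h = 0" | "h > 0" by linarith
  then have "class_2b_shape S"
  proof cases
    case 1
    have "\<not> (fst x)\<^sup>2 < 4 * h" if "h < 0" for x :: "real \<times> real" using zero_le_power2[of "fst x"] that by linarith
    then have "x \<notin> S" for x unfolding S using 1 by (auto split: if_splits)
    then have "S = {}" by blast
    then show ?thesis unfolding class_2b_shape_def by simp
  next
    case 2
    then have "S = {(0, 0)}" unfolding set_eq_iff S by auto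
    then show ?thesis unfolding class_2b_shape_def using spectrahedral2_components[OF spectrahedral2_origin] by auto
  next
    case 3
    define M where "M = 2 * sqrt h"
    have M: "M > 0" "M\<^sup>2 = 4 * h" unfolding M_def using 3 by (simp_all add: power_mult_distrib)
    have k: "k \<noteq> 0" using 3 unfolding gh by auto
    have lt: "v\<^sup>2 < 4 * h \<longleftrightarrow> - M < v \<and> v < M" for v
    proof -
      have "v\<^sup>2 < M\<^sup>2 \<longleftrightarrow> \<bar>v\<bar> < \<bar>M\<bar>" using abs_le_square_iff[of M v] by linarith
      then show ?thesis unfolding M(2) using M(1) by (auto simp: abs_less_iff)
    qed
    have S': "S = {x. snd x = 0 \<and> - M < fst x \<and> fst x < M}" unfolding set_eq_iff S using k 3 lt by auto
    have eq: "S = {x. 0 \<le> snd x \<and> 0 \<le> - snd x \<and> 0\<^sup>2 \<le> snd x * - snd x \<and> 0 < M - fst x \<and> 0\<^sup>2 < (M - fst x) * (M + fst x)}"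
      unfolding S' by (auto simp: zero_less_mult_iff)
    have "spectrahedral2 S"
      by (rule spectrahedral2I[OF _ _ _ _ _ _ eq])
        (auto intro: affine_fun_const affine_funI[of _ 0 0 1] affine_funI[of _ 0 0 "-1"] affine_funI[of _ M 1 0] affine_funI[of _ M "-1" 0])
    moreover have "S = open_segment (- M, 0) (M, 0)"
    proof (intro Set.set_eqI iffI)
      fix x assume "x \<in> S"
      then have x: "snd x = 0" "- M < fst x" "fst x < M" unfolding S' by auto
      define u where "u = (fst x + M) / (2 * M)"
      have "0 < u" "u < 1" unfolding u_def using x M by auto
      moreover have "fst x = (1 - u) * - M + u * M" unfolding u_def using M(1) by (simp add: field_simps)
      then have "x = (1 - u) *\<^sub>R (- M, 0) + u *\<^sub>R (M, 0)" using x by (simp add: prod_eq_iff)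
      ultimately show "x \<in> open_segment (- M, 0) (M, 0)" unfolding in_segment using M(1) by auto
    next
      fix x :: "real \<times> real" assume "x \<in> open_segment (- M, 0) (M, 0)"
      then obtain u where u: "0 < u" "u < 1" "x = (1 - u) *\<^sub>R (- M, 0) + u *\<^sub>R (M, 0)"
        unfolding in_segment by blast
      have "fst x = M * (2 * u - 1)" unfolding u(3) by (simp add: algebra_simps)
      moreover have "M * (2 * u - 1) < M * 1" "M * (2 * u - 1) > M * (- 1)"
        using M(1) u by (intro mult_strict_left_mono; simp)+
      ultimately show "x \<in> S" unfolding S' u(3) by simp
    qed
    then have "open_segment (- M, 0) (M, 0) \<subseteq> S" "S \<subseteq> closed_segment (- M, 0) (M, 0)" "(- M, 0::real) \<noteq> (M, 0)"
      using segment_open_subset_closed M(1) by auto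
    ultimately show ?thesis unfolding class_2b_shape_def using spectrahedral2_components by blast
  qed
  then show ?thesis unfolding S_def .
qed

lemma class_1a_shape_transfer: "\<exists>\<phi>. affine_map \<phi> \<and> S = \<phi> ` T \<Longrightarrow> class_1a_shape T \<Longrightarrow> class_1a_shape S"
  using class_1a_shape_aff_image by blast

lemma class_1b_shape_transfer: "\<exists>\<phi>. affine_map \<phi> \<and> S = \<phi> ` T \<Longrightarrow> class_1b_shape T \<Longrightarrow> class_1b_shape S"
  using class_1b_shape_aff_image by blast

lemma class_2b_shape_transfer: "\<exists>\<phi>. affine_map \<phi> \<and> S = \<phi> ` T \<Longrightarrow> class_2b_shape T \<Longrightarrow> class_2b_shape S"
  using class_2b_shape_aff_image by blast

section \<open>Removal of lower-order terms by complex translations\<close>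

text \<open>Completing the square in z1 leaves a constant. If z2 occurs linearly, a translation of
  z2 absorbs that constant and the result is a parabola; if not, z1^2 equals a constant.\<close>

lemma class_1a_shape_conic:
  assumes \<alpha>: "\<alpha> \<noteq> 0"
  shows "class_1a_shape (- imaginary_set (\<lambda>z1 z2. \<alpha> * z1\<^sup>2 + d * z1 + e * z2 + f = 0))"
proof (cases "e = 0")
  case True
  have "\<exists>\<phi>. affine_map \<phi> \<and> - imaginary_set (\<lambda>z1 z2. \<alpha> * z1\<^sup>2 + d * z1 + e * z2 + f = 0)
      = \<phi> ` (- imaginary_set (\<lambda>z1 z2. z1\<^sup>2 = (d\<^sup>2 / (4 * \<alpha>) - f) / \<alpha>))"
  proof (rule compl_imaginary_set_aff[of 1 1 0 0 _ "- d / (2 * \<alpha>)" 0])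
    fix Z1 Z2 :: complex
    have "\<alpha> * (of_real 1 * Z1 + of_real 0 * Z2 + - d / (2 * \<alpha>))\<^sup>2 + d * (of_real 1 * Z1 + of_real 0 * Z2 + - d / (2 * \<alpha>))
        + e * (of_real 0 * Z1 + of_real 1 * Z2 + 0) + f = \<alpha> * (Z1\<^sup>2 - (d\<^sup>2 / (4 * \<alpha>) - f) / \<alpha>)"
      using \<alpha> True by (simp add: power2_eq_square field_simps)
    then show "(\<alpha> * (of_real 1 * Z1 + of_real 0 * Z2 + - d / (2 * \<alpha>))\<^sup>2 + d * (of_real 1 * Z1 + of_real 0 * Z2 + - d / (2 * \<alpha>))
        + e * (of_real 0 * Z1 + of_real 1 * Z2 + 0) + f = 0) \<longleftrightarrow> (Z1\<^sup>2 = (d\<^sup>2 / (4 * \<alpha>) - f) / \<alpha>)"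
      using \<alpha> by simp
  qed simp
  then show ?thesis using class_1a_shape_square by (rule class_1a_shape_transfer)
next
  case False
  have "\<exists>\<phi>. affine_map \<phi> \<and> - imaginary_set (\<lambda>z1 z2. \<alpha> * z1\<^sup>2 + d * z1 + e * z2 + f = 0)
      = \<phi> ` (- imaginary_set (\<lambda>z1 z2. z2 = (- \<alpha> / e) * z1\<^sup>2))"
  proof (rule compl_imaginary_set_aff[of 1 1 0 0 _ "- d / (2 * \<alpha>)" "(d\<^sup>2 / (4 * \<alpha>) - f) / e"])
    fix Z1 Z2 :: complex
    have eq: "\<alpha> * (of_real 1 * Z1 + of_real 0 * Z2 + - d / (2 * \<alpha>))\<^sup>2 + d * (of_real 1 * Z1 + of_real 0 * Z2 + - d / (2 * \<alpha>))
        + e * (of_real 0 * Z1 + of_real 1 * Z2 + (d\<^sup>2 / (4 * \<alpha>) - f) / e) + f = e * (Z2 - (- \<alpha> / e) * Z1\<^sup>2)"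
      using \<alpha> False by (simp add: power2_eq_square field_simps)
    show "(\<alpha> * (of_real 1 * Z1 + of_real 0 * Z2 + - d / (2 * \<alpha>))\<^sup>2 + d * (of_real 1 * Z1 + of_real 0 * Z2 + - d / (2 * \<alpha>))
        + e * (of_real 0 * Z1 + of_real 1 * Z2 + (d\<^sup>2 / (4 * \<alpha>) - f) / e) + f = 0) \<longleftrightarrow> (Z2 = (- \<alpha> / e) * Z1\<^sup>2)"
      unfolding eq mult_eq_0_iff right_minus_eq using False by simp
  qed simp
  moreover have "class_1a_shape (- imaginary_set (\<lambda>z1 z2. z2 = (- \<alpha> / e) * z1\<^sup>2))"
    by (rule class_1a_shape_parabola) (use \<alpha> False in simp)
  ultimately show ?thesis by (rule class_1a_shape_transfer)
qed

lemma class_1b_shape_conic: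
  assumes \<alpha>: "\<alpha> \<noteq> 0"
  shows "class_1b_shape (- imaginary_set (\<lambda>z1 z2. \<alpha> * z1 * z2 + d * z1 + e * z2 + f = 0))"
proof -
  have "\<exists>\<phi>. affine_map \<phi> \<and> - imaginary_set (\<lambda>z1 z2. \<alpha> * z1 * z2 + d * z1 + e * z2 + f = 0)
      = \<phi> ` (- imaginary_set (\<lambda>z1 z2. z1 * z2 = (d * e / \<alpha> - f) / \<alpha>))"
  proof (rule compl_imaginary_set_aff[of 1 1 0 0 _ "- e / \<alpha>" "- d / \<alpha>"])
    fix Z1 Z2 :: complex
    have "\<alpha> * (of_real 1 * Z1 + of_real 0 * Z2 + - e / \<alpha>) * (of_real 0 * Z1 + of_real 1 * Z2 + - d / \<alpha>)
        + d * (of_real 1 * Z1 + of_real 0 * Z2 + - e / \<alpha>)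
        + e * (of_real 0 * Z1 + of_real 1 * Z2 + - d / \<alpha>) + f = \<alpha> * (Z1 * Z2 - (d * e / \<alpha> - f) / \<alpha>)"
      using \<alpha> by (simp add: field_simps)
    then show "(\<alpha> * (of_real 1 * Z1 + of_real 0 * Z2 + - e / \<alpha>) * (of_real 0 * Z1 + of_real 1 * Z2 + - d / \<alpha>)
        + d * (of_real 1 * Z1 + of_real 0 * Z2 + - e / \<alpha>)
        + e * (of_real 0 * Z1 + of_real 1 * Z2 + - d / \<alpha>) + f = 0) \<longleftrightarrow> (Z1 * Z2 = (d * e / \<alpha> - f) / \<alpha>)"
      using \<alpha> by simp
  qed simp
  then show ?thesis using class_1b_shape_product by (rule class_1b_shape_transfer)
qed

lemma class_2b_shape_conic:
  assumes \<alpha>: "\<alpha> \<noteq> 0"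
  shows "class_2b_shape (- imaginary_set (\<lambda>z1 z2. \<alpha> * z2 * (z1 - \<i> * z2) + d * z1 + e * z2 + f = 0))"
proof -
  \<comment> \<open>(w1, w2) is the center of the conic, the common zero of both partial
    derivatives; translating there removes the linear terms.\<close>
  define w2 where "w2 = - d / \<alpha>"
  define w1 where "w1 = - e / \<alpha> + 2 * \<i> * w2"
  define k where "k = - (\<alpha> * w2 * (w1 - \<i> * w2) + d * w1 + e * w2 + f) / \<alpha>"
  have d: "d = - \<alpha> * w2" and e: "e = \<alpha> * (2 * \<i> * w2 - w1)"
    unfolding w1_def w2_def using \<alpha> by (simp_all add: field_simps)
  have f: "f = - (\<alpha> * k + \<alpha> * w2 * (w1 - \<i> * w2) + d * w1 + e * w2)"
    unfolding k_def using \<alpha> by (simp add: field_simps)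
  have "\<exists>\<phi>. affine_map \<phi> \<and> - imaginary_set (\<lambda>z1 z2. \<alpha> * z2 * (z1 - \<i> * z2) + d * z1 + e * z2 + f = 0)
      = \<phi> ` (- imaginary_set (\<lambda>z1 z2. z2 * (z1 - \<i> * z2) = k))"
  proof (rule compl_imaginary_set_aff[of 1 1 0 0 _ w1 w2])
    fix Z1 Z2 :: complex
    have "\<alpha> * (of_real 0 * Z1 + of_real 1 * Z2 + w2) * ((of_real 1 * Z1 + of_real 0 * Z2 + w1) - \<i> * (of_real 0 * Z1 + of_real 1 * Z2 + w2))
        + d * (of_real 1 * Z1 + of_real 0 * Z2 + w1) + e * (of_real 0 * Z1 + of_real 1 * Z2 + w2) + f
        = \<alpha> * (Z2 * (Z1 - \<i> * Z2) - k)"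
      unfolding f d e by (simp add: algebra_simps)
    then show "(\<alpha> * (of_real 0 * Z1 + of_real 1 * Z2 + w2) * ((of_real 1 * Z1 + of_real 0 * Z2 + w1) - \<i> * (of_real 0 * Z1 + of_real 1 * Z2 + w2))
        + d * (of_real 1 * Z1 + of_real 0 * Z2 + w1) + e * (of_real 0 * Z1 + of_real 1 * Z2 + w2) + f = 0)
        \<longleftrightarrow> (Z2 * (Z1 - \<i> * Z2) = k)"
      using \<alpha> by simp
  qed simp
  then show ?thesis using class_2b_shape_mixed_product by (rule class_2b_shape_transfer)
qed

section \<open>The classes of conics\<close>

lemma mem_CP1:
  assumes "\<xi> \<in> CP1" "(u, v) \<in> \<xi>"
  shows "(u, v) \<noteq> (0, 0)" "\<xi> = proj_point u v"
proof -
  obtain u0 v0 where uv0: "\<xi> = proj_point u0 v0" "(u0, v0) \<noteq> (0, 0)" using assms(1) unfolding CP1_def by blast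
  then obtain t where t: "t \<noteq> 0" "u = t * u0" "v = t * v0" using assms(2) unfolding proj_point_def by blast
  show "(u, v) \<noteq> (0, 0)" using t uv0 by auto
  show "\<xi> = proj_point u v" unfolding uv0(1)
  proof (intro Set.set_eqI iffI)
    fix x assume "x \<in> proj_point u0 v0"
    then obtain r where r: "r \<noteq> 0" "x = (r * u0, r * v0)" unfolding proj_point_def by blast
    then have "x = ((r / t) * u, (r / t) * v)" "r / t \<noteq> 0" using t by simp_all
    then show "x \<in> proj_point u v" unfolding proj_point_def by blast
  next
    fix x assume "x \<in> proj_point u v"
    then obtain r where r: "r \<noteq> 0" "x = (r * u, r * v)" unfolding proj_point_def by blast
    then have "x = ((r * t) * u0, (r * t) * v0)" "r * t \<noteq> 0" using t by simp_all
    then show "x \<in> proj_point u0 v0" unfolding proj_point_def by blast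
  qed
qed

lemma proj_point_eqI:
  assumes "\<xi> \<in> CP1" "(u, v) \<in> \<xi>" "\<eta> \<in> CP1" "(u', v') \<in> \<eta>" "c \<noteq> 0" "u' = c * u" "v' = c * v"
  shows "\<xi> = \<eta>"
proof -
  have "(u', v') \<in> \<xi>" unfolding mem_CP1(2)[OF assms(1,2)] proj_point_def using assms(5-7) by blast
  then show ?thesis using mem_CP1(2)[OF assms(1)] mem_CP1(2)[OF assms(3,4)] by simp
qed

lemma mem_RP1:
  assumes "\<xi> \<in> RP1" "(u, v) \<in> \<xi>"
  obtains \<tau> s t where "\<tau> \<noteq> 0" "s \<noteq> 0 \<or> t \<noteq> 0" "u = \<tau> * of_real s" "v = \<tau> * of_real t"
  using assms unfolding RP1_def proj_point_def by auto

text \<open>The point (1 : 0) is real, and (u : v) = (u / v : 1) is real whenever u / v is. So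
  non-real roots have an affine coordinate, and it lies off the real axis.\<close>

lemma mem_nonreal:
  assumes \<xi>: "\<xi> \<in> CP1" "\<xi> \<notin> RP1" and uv: "(u, v) \<in> \<xi>"
  shows "v \<noteq> 0" "Im (u / v) \<noteq> 0"
proof -
  note m = mem_CP1[OF \<xi>(1) uv]
  have self: "(x, y) \<in> proj_point x y" for x y
    unfolding proj_point_def by (intro CollectI exI[of _ 1]) simp
  have real: "proj_point (of_real s) (of_real t) \<in> RP1" "proj_point (of_real s) (of_real t) \<in> CP1"
    if "s \<noteq> 0 \<or> t \<noteq> 0" for s t
  proof -
    have "(s, t) \<noteq> (0, 0)" "(complex_of_real s, complex_of_real t) \<noteq> (0, 0)" using that by auto
    then show "proj_point (of_real s) (of_real t) \<in> RP1" "proj_point (of_real s) (of_real t) \<in> CP1"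
      unfolding RP1_def CP1_def by blast+
  qed
  show v: "v \<noteq> 0"
  proof
    assume "v = 0"
    then have "\<xi> = proj_point (of_real 1) (of_real 0)"
      using m(1) by (intro proj_point_eqI[OF \<xi>(1) uv real(2) self, where c = "1 / u"]) auto
    then show False using \<xi>(2) real(1)[of 1 0] by simp
  qed
  show "Im (u / v) \<noteq> 0"
  proof
    assume "Im (u / v) = 0"
    then have "of_real (Re (u / v)) = u / v" by (simp add: complex_eq_iff)
    then have "\<xi> = proj_point (of_real (Re (u / v))) (of_real 1)"
      using v by (intro proj_point_eqI[OF \<xi>(1) uv real(2) self, where c = "1 / v"]) auto
    then show False using \<xi>(2) real(1)[of "Re (u / v)" 1] by simp
  qed
qed

lemma init_roots_imaginary_set:
  assumes "init_roots p \<xi> \<eta>"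
  obtains u v u' v' d e f where "\<xi> \<in> CP1" "\<eta> \<in> CP1" "(u, v) \<in> \<xi>" "(u', v') \<in> \<eta>"
    "imaginary_projection p = imaginary_set (\<lambda>z1 z2. (v * z1 - u * z2) * (v' * z1 - u' * z2) + d * z1 + e * z2 + f = 0)"
proof -
  obtain u v u' v' where uv: "\<xi> \<in> CP1" "\<eta> \<in> CP1" "(u, v) \<in> \<xi>" "(u', v') \<in> \<eta>"
    "\<And>z1 z2. init_form p z1 z2 = (v * z1 - u * z2) * (v' * z1 - u' * z2)"
    using assms unfolding init_roots_def by blast
  obtain a b c d e f where p: "p = Quad a b c d e f" by (cases p)
  have "peval p z1 z2 = init_form p z1 z2 + d * z1 + e * z2 + f" for z1 z2 unfolding p by simp
  then show thesis using that[OF uv(1-4), of d e f] unfolding imaginary_projection_imaginary_set uv(5) by simp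
qed

lemma class_1a_imp_class_1a_shape:
  assumes "class_1a p"
  shows "class_1a_shape (- imaginary_projection p)"
proof -
  obtain \<xi> where \<xi>: "init_roots p \<xi> \<xi>" "\<xi> \<in> RP1" using assms unfolding class_1a_def by blast
  obtain u v u' v' d e f where uv: "(u, v) \<in> \<xi>" "(u', v') \<in> \<xi>" "\<xi> \<in> CP1"
    and I: "imaginary_projection p = imaginary_set (\<lambda>z1 z2. (v * z1 - u * z2) * (v' * z1 - u' * z2) + d * z1 + e * z2 + f = 0)"
    by (rule init_roots_imaginary_set[OF \<xi>(1)]) (rule that; assumption)
  obtain \<tau> s t where \<tau>: "\<tau> \<noteq> 0" "s \<noteq> 0 \<or> t \<noteq> 0" "u = \<tau> * of_real s" "v = \<tau> * of_real t"
    using mem_RP1[OF \<xi>(2) uv(1)] .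
  obtain \<kappa> where \<kappa>: "\<kappa> \<noteq> 0" "u' = \<kappa> * u" "v' = \<kappa> * v"
    using uv(2) unfolding mem_CP1(2)[OF uv(3,1)] proj_point_def by blast
  define n where "n = s\<^sup>2 + t\<^sup>2"
  have n: "n \<noteq> 0" unfolding n_def using \<tau>(2) by (simp add: sum_power2_eq_zero_iff)
  define \<alpha> where "\<alpha> = \<kappa> * \<tau>\<^sup>2 * (of_real n)\<^sup>2"
  have \<alpha>: "\<alpha> \<noteq> 0" unfolding \<alpha>_def using \<kappa> \<tau> n by simp
  have "\<exists>\<phi>. affine_map \<phi> \<and> - imaginary_projection p = \<phi> ` (- imaginary_set (\<lambda>Z1 Z2. \<alpha> * Z1\<^sup>2
     + (d * of_real t - e * of_real s) * Z1 + (d * of_real s + e * of_real t) * Z2 + f = 0))"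
    unfolding I
  \<comment> \<open>The columns are (t, - s) and the real root (s, t), orthogonal to it; both linear
    factors vanish on the second column and become multiples of Z1. The arguments of
    \<open>of\<close> are in the order a, d, b, c.\<close>
  proof (rule compl_imaginary_set_aff[of t t s "- s" _ 0 0])
    show "t * t - s * - s \<noteq> 0" using n unfolding n_def by (simp add: power2_eq_square add.commute)
    fix Z1 Z2 :: complex
    have "(v * (of_real t * Z1 + of_real s * Z2 + 0) - u * (of_real (- s) * Z1 + of_real t * Z2 + 0)) *
       (v' * (of_real t * Z1 + of_real s * Z2 + 0) - u' * (of_real (- s) * Z1 + of_real t * Z2 + 0))
       = \<alpha> * Z1\<^sup>2"
      unfolding \<kappa> \<tau> \<alpha>_def n_def by (simp add: power2_eq_square algebra_simps)
    then show "((v * (of_real t * Z1 + of_real s * Z2 + 0) - u * (of_real (- s) * Z1 + of_real t * Z2 + 0)) *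
       (v' * (of_real t * Z1 + of_real s * Z2 + 0) - u' * (of_real (- s) * Z1 + of_real t * Z2 + 0))
       + d * (of_real t * Z1 + of_real s * Z2 + 0) + e * (of_real (- s) * Z1 + of_real t * Z2 + 0) + f = 0)
       \<longleftrightarrow> (\<alpha> * Z1\<^sup>2 + (d * of_real t - e * of_real s) * Z1 + (d * of_real s + e * of_real t) * Z2 + f = 0)"
      by (simp add: algebra_simps)
  qed
  then show ?thesis using class_1a_shape_conic[OF \<alpha>] by (rule class_1a_shape_transfer)
qed

lemma class_1b_imp_class_1b_shape:
  assumes "class_1b p"
  shows "class_1b_shape (- imaginary_projection p)"
proof -
  obtain \<xi> \<eta> where \<xi>: "init_roots p \<xi> \<eta>" "\<xi> \<noteq> \<eta>" "\<xi> \<in> RP1" "\<eta> \<in> RP1" using assms unfolding class_1b_def by blast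
  obtain u v u' v' d e f where uv: "(u, v) \<in> \<xi>" "(u', v') \<in> \<eta>" "\<xi> \<in> CP1" "\<eta> \<in> CP1"
    and I: "imaginary_projection p = imaginary_set (\<lambda>z1 z2. (v * z1 - u * z2) * (v' * z1 - u' * z2) + d * z1 + e * z2 + f = 0)"
    by (rule init_roots_imaginary_set[OF \<xi>(1)]) (rule that; assumption)
  obtain \<tau> s t where \<tau>: "\<tau> \<noteq> 0" "s \<noteq> 0 \<or> t \<noteq> 0" "u = \<tau> * of_real s" "v = \<tau> * of_real t"
    using mem_RP1[OF \<xi>(3) uv(1)] .
  obtain \<tau>' s' t' where \<tau>': "\<tau>' \<noteq> 0" "s' \<noteq> 0 \<or> t' \<noteq> 0" "u' = \<tau>' * of_real s'" "v' = \<tau>' * of_real t'"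
    using mem_RP1[OF \<xi>(4) uv(2)] .
  define \<Delta> where "\<Delta> = s * t' - t * s'"
  have \<Delta>: "\<Delta> \<noteq> 0"
  proof
    assume "\<Delta> = 0"
    then have e: "s * t' = t * s'" unfolding \<Delta>_def by simp
    have "\<exists>r. r \<noteq> 0 \<and> s' = r * s \<and> t' = r * t"
    proof (cases "s = 0")
      case True
      then have "s' = 0" using e \<tau>(2) by simp
      then show ?thesis using True \<tau>(2) \<tau>'(2) by (intro exI[of _ "t' / t"]) simp
    next
      case False
      then have "s' \<noteq> 0" using e \<tau>'(2) by auto
      then show ?thesis using False e by (intro exI[of _ "s' / s"]) (simp add: field_simps)
    qed
    then obtain r where r: "r \<noteq> 0" "s' = r * s" "t' = r * t" by blast
    have "\<xi> = \<eta>"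
      by (rule proj_point_eqI[OF uv(3,1) uv(4,2), where c = "\<tau>' * of_real r / \<tau>"]) (use r \<tau> \<tau>' in simp_all)
    then show False using \<xi>(2) by simp
  qed
  define \<alpha> where "\<alpha> = \<tau> * \<tau>' * (of_real \<Delta>)\<^sup>2"
  have \<alpha>: "\<alpha> \<noteq> 0" unfolding \<alpha>_def using \<tau> \<tau>' \<Delta> by simp
  have "\<exists>\<phi>. affine_map \<phi> \<and> - imaginary_projection p = \<phi> ` (- imaginary_set (\<lambda>Z1 Z2. \<alpha> * Z1 * Z2
     + (- d * of_real s' - e * of_real t') * Z1 + (d * of_real s + e * of_real t) * Z2 + f = 0))"
    unfolding I
  \<comment> \<open>The columns are the two roots, one with reversed sign, so each linear factor
    vanishes on one of them and is a multiple of the other coordinate.\<close>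
  proof (rule compl_imaginary_set_aff[of "- s'" t s "- t'" _ 0 0])
    show "- s' * t - s * - t' \<noteq> 0" using \<Delta> unfolding \<Delta>_def by (simp add: mult.commute)
    fix Z1 Z2 :: complex
    have "(v * (of_real (- s') * Z1 + of_real s * Z2 + 0) - u * (of_real (- t') * Z1 + of_real t * Z2 + 0)) *
       (v' * (of_real (- s') * Z1 + of_real s * Z2 + 0) - u' * (of_real (- t') * Z1 + of_real t * Z2 + 0))
       = \<alpha> * Z1 * Z2"
      unfolding \<tau> \<tau>' \<alpha>_def \<Delta>_def by (simp add: power2_eq_square algebra_simps)
    then show "((v * (of_real (- s') * Z1 + of_real s * Z2 + 0) - u * (of_real (- t') * Z1 + of_real t * Z2 + 0)) *
       (v' * (of_real (- s') * Z1 + of_real s * Z2 + 0) - u' * (of_real (- t') * Z1 + of_real t * Z2 + 0))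
       + d * (of_real (- s') * Z1 + of_real s * Z2 + 0) + e * (of_real (- t') * Z1 + of_real t * Z2 + 0) + f = 0)
       \<longleftrightarrow> (\<alpha> * Z1 * Z2 + (- d * of_real s' - e * of_real t') * Z1 + (d * of_real s + e * of_real t) * Z2 + f = 0)"
      by (simp add: algebra_simps)
  qed
  then show ?thesis using class_1b_shape_conic[OF \<alpha>] by (rule class_1b_shape_transfer)
qed

lemma class_2b_imp_class_2b_shape:
  assumes "class_2b p"
  shows "class_2b_shape (- imaginary_projection p)"
proof -
  obtain \<xi> \<eta> where \<xi>: "init_roots p \<xi> \<eta>" "\<xi> \<in> RP1" "\<eta> \<notin> RP1" using assms unfolding class_2b_def by blast
  obtain u v u' v' d e f where uv: "(u, v) \<in> \<xi>" "(u', v') \<in> \<eta>" "\<xi> \<in> CP1" "\<eta> \<in> CP1"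
    and I: "imaginary_projection p = imaginary_set (\<lambda>z1 z2. (v * z1 - u * z2) * (v' * z1 - u' * z2) + d * z1 + e * z2 + f = 0)"
    by (rule init_roots_imaginary_set[OF \<xi>(1)]) (rule that; assumption)
  obtain \<tau> s t where \<tau>: "\<tau> \<noteq> 0" "s \<noteq> 0 \<or> t \<noteq> 0" "u = \<tau> * of_real s" "v = \<tau> * of_real t"
    using mem_RP1[OF \<xi>(2) uv(1)] .
  define \<rho> where "\<rho> = u' / v'"
  have v': "v' \<noteq> 0" and "Im \<rho> \<noteq> 0" using mem_nonreal[OF uv(4) \<xi>(3) uv(2)] unfolding \<rho>_def by auto
  define r m where "r = Re \<rho>" "m = Im \<rho>"
  note rm = this
  have m: "m \<noteq> 0" using \<open>Im \<rho> \<noteq> 0\<close> rm by simp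
  have \<rho>: "\<rho> = of_real r + \<i> * of_real m" unfolding rm by (simp add: complex_eq_iff)
  have u': "u' = v' * \<rho>" unfolding \<rho>_def using v' by simp
  \<comment> \<open>In the coordinates ((z1 - r * z2) / m, z2) the non-real root becomes i and the
    real one (q : t). The rotation and scaling with entries q and t preserves the root i and carries
    the real root to Z2 = 0, which explains the columns (a, t) and (b, q) below.\<close>
  define q where "q = (s - r * t) / m"
  have s: "s = m * q + r * t" unfolding q_def using m by simp
  have qt: "q \<noteq> 0 \<or> t \<noteq> 0" using \<tau>(2) s by auto
  then have n: "q\<^sup>2 + t\<^sup>2 \<noteq> 0" by (simp add: sum_power2_eq_zero_iff)
  have qt': "of_real q - \<i> * of_real t \<noteq> 0" using qt by (auto simp: complex_eq_iff)
  define \<alpha> where "\<alpha> = - (\<tau> * v' * (of_real m)\<^sup>2 * of_real (q\<^sup>2 + t\<^sup>2) * (of_real q - \<i> * of_real t))"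
  have \<alpha>: "\<alpha> \<noteq> 0" unfolding \<alpha>_def using \<tau>(1) v' m n qt' by (simp del: of_real_add)
  define a b where "a = m * q + r * t" "b = - m * t + r * q"
  note ab = this
  have "\<exists>\<phi>. affine_map \<phi> \<and> - imaginary_projection p = \<phi> ` (- imaginary_set (\<lambda>Z1 Z2. \<alpha> * Z2 * (Z1 - \<i> * Z2)
     + (d * of_real a + e * of_real t) * Z1 + (d * of_real b + e * of_real q) * Z2 + f = 0))"
    unfolding I
  proof (rule compl_imaginary_set_aff[of a q b t _ 0 0])
    have "a * q - b * t = m * (q\<^sup>2 + t\<^sup>2)" unfolding ab by (simp add: power2_eq_square algebra_simps)
    then show "a * q - b * t \<noteq> 0" using m n by simp
    fix Z1 Z2 :: complex
    have 1: "v * (of_real a * Z1 + of_real b * Z2 + 0) - u * (of_real t * Z1 + of_real q * Z2 + 0)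
       = - \<tau> * of_real m * of_real (q\<^sup>2 + t\<^sup>2) * Z2"
      unfolding \<tau> s ab by (simp add: power2_eq_square algebra_simps)
    have ii: "\<i> * (\<i> * x) = - x" for x by (simp flip: mult.assoc)
    have 2: "v' * (of_real a * Z1 + of_real b * Z2 + 0) - u' * (of_real t * Z1 + of_real q * Z2 + 0)
       = v' * of_real m * (of_real q - \<i> * of_real t) * (Z1 - \<i> * Z2)"
      unfolding u' \<rho> ab by (simp add: algebra_simps ii)
    have "(v * (of_real a * Z1 + of_real b * Z2 + 0) - u * (of_real t * Z1 + of_real q * Z2 + 0)) *
       (v' * (of_real a * Z1 + of_real b * Z2 + 0) - u' * (of_real t * Z1 + of_real q * Z2 + 0))
       = \<alpha> * Z2 * (Z1 - \<i> * Z2)"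
      unfolding 1 2 \<alpha>_def by (simp add: power2_eq_square del: of_real_add)
    then show "((v * (of_real a * Z1 + of_real b * Z2 + 0) - u * (of_real t * Z1 + of_real q * Z2 + 0)) *
       (v' * (of_real a * Z1 + of_real b * Z2 + 0) - u' * (of_real t * Z1 + of_real q * Z2 + 0))
       + d * (of_real a * Z1 + of_real b * Z2 + 0) + e * (of_real t * Z1 + of_real q * Z2 + 0) + f = 0)
       \<longleftrightarrow> (\<alpha> * Z2 * (Z1 - \<i> * Z2) + (d * of_real a + e * of_real t) * Z1 + (d * of_real b + e * of_real q) * Z2 + f = 0)"
      by (simp add: distrib_left distrib_right add.assoc add.left_commute mult.assoc)
  qed
  then show ?thesis using class_2b_shape_conic[OF \<alpha>] by (rule class_2b_shape_transfer)
qed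

lemma nonreal_roots_imaginary_set:
  assumes "init_roots p \<xi> \<eta>" "\<xi> \<notin> RP1" "\<eta> \<notin> RP1"
  obtains a \<rho> \<sigma> d e f where "a \<noteq> 0" "Im \<rho> \<noteq> 0" "Im \<sigma> \<noteq> 0" "\<xi> = \<eta> \<Longrightarrow> \<rho> = \<sigma>"
    "imaginary_projection p = imaginary_set (\<lambda>z1 z2. a * (z1 - \<rho> * z2) * (z1 - \<sigma> * z2) + d * z1 + e * z2 + f = 0)"
proof -
  obtain u v u' v' d e f where uv: "(u, v) \<in> \<xi>" "(u', v') \<in> \<eta>" "\<xi> \<in> CP1" "\<eta> \<in> CP1"
    and I: "imaginary_projection p = imaginary_set (\<lambda>z1 z2. (v * z1 - u * z2) * (v' * z1 - u' * z2) + d * z1 + e * z2 + f = 0)"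
    by (rule init_roots_imaginary_set[OF assms(1)]) (rule that; assumption)
  note 1 = mem_nonreal[OF uv(3) assms(2) uv(1)] and 2 = mem_nonreal[OF uv(4) assms(3) uv(2)]
  have "(v * z1 - u * z2) * (v' * z1 - u' * z2) = v * v' * (z1 - u / v * z2) * (z1 - u' / v' * z2)" for z1 z2
    using 1(1) 2(1) by (simp add: field_simps)
  moreover have "u / v = u' / v'" if "\<xi> = \<eta>"
    using uv(2) that unfolding mem_CP1(2)[OF uv(3,1)] proj_point_def by auto
  ultimately show thesis
    using that[of "v * v'" "u / v" "u' / v'" d e f] 1 2 I by simp
qed

lemma class_2a_empty:
  assumes "class_2a p"
  shows "- imaginary_projection p = {}"
proof -
  obtain \<xi> where \<xi>: "init_roots p \<xi> \<xi>" "\<xi> \<notin> RP1" using assms unfolding class_2a_def by blast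
  obtain a \<rho> \<sigma> d e f where *: "a \<noteq> 0" "Im \<rho> \<noteq> 0" "\<rho> = \<sigma>"
    "imaginary_projection p = imaginary_set (\<lambda>z1 z2. a * (z1 - \<rho> * z2) * (z1 - \<sigma> * z2) + d * z1 + e * z2 + f = 0)"
    by (rule nonreal_roots_imaginary_set[OF \<xi> \<xi>(2)]) (rule that; simp)
  have "Im \<rho> * Im \<sigma> > 0" using *(2,3) by (auto simp: zero_less_mult_iff)
  then show ?thesis using same_half_plane_imaginary_set[OF *(1)] *(4) by simp
qed

lemma class_2c_connected_bounded:
  assumes "class_2c p"
  shows "connected (- imaginary_projection p)" "bounded (- imaginary_projection p)"
proof -
  obtain \<xi> \<eta> where \<xi>: "init_roots p \<xi> \<eta>" "\<xi> \<notin> RP1" "\<eta> \<notin> RP1" using assms unfolding class_2c_def by blast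
  obtain a \<rho> \<sigma> d e f where *: "a \<noteq> 0" "Im \<rho> \<noteq> 0" "Im \<sigma> \<noteq> 0"
    "imaginary_projection p = imaginary_set (\<lambda>z1 z2. a * (z1 - \<rho> * z2) * (z1 - \<sigma> * z2) + d * z1 + e * z2 + f = 0)"
    by (rule nonreal_roots_imaginary_set[OF \<xi>]) (rule that; assumption)
  have swap: "a * (z1 - \<rho> * z2) * (z1 - \<sigma> * z2) = a * (z1 - \<sigma> * z2) * (z1 - \<rho> * z2)" for z1 z2
    by (simp add: mult_ac)
  consider "Im \<rho> * Im \<sigma> > 0" | "Im \<rho> > 0" "Im \<sigma> < 0" | "Im \<sigma> > 0" "Im \<rho> < 0"
    using *(2,3) by (auto simp: zero_less_mult_iff linorder_neq_iff)
  then have "connected (- imaginary_projection p) \<and> bounded (- imaginary_projection p)"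
  proof cases
    case 1
    then show ?thesis using same_half_plane_imaginary_set[OF *(1)] *(4) by simp
  next
    case 2
    then show ?thesis using opposite_half_planes_imaginary_set[OF *(1)] unfolding *(4) by blast
  next
    case 3
    then show ?thesis using opposite_half_planes_imaginary_set[OF *(1) 3] unfolding *(4) swap by blast
  qed
  then show "connected (- imaginary_projection p)" "bounded (- imaginary_projection p)" by auto
qed

section \<open>Examples with two distinct non-real roots\<close>

text \<open>Serves the two examples of the theorem, whose initial forms have no mixed term and hence
  opposite roots.\<close>

lemma class_2cI:
  assumes p: "complex_conic p" "\<And>z1 z2. init_form p z1 z2 = (z1 - \<rho> * z2) * (z1 + \<rho> * z2)" and \<rho>: "Im \<rho> \<noteq> 0"
  shows "class_2c p"
proof -
  have mem: "(\<sigma>, 1) \<in> proj_point \<sigma> 1" "proj_point \<sigma> 1 \<in> CP1" for \<sigma>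
  proof -
    have "(\<sigma>, 1) \<noteq> (0, 0 :: complex)" by simp
    then show "proj_point \<sigma> 1 \<in> CP1" unfolding CP1_def by blast
    show "(\<sigma>, 1) \<in> proj_point \<sigma> 1" unfolding proj_point_def by (intro CollectI exI[of _ 1]) simp
  qed
  have nonreal: "proj_point \<sigma> 1 \<notin> RP1" if "Im \<sigma> \<noteq> 0" for \<sigma>
  proof
    assume "proj_point \<sigma> 1 \<in> RP1"
    from mem_RP1[OF this mem(1)] obtain \<tau> s t where st: "\<sigma> = \<tau> * of_real s" "1 = \<tau> * of_real t" by blast
    then have "t \<noteq> 0" by auto
    then have "\<tau> = of_real (1 / t)" using st(2) by (simp add: eq_divide_eq)
    then show False using that st(1) by simp
  qed
  have "proj_point \<rho> 1 \<noteq> proj_point (- \<rho>) 1"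
  proof
    assume "proj_point \<rho> 1 = proj_point (- \<rho>) 1"
    then have "(\<rho>, 1) \<in> proj_point (- \<rho>) 1" using mem(1) by metis
    then show False using \<rho> unfolding proj_point_def by auto
  qed
  moreover have "init_roots p (proj_point \<rho> 1) (proj_point (- \<rho>) 1)"
    unfolding init_roots_def
  proof (intro conjI mem exI)
    show "\<forall>z1 z2. init_form p z1 z2 = (1 * z1 - \<rho> * z2) * (1 * z1 - - \<rho> * z2)" unfolding p(2) by simp
  qed (rule mem)+
  ultimately show ?thesis unfolding class_2c_def using p(1) nonreal[of \<rho>] nonreal[of "- \<rho>"] \<rho> by auto
qed

lemma circle_imaginary_projection:
  "imaginary_projection (Quad 1 0 1 0 0 1) = {x. 1 \<le> (fst x)\<^sup>2 + (snd x)\<^sup>2}"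
proof (intro Set.set_eqI)
  fix x :: "real \<times> real"
  obtain y1 y2 where x: "x = (y1, y2)" by fastforce
  have "x \<in> imaginary_projection (Quad 1 0 1 0 0 1) \<longleftrightarrow>
      (\<exists>x1 x2. x1\<^sup>2 + x2\<^sup>2 + 1 = y1\<^sup>2 + y2\<^sup>2 \<and> 2 * (x1 * y1) + 2 * (x2 * y2) = 0)"
    unfolding x imaginary_projection_imaginary_set imaginary_set_iff
    by (simp add: complex_eq_iff power2_eq_square algebra_simps)
  also have "\<dots> \<longleftrightarrow> 1 \<le> y1\<^sup>2 + y2\<^sup>2"
  proof
    assume le: "1 \<le> y1\<^sup>2 + y2\<^sup>2"
    define n where "n = y1\<^sup>2 + y2\<^sup>2"
    \<comment> \<open>The real part is taken orthogonal to (y1, y2), which kills the imaginary part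
      of the equation; the factor s then gives it the square norm n - 1.\<close>
    define s where "s = sqrt ((n - 1) / n)"
    have s: "s\<^sup>2 * n = n - 1" unfolding s_def using le[folded n_def] by simp
    have "(- s * y2)\<^sup>2 + (s * y1)\<^sup>2 + 1 = n" using s unfolding n_def by (simp add: power_mult_distrib algebra_simps)
    then have "(- s * y2)\<^sup>2 + (s * y1)\<^sup>2 + 1 = y1\<^sup>2 + y2\<^sup>2" "2 * (- s * y2 * y1) + 2 * (s * y1 * y2) = 0" unfolding n_def by simp_all
    then show "\<exists>x1 x2. x1\<^sup>2 + x2\<^sup>2 + 1 = y1\<^sup>2 + y2\<^sup>2 \<and> 2 * (x1 * y1) + 2 * (x2 * y2) = 0" by blast
  next
    assume "\<exists>x1 x2. x1\<^sup>2 + x2\<^sup>2 + 1 = y1\<^sup>2 + y2\<^sup>2 \<and> 2 * (x1 * y1) + 2 * (x2 * y2) = 0"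
    then obtain x1 x2 where "x1\<^sup>2 + x2\<^sup>2 + 1 = y1\<^sup>2 + y2\<^sup>2" by blast
    then show "1 \<le> y1\<^sup>2 + y2\<^sup>2" using zero_le_power2[of x1] zero_le_power2[of x2] by linarith
  qed
  finally show "x \<in> imaginary_projection (Quad 1 0 1 0 0 1) \<longleftrightarrow> x \<in> {x. 1 \<le> (fst x)\<^sup>2 + (snd x)\<^sup>2}"
    unfolding x by simp
qed

lemma class_2c_components:
  assumes "class_2c p" "- imaginary_projection p \<noteq> {}"
  shows "components (- imaginary_projection p) = {- imaginary_projection p}"
  unfolding components_eq_sing_iff using class_2c_connected_bounded(1)[OF assms(1)] assms(2) by (rule conjI)

theorem theorem5p1:
  shows "(\<forall>p. complex_conic p \<longrightarrow>
      (let Ic = - imaginary_projection p in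
        (class_1a p \<longrightarrow>
           card (components Ic) \<in> {1, 2, 3} \<and> (\<forall>C \<in> components Ic. \<not> bounded C)) \<and>
        (class_1b p \<longrightarrow>
           card {C \<in> components Ic. \<not> bounded C} = 4 \<and>
           (\<exists>y. \<forall>C \<in> components Ic. bounded C \<longrightarrow> C = {y})) \<and>
        (class_2a p \<longrightarrow> Ic = {}) \<and>
        (class_2b p \<longrightarrow>
           Ic = {} \<or> (\<exists>y. Ic = {y}) \<or>
           (\<exists>y w. y \<noteq> w \<and> open_segment y w \<subseteq> Ic \<and> Ic \<subseteq> closed_segment y w)) \<and>
        (class_2c p \<longrightarrow>
           Ic = {} \<or> (\<exists>C. components Ic = {C} \<and> bounded C)) \<and>
        (class_1a p \<or> class_1b p \<or> class_2a p \<or> class_2b p \<longrightarrow>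
           (\<forall>C \<in> components Ic. spectrahedral C))))
    \<and> (\<exists>p C. class_2c p \<and> components (- imaginary_projection p) = {C} \<and> bounded C \<and> open C)
    \<and> (\<exists>p C. class_2c p \<and> C \<in> components (- imaginary_projection p) \<and> \<not> spectrahedral C)"
proof (intro conjI)
  show "\<forall>p. complex_conic p \<longrightarrow>
      (let Ic = - imaginary_projection p in
        (class_1a p \<longrightarrow>
           card (components Ic) \<in> {1, 2, 3} \<and> (\<forall>C \<in> components Ic. \<not> bounded C)) \<and>
        (class_1b p \<longrightarrow>
           card {C \<in> components Ic. \<not> bounded C} = 4 \<and>
           (\<exists>y. \<forall>C \<in> components Ic. bounded C \<longrightarrow> C = {y})) \<and>
        (class_2a p \<longrightarrow> Ic = {}) \<and>
        (class_2b p \<longrightarrow>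
           Ic = {} \<or> (\<exists>y. Ic = {y}) \<or>
           (\<exists>y w. y \<noteq> w \<and> open_segment y w \<subseteq> Ic \<and> Ic \<subseteq> closed_segment y w)) \<and>
        (class_2c p \<longrightarrow>
           Ic = {} \<or> (\<exists>C. components Ic = {C} \<and> bounded C)) \<and>
        (class_1a p \<or> class_1b p \<or> class_2a p \<or> class_2b p \<longrightarrow>
           (\<forall>C \<in> components Ic. spectrahedral C)))"
    unfolding Let_def
  proof (rule allI, rule impI, intro conjI impI)
    fix p
    show "card (components (- imaginary_projection p)) \<in> {1, 2, 3}" if "class_1a p"
      using class_1a_imp_class_1a_shape[OF that] unfolding class_1a_shape_def by (rule conjunct1)
    show "\<forall>C\<in>components (- imaginary_projection p). \<not> bounded C" if "class_1a p"
      using class_1a_imp_class_1a_shape[OF that] unfolding class_1a_shape_def by simp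
    show "card {C \<in> components (- imaginary_projection p). \<not> bounded C} = 4" if "class_1b p"
      using class_1b_imp_class_1b_shape[OF that] unfolding class_1b_shape_def by (rule conjunct1)
    show "\<exists>y. \<forall>C\<in>components (- imaginary_projection p). bounded C \<longrightarrow> C = {y}" if "class_1b p"
      using class_1b_imp_class_1b_shape[OF that] unfolding class_1b_shape_def by (elim conjE)
    show "- imaginary_projection p = {}" if "class_2a p" using class_2a_empty[OF that] .
    show "- imaginary_projection p = {} \<or> (\<exists>y. - imaginary_projection p = {y}) \<or>
        (\<exists>y w. y \<noteq> w \<and> open_segment y w \<subseteq> - imaginary_projection p \<and> - imaginary_projection p \<subseteq> closed_segment y w)"
      if "class_2b p"
      using class_2b_imp_class_2b_shape[OF that] unfolding class_2b_shape_def by (rule conjunct1)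
    show "- imaginary_projection p = {} \<or> (\<exists>C. components (- imaginary_projection p) = {C} \<and> bounded C)" if "class_2c p"
      using class_2c_components[OF that] class_2c_connected_bounded(2)[OF that] by blast
    show "\<forall>C\<in>components (- imaginary_projection p). spectrahedral C"
      if "class_1a p \<or> class_1b p \<or> class_2a p \<or> class_2b p"
    proof -
      have "\<forall>C\<in>components (- imaginary_projection p). spectrahedral2 C"
        using that class_1a_imp_class_1a_shape[of p] class_1b_imp_class_1b_shape[of p] class_2a_empty[of p] class_2b_imp_class_2b_shape[of p]
        unfolding class_1a_shape_def class_1b_shape_def class_2b_shape_def by (elim disjE) simp_all
      then show ?thesis using spectrahedral2_imp_spectrahedral by blast
    qed
  qed
next
  define p where "p = Quad 1 0 1 0 0 1"
  have c: "class_2c p"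
    by (rule class_2cI[of _ \<i>]) (auto simp: p_def power2_eq_square algebra_simps)
  have Ic: "- imaginary_projection p = {x. (fst x)\<^sup>2 + (snd x)\<^sup>2 < 1}"
    unfolding p_def circle_imaginary_projection by auto
  then have "(0, 0) \<in> - imaginary_projection p" by simp
  then have "components (- imaginary_projection p) = {- imaginary_projection p}"
    using class_2c_components[OF c] by blast
  moreover have "open (- imaginary_projection p)"
    unfolding Ic by (intro open_Collect_less continuous_intros)
  ultimately show "\<exists>p C. class_2c p \<and> components (- imaginary_projection p) = {C} \<and> bounded C \<and> open C"
    using c class_2c_connected_bounded(2)[OF c] by blast
next
  define p where "p = Quad 1 0 \<i> 0 0 1"
  define \<rho> where "\<rho> = csqrt (- \<i>)"
  have \<rho>: "\<rho>\<^sup>2 = - \<i>" unfolding \<rho>_def by simp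
  have "Im \<rho> \<noteq> 0"
  proof
    assume "Im \<rho> = 0"
    then have "Im (\<rho>\<^sup>2) = 0" by (simp add: power2_eq_square)
    then show False unfolding \<rho> by simp
  qed
  moreover have "init_form p z1 z2 = (z1 - \<rho> * z2) * (z1 + \<rho> * z2)" for z1 z2
  proof -
    have "(z1 - \<rho> * z2) * (z1 + \<rho> * z2) = z1\<^sup>2 - \<rho>\<^sup>2 * z2\<^sup>2" by (simp add: power2_eq_square algebra_simps)
    then show ?thesis unfolding \<rho> p_def by simp
  qed
  moreover have "complex_conic p" unfolding p_def by simp
  ultimately have c: "class_2c p" by (intro class_2cI)
  have "imaginary_projection p = imaginary_set (\<lambda>z1 z2. z1\<^sup>2 + \<i> * z2\<^sup>2 = - 1)"
    unfolding imaginary_projection_imaginary_set p_def by (simp add: add_eq_0_iff2)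
  then have ns: "\<not> spectrahedral (- imaginary_projection p)" using cusp_conic_not_spectrahedral by simp
  \<comment> \<open>Since the empty set is spectrahedral, the complement is nonempty and is its own
    single component.\<close>
  have "spectrahedral2 {}"
    using spectrahedral2_strict_half_plane[OF affine_fun_const[of 0]] by simp
  then have "- imaginary_projection p \<noteq> {}" using ns spectrahedral2_imp_spectrahedral by metis
  then have "- imaginary_projection p \<in> components (- imaginary_projection p)"
    using class_2c_components[OF c] by simp
  then show "\<exists>p C. class_2c p \<and> C \<in> components (- imaginary_projection p) \<and> \<not> spectrahedral C"
    using c ns by blast
qed

end
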